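(* Let $n\ge1$ be an integer, $\nu>n/2$ real, and $m$ an integer with $0\le m<\nu-n/2$. Let $\{|z,\nu,m\rangle\}_{z\in\mathbb{B}^n}$ be the coherent states attached to $\mathcal{A}^{2,\nu}_m(\mathbb{B}^n)$ defined in the context. Let $\varphi\in L^2(\mathbb{B}^n,(1-|\xi|^2)^{-n-1}d\mu)$ and let $$A_\varphi=\int_{\mathbb{B}^n}|w,\nu,m\rangle\langle w,\nu,m|\,\varphi(w)\,\mathcal{N}(w)\,(1-|w|^2)^{-n-1}d\mu(w).$$ Then for every $z\in\mathbb{B}^n$ the expectation value $\mathbb{E}_{\{|z,\nu,m\rangle\}}(A_\varphi):=\langle z,\nu,m|A_\varphi|z,\nu,m\rangle$ is given by $$\mathbb{E}_{\{|z,\nu,m\rangle\}}(A_\varphi)=\frac{\Gamma(n)\,m!\,(2(\nu-m)-n)\,\Gamma(2\nu-m)}{n!\,\Gamma(n+m)\,\Gamma(2\nu-m-n+1)}\int_{\mathbb{B}^n}\left(\frac{(1-|z|^2)(1-|\xi|^2)}{|1-\langle z,\xi\rangle|^2}\right)^{2(\nu-m)}\Big(P_m^{(n-1,\,2(\nu-m)-n)}\big(1-2\tanh^2 d(z,\xi)\big)\Big)^2\frac{\varphi(\xi)}{(1-|\xi|^2)^{n+1}}\,d\mu(\xi).$$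
   Context: $\mathbb{B}^n=\{z\in\mathbb{C}^n:|z|<1\}$, $\langle z,w\rangle=\sum_j z_j\overline{w_j}$, and $\mu$ is Lebesgue measure on $\mathbb{C}^n$ normalized so that $\mu(\mathbb{B}^n)=1$. The unit sphere $\partial\mathbb{B}^n$ carries its normalized (total mass one) rotation-invariant measure $\sigma$. Put $d\mu_n(z)=(1-|z|^2)^{-n-1}d\mu(z)$. The Bergman distance $d(z,w)\ge0$ is given by $$\cosh^2 d(z,w)=\frac{|1-\langle z,w\rangle|^2}{(1-|z|^2)(1-|w|^2)}.$$ $P_k^{(\alpha,\beta)}$ are the Jacobi polynomials, with $P_k^{(\alpha,\beta)}(1)=\frac{\Gamma(k+\alpha+1)}{k!\,\Gamma(\alpha+1)}$. The Schr\"odinger operator with uniform magnetic field on $\mathbb{B}^n$ is $$H_\nu=-4(1-|z|^2)\Big(\sum_{i,j=1}^n(\delta_{ij}-z_i\overline{z_j})\frac{\partial^2}{\partial z_i\partial\overline{z}_j}+\nu\sum_{j=1}^n\big(z_j\tfrac{\partial}{\partial z_j}-\overline{z}_j\tfrac{\partial}{\partial\overline{z}_j}\big)+\nu^2\Big)+4\nu^2 ,$$ and the generalized Bergman space of index $m$ is $$\mathcal{A}^{2,\nu}_m(\mathbb{B}^n)=\{\varphi\in L^2(\mathbb{B}^n,d\mu_n): H_\nu\varphi=\epsilon_m^{\nu,n}\varphi\},\qquad \epsilon_m^{\nu,n}=4\nu(2m+n)-4m(m+n).$$ For $p,q\ge0$, $H(p,q)$ is the space of restrictions to $\partial\mathbb{B}^n$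 of harmonic polynomials on $\mathbb{C}^n$ homogeneous of degree $p$ in $z$ and degree $q$ in $\overline z$; $d(n,p,q)=\dim H(p,q)$; $\{h^j_{p,q}\}_{1\le j\le d(n,p,q)}$ is an orthonormal basis of $H(p,q)$ in $L^2(\partial\mathbb{B}^n,d\sigma)$, with $h^j_{p,q}(z,\overline z)$ the corresponding harmonic polynomial on $\mathbb{C}^n$. An orthonormal basis of $\mathcal{A}^{2,\nu}_m(\mathbb{B}^n)$ is given by $$\Phi^{\nu,m}_{p,q,j}(z)=\kappa_{p,q}^{\nu,m,n}(1-|z|^2)^{\nu-m}P_{m-q}^{(n+p+q-1,\,2(\nu-m)-n)}(1-2|z|^2)\,h^j_{p,q}(z,\overline z),$$ $$\kappa_{p,q}^{\nu,m,n}=\Big(\frac{n\,\Gamma(2\nu-m-n-q+1)\,\Gamma(p+n+m)}{(m-q)!\,(2(\nu-m)-n)\,\Gamma(2\nu-m+p)}\Big)^{-1/2},$$ with $p=0,1,2,\dots$, $q=0,\dots,m$, $j=1,\dots,d(n,p,q)$. Let $\mathcal{H}$ be a Hilbert space with an orthonormal basis $\{\varphi_{p,q,j}\}$ indexed by the same set. The coherent states are $$|z,\nu,m\rangle:=\mathcal{N}(z)^{-1/2}\sum_{p=0}^{+\infty}\sum_{q=0}^m\sum_{j=1}^{d(n,p,q)}\Phi^{\nu,m}_{p,q,j}(z)\,\varphi_{p,q,j}\in\mathcal{H},$$ where $\mathcal{N}(z)=\sum_{p,q,j}|\Phi^{\nu,m}_{p,q,j}(z)|^2$ is the normalization factor making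 $|z,\nu,m\rangle$ a unit vector. In Dirac notation, $|x\rangle\langle x|$ is the rank-one operator $u\mapsto\langle u,x\rangle_{\mathcal{H}}\,x$ (inner product linear in the first slot), and the operator-valued integral $A_\varphi$ is understood in the weak sense. *)

theory Defs
  imports "HOL-Analysis.Analysis" "HOL-Library.Function_Algebras"
begin

text \<open>
  Throughout, \<open>\<complex>\<^sup>n\<close> is \<^typ>\<open>complex^'n\<close> with \<open>n = CARD('n)\<close>, so its norm is the Euclidean
  norm and the unit ball is \<open>ball 0 1\<close>.
\<close>

subsection \<open>The ball: Hermitian product, measures, Bergman distance\<close>

definition hprod :: "complex^'n \<Rightarrow> complex^'n \<Rightarrow> complex" where
  "hprod z w = (\<Sum>j\<in>UNIV. z $ j * cnj (w $ j))"

definition mu_leb :: "(complex^'n) measure" where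
  "mu_leb = scale_measure (1 / emeasure lebesgue (ball 0 1 :: (complex^'n) set)) lebesgue"

definition mu_n :: "(complex^'n) measure" where
  "mu_n = density (restrict_space mu_leb (ball 0 1))
     (\<lambda>z. ennreal (1 / (1 - (norm z)\<^sup>2) ^ (CARD('n) + 1)))"

definition bergman_dist :: "complex^'n \<Rightarrow> complex^'n \<Rightarrow> real" where
  "bergman_dist z w = (THE d. 0 \<le> d \<and>
     (cosh d)\<^sup>2 = (cmod (1 - hprod z w))\<^sup>2 / ((1 - (norm z)\<^sup>2) * (1 - (norm w)\<^sup>2)))"

text \<open>The normalized rotation-invariant measure on the unit sphere, by its defining properties;
  the rotations are those of the underlying real space \<open>\<real>\<^sup>2\<^sup>n\<close>.\<close>

definition rotation_invariant_sphere_measure :: "(complex^'n) measure \<Rightarrow> bool" where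
  "rotation_invariant_sphere_measure \<sigma> \<longleftrightarrow>
     space \<sigma> = sphere 0 1 \<and>
     sets \<sigma> = sets (restrict_space borel (sphere 0 1)) \<and>
     emeasure \<sigma> (sphere 0 1) = 1 \<and>
     (\<forall>U. orthogonal_transformation U \<longrightarrow> distr \<sigma> \<sigma> U = \<sigma>)"

subsection \<open>Jacobi polynomials\<close>

definition jacobi_poly :: "nat \<Rightarrow> real \<Rightarrow> real \<Rightarrow> real \<Rightarrow> real" where
  "jacobi_poly k \<alpha> \<beta> x =
     (\<Sum>s\<le>k. ((real k + \<alpha>) gchoose (k - s)) * ((real k + \<beta>) gchoose s)
        * ((x - 1) / 2) ^ s * ((x + 1) / 2) ^ (k - s))"

text \<open>The normalization \<open>P\<^sub>k(1) = \<Gamma>(k + \<alpha> + 1) / (k! \<Gamma>(\<alpha> + 1))\<close>.\<close>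

lemma jacobi_poly_at_1:
  assumes "\<alpha> > - 1"
  shows "jacobi_poly k \<alpha> \<beta> 1 = Gamma (real k + \<alpha> + 1) / (fact k * Gamma (\<alpha> + 1))"
proof -
  have "jacobi_poly k \<alpha> \<beta> 1 = (\<Sum>s\<in>{0::nat}. (real k + \<alpha>) gchoose k)"
    unfolding jacobi_poly_def by (intro sum.mono_neutral_cong_right) auto
  also have "\<dots> = pochhammer (\<alpha> + 1) k / fact k"
    by (simp add: gbinomial_pochhammer')
  also have "pochhammer (\<alpha> + 1) k = Gamma (\<alpha> + 1 + real k) / Gamma (\<alpha> + 1)"
    by (rule pochhammer_Gamma) (use assms in \<open>auto elim!: nonpos_Ints_cases\<close>)
  finally show ?thesis by (simp add: algebra_simps)
qed

subsection \<open>Spherical harmonics of bidegree \<open>(p, q)\<close>\<close>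

definition bihomogeneous_poly :: "nat \<Rightarrow> nat \<Rightarrow> (complex^'n \<Rightarrow> complex) \<Rightarrow> bool" where
  "bihomogeneous_poly p q f \<longleftrightarrow>
     (\<exists>c. \<forall>z. f z = (\<Sum>a\<in>{a :: 'n \<Rightarrow> nat. sum a UNIV = p}. \<Sum>b\<in>{b :: 'n \<Rightarrow> nat. sum b UNIV = q}.
        c a b * (\<Prod>i\<in>UNIV. (z $ i) ^ a i) * (\<Prod>i\<in>UNIV. (cnj (z $ i)) ^ b i)))"

text \<open>The Laplacian of \<open>\<complex>\<^sup>n = \<real>\<^sup>2\<^sup>n\<close>; \<^term>\<open>Basis\<close> consists of the \<open>2n\<close> real coordinate directions.\<close>

definition laplacian :: "(complex^'n \<Rightarrow> complex) \<Rightarrow> complex^'n \<Rightarrow> complex" where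
  "laplacian f z = (\<Sum>b\<in>Basis. frechet_derivative (\<lambda>w. frechet_derivative f (at w) b) (at z) b)"

definition harmonic_polys :: "nat \<Rightarrow> nat \<Rightarrow> (complex^'n \<Rightarrow> complex) set" where
  "harmonic_polys p q = {f. bihomogeneous_poly p q f \<and> (\<forall>z. laplacian f z = 0)}"

text \<open>A function on the sphere is represented by its extension by zero, which makes the functions
  on the sphere a linear subspace of the complex vector space of all functions.\<close>

definition sphere_restr :: "(complex^'n \<Rightarrow> complex) \<Rightarrow> complex^'n \<Rightarrow> complex" where
  "sphere_restr f z = (if z \<in> sphere 0 1 then f z else 0)"

definition Hpq :: "nat \<Rightarrow> nat \<Rightarrow> (complex^'n \<Rightarrow> complex) set" where
  "Hpq p q = sphere_restr ` harmonic_polys p q"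

definition scale_fun :: "complex \<Rightarrow> ('a \<Rightarrow> complex) \<Rightarrow> 'a \<Rightarrow> complex" where
  "scale_fun c f = (\<lambda>z. c * f z)"

lemma vector_space_scale_fun: "vector_space scale_fun"
  by unfold_locales (auto simp: scale_fun_def fun_eq_iff algebra_simps)

definition dim_H :: "'n::finite itself \<Rightarrow> nat \<Rightarrow> nat \<Rightarrow> nat" where
  "dim_H _ p q = vector_space.dim scale_fun (Hpq p q :: (complex^'n \<Rightarrow> complex) set)"

text \<open>\<open>h p q j\<close>, for \<open>1 \<le> j \<le> d(n,p,q)\<close>, are harmonic polynomials on \<open>\<complex>\<^sup>n\<close> whose restrictions to
  the sphere form an orthonormal basis of \<open>Hpq p q\<close>.\<close>

definition orthonormal_harmonics ::
    "(complex^'n) measure \<Rightarrow> (nat \<Rightarrow> nat \<Rightarrow> nat \<Rightarrow> complex^'n \<Rightarrow> complex) \<Rightarrow> bool" where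
  "orthonormal_harmonics \<sigma> h \<longleftrightarrow> (\<forall>p q.
     (\<forall>j\<in>{1..dim_H TYPE('n) p q}. h p q j \<in> harmonic_polys p q) \<and>
     (\<forall>i\<in>{1..dim_H TYPE('n) p q}. \<forall>j\<in>{1..dim_H TYPE('n) p q}.
        (LINT z|\<sigma>. h p q i z * cnj (h p q j z)) = (if i = j then 1 else 0)) \<and>
     module.span scale_fun ((\<lambda>j. sphere_restr (h p q j)) ` {1..dim_H TYPE('n) p q}) = Hpq p q)"

subsection \<open>The basis functions of the generalized Bergman space\<close>

definition kappa :: "'n::finite itself \<Rightarrow> real \<Rightarrow> nat \<Rightarrow> nat \<Rightarrow> nat \<Rightarrow> real" where
  "kappa _ \<nu> m p q = (let n = real CARD('n) in
     ((n * Gamma (2 * \<nu> - real m - n - real q + 1) * Gamma (real p + n + real m))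
      / (fact (m - q) * (2 * (\<nu> - real m) - n) * Gamma (2 * \<nu> - real m + real p))) powr (- 1 / 2))"

definition Phi ::
    "(nat \<Rightarrow> nat \<Rightarrow> nat \<Rightarrow> complex^'n \<Rightarrow> complex) \<Rightarrow> real \<Rightarrow> nat \<Rightarrow> nat \<Rightarrow> nat \<Rightarrow> nat \<Rightarrow> complex^'n \<Rightarrow> complex" where
  "Phi h \<nu> m p q j z =
     of_real (kappa TYPE('n) \<nu> m p q * (1 - (norm z)\<^sup>2) powr (\<nu> - real m)
       * jacobi_poly (m - q) (real CARD('n) + real p + real q - 1) (2 * (\<nu> - real m) - real CARD('n))
           (1 - 2 * (norm z)\<^sup>2))
     * h p q j z"

subsection \<open>Complex Hilbert spaces\<close>

text \<open>A complex Hilbert space on a complete normed space: complex scalar multiplication \<open>sC\<close>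
  extending the real one, and an inner product \<open>ip\<close>, linear in the first slot, inducing the norm.\<close>

locale complex_hilbert =
  fixes sC :: "complex \<Rightarrow> 'h::banach \<Rightarrow> 'h"
    and ip :: "'h \<Rightarrow> 'h \<Rightarrow> complex"
  assumes vector_space_sC: "vector_space sC"
    and sC_of_real: "sC (of_real r) x = r *\<^sub>R x"
    and ip_add_left: "ip (x + y) u = ip x u + ip y u"
    and ip_sC_left: "ip (sC c x) u = c * ip x u"
    and ip_commute: "ip x y = cnj (ip y x)"
    and ip_self: "ip x x = of_real ((norm x)\<^sup>2)"

definition orthonormal_basis ::
    "(complex \<Rightarrow> 'h::banach \<Rightarrow> 'h) \<Rightarrow> ('h \<Rightarrow> 'h \<Rightarrow> complex) \<Rightarrow> 'i set \<Rightarrow> ('i \<Rightarrow> 'h) \<Rightarrow> bool" where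
  "orthonormal_basis sC ip I e \<longleftrightarrow>
     (\<forall>i\<in>I. \<forall>k\<in>I. ip (e i) (e k) = (if i = k then 1 else 0)) \<and>
     closure (module.span sC (e ` I)) = UNIV"

text \<open>The rank-one operator \<open>|x\<rangle>\<langle>x|\<close>.\<close>

definition rank_one ::
    "(complex \<Rightarrow> 'h::banach \<Rightarrow> 'h) \<Rightarrow> ('h \<Rightarrow> 'h \<Rightarrow> complex) \<Rightarrow> 'h \<Rightarrow> 'h \<Rightarrow> 'h" where
  "rank_one sC ip x u = sC (ip u x) x"

text \<open>The weak integral of an operator-valued function \<open>T\<close>: the operator \<open>A\<close> such that, for all
  \<open>u\<close> and \<open>v\<close>, \<open>w \<mapsto> \<langle>T(w)u, v\<rangle>\<close> is integrable with integral \<open>\<langle>Au, v\<rangle>\<close>.\<close>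

definition weak_integral ::
    "('h \<Rightarrow> 'h \<Rightarrow> complex) \<Rightarrow> 'a measure \<Rightarrow> ('a \<Rightarrow> 'h \<Rightarrow> 'h) \<Rightarrow> 'h \<Rightarrow> 'h" where
  "weak_integral ip M T =
     (THE A. \<forall>u v. has_bochner_integral M (\<lambda>w. ip (T w u) v) (ip (A u) v))"

subsection \<open>Coherent states\<close>

definition coh_index :: "'n::finite itself \<Rightarrow> nat \<Rightarrow> (nat \<times> nat \<times> nat) set" where
  "coh_index _ m = {(p, q, j). q \<le> m \<and> j \<in> {1..dim_H TYPE('n) p q}}"

definition coh_norm ::
    "(nat \<Rightarrow> nat \<Rightarrow> nat \<Rightarrow> complex^'n \<Rightarrow> complex) \<Rightarrow> real \<Rightarrow> nat \<Rightarrow> complex^'n \<Rightarrow> real" where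
  "coh_norm h \<nu> m z =
     (\<Sum>p. \<Sum>q\<le>m. \<Sum>j = 1..dim_H TYPE('n) p q. (cmod (Phi h \<nu> m p q j z))\<^sup>2)"

definition coh_state ::
    "(complex \<Rightarrow> 'h::banach \<Rightarrow> 'h) \<Rightarrow> (nat \<times> nat \<times> nat \<Rightarrow> 'h)
      \<Rightarrow> (nat \<Rightarrow> nat \<Rightarrow> nat \<Rightarrow> complex^'n \<Rightarrow> complex) \<Rightarrow> real \<Rightarrow> nat \<Rightarrow> complex^'n \<Rightarrow> 'h" where
  "coh_state sC e h \<nu> m z =
     (coh_norm h \<nu> m z) powr (- 1 / 2) *\<^sub>R
       (\<Sum>p. \<Sum>q\<le>m. \<Sum>j = 1..dim_H TYPE('n) p q. sC (Phi h \<nu> m p q j z) (e (p, q, j)))"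

definition A_op ::
    "(complex \<Rightarrow> 'h::banach \<Rightarrow> 'h) \<Rightarrow> ('h \<Rightarrow> 'h \<Rightarrow> complex) \<Rightarrow> (nat \<times> nat \<times> nat \<Rightarrow> 'h)
      \<Rightarrow> (nat \<Rightarrow> nat \<Rightarrow> nat \<Rightarrow> complex^'n \<Rightarrow> complex) \<Rightarrow> real \<Rightarrow> nat \<Rightarrow> (complex^'n \<Rightarrow> complex) \<Rightarrow> 'h \<Rightarrow> 'h" where
  "A_op sC ip e h \<nu> m \<phi> = weak_integral ip mu_n
     (\<lambda>w u. sC (\<phi> w * of_real (coh_norm h \<nu> m w)) (rank_one sC ip (coh_state sC e h \<nu> m w) u))"

definition exp_value ::
    "('h \<Rightarrow> 'h \<Rightarrow> complex) \<Rightarrow> 'h \<Rightarrow> ('h \<Rightarrow> 'h) \<Rightarrow> complex" where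
  "exp_value ip x A = ip (A x) x"

end

theory Submission
  imports Defs "HOL-Computational_Algebra.Polynomial"
begin

text \<open>
  The expectation value is the integral of \<open>\<phi>(\<xi>) |K(z,\<xi>)|\<^sup>2 / N\<close>, where \<open>K\<close> is the sum of
  the products of \<open>\<Phi>(z)\<close> and the conjugate of \<open>\<Phi>(\<xi>)\<close> over the basis and \<open>N = K(z,z)\<close> turns out to
  be constant, so the point is to sum \<open>K\<close> in closed form. The addition formula replaces the
  sum over \<open>j\<close> by a zonal harmonic. Expand in powers of \<open>s = \<langle>z,\<xi>\<rangle>\<close> and its conjugate: the
  coefficients are polynomials in \<open>X = 1 - |z|\<^sup>2\<close> and \<open>Y = 1 - |\<xi>|\<^sup>2\<close> which satisfy, in each variable,
  a recurrence expressing the eigenvalue equation of \<open>H\<^sub>\<nu>\<close> and determining them from their values at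
  \<open>X = 0\<close> or \<open>Y = 0\<close>. The expansion of the claimed closed form satisfies the same recurrence, and at
  \<open>X = Y = 0\<close> the two sides agree by a well-poised hypergeometric summation.

  For the weak integral to exist, the pairings of a fixed vector with the coherent states have to be
  square integrable: in polar coordinates the basis functions are seen to be orthogonal, and their
  norms are bounded by Gamma asymptotics.
\<close>

subsection \<open>The magnetic recurrence and the coefficients of the kernel\<close>

text \<open>A bidegree (p,q) contributes to s^A cnj(s)^B only if p = A + k and q = B + k with B + k
  \<le> m. Hence each coefficient is a finite sum although p is unbounded, and after the comparison
  of coefficients the only infinite summation left is over A. The order of the two variables
  matters: the recurrence runs in Y, while X enters only through R = 1 - X and a weight. It is used
  first at X = 0, where the starting value is the hypergeometric sum, and then for general X, where
  the first result, read as a polynomial in X, is the starting value. The kernel itself is not a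
  function of the Bergman distance, but its modulus is: |K| = c x^(\<nu>-m) |P_m(2x - 1)| with x =
  XY/|1 - s|^2 = 1 - tanh^2 d. On the diagonal x = 1, so N = c P_m(1), and the constant of the
  theorem is c^2/N = c/P_m(1). The sphere measure is known only through its invariance; every
  integral over the sphere is obtained by differentiating along rotations. The polar measure
  constructed later is tied to the given one by the common reproducing kernel.\<close>

definition wpt :: "real \<Rightarrow> nat \<Rightarrow> real" where
  "wpt c k = (if k = 0 then 1 else (c + 2 * real k) * pochhammer (c + 1) (k - 1))"

text \<open>For c > 0 the factor \<open>wpt c k\<close> is (c)_k (c + 2k)/c; the form without a
  division also covers c = 0, which occurs for n = 1. Up to the factor (1+c-d)_M/(1+c)_M the sum is
  the terminating very-well-poised series 4F3(c, 1+c/2, d, -M; c/2, 1+c-d, 1+c+M; -1). That factor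
  is kept inside the sum so that no denominator depends on d.\<close>

lemma well_poised_sum:
  fixes c d :: real
  assumes c: "c \<ge> 0"
  shows "(\<Sum>k\<le>M. (-1) ^ (M + k) * real (M choose k) * wpt c k * pochhammer d k
            * pochhammer (d - c - real M) (M - k) / pochhammer (c + 1) (M + k)) = 1"
proof (induction M)
  case 0
  show ?case by (simp add: wpt_def)
next
  case (Suc M)
  \<comment> \<open>\<open>F\<close> and \<open>G\<close> form a Wilf-Zeilberger pair: the difference in \<open>M\<close> telescopes in \<open>k\<close>.\<close>
  define F where "F M k = (-1) ^ (M + k) * real (M choose k) * wpt c k * pochhammer d k
            * pochhammer (d - c - real M) (M - k) / pochhammer (c + 1) (M + k)" for M k
  define G where "G k = (if k = 0 then 0 else (-1) ^ (M + k) * real (M choose (k - 1)) * pochhammer d k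
            * pochhammer (d - c - real M) (M + 1 - k) * pochhammer (c + 1) (k - 1) / pochhammer (c + 1) (M + k))" for k
  have pos: "pochhammer (c + 1) j > 0" for j
    by (rule pochhammer_pos) (use c in auto)
  have WZ: "F (Suc M) k = F M k + G (Suc k) - G k" if k: "k \<le> Suc M" for k
  proof -
    \<comment> \<open>The two ends are separated because \<open>k - 1\<close> and
      \<open>M - k\<close> are truncated there.\<close>
    consider "k = 0" | "k = Suc M" | j where "k = Suc j" "k \<le> M"
      using k by (cases k) (auto simp: le_Suc_eq)
    then show ?thesis
    proof cases
      case 1
      have r: "pochhammer (d - c - real (Suc M)) (Suc M) = (d - c - real M - 1) * pochhammer (d - c - real M) M"
        by (subst pochhammer_rec) (simp add: algebra_simps)
      have r2: "pochhammer (c + 1) (Suc M) = pochhammer (c + 1) M * (c + 1 + real M)"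
        by (simp add: pochhammer_Suc)
      define P Q where "P = pochhammer (d - c - real M) M" and "Q = pochhammer (c + 1) M"
      have n: "Q > 0" "c + 1 + real M > 0" using pos c by (auto simp: Q_def)
      have f1: "F (Suc M) k = (-1) ^ Suc M * ((d - c - real M - 1) * P) / (Q * (c + 1 + real M))"
        by (simp add: F_def 1 wpt_def r r2 P_def Q_def del: of_nat_Suc)
      have f2: "F M k = (-1) ^ M * P / Q"
        unfolding F_def 1 P_def Q_def by (simp add: wpt_def)
      have f3: "G (Suc k) = (-1) ^ Suc M * d * P / (Q * (c + 1 + real M))"
        unfolding G_def 1 P_def Q_def by (simp add: r2)
      have f4: "G k = 0" by (simp add: G_def 1)
      show ?thesis unfolding f1 f2 f3 f4 using n by (simp add: divide_simps) (simp add: algebra_simps)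
    next
      case 2
      have w: "wpt c (Suc M) = (c + 2 * real (Suc M)) * pochhammer (c + 1) M" by (simp add: wpt_def)
      have r3: "pochhammer (c + 1) (Suc M + Suc M) = pochhammer (c + 1) (M + Suc M) * (c + 2 * real (Suc M))"
        by (simp add: pochhammer_Suc algebra_simps)
      have "F (Suc M) k = pochhammer d (Suc M) * pochhammer (c + 1) M / pochhammer (c + 1) (M + Suc M)"
        unfolding F_def 2 w r3 using c by (simp add: add_eq_0_iff_both_eq_0 flip: power_add)
      moreover have "F M k = 0" by (simp add: F_def 2)
      moreover have "G (Suc k) = 0" by (simp add: G_def 2)
      moreover have "G k = - pochhammer d (Suc M) * pochhammer (c + 1) M / pochhammer (c + 1) (M + Suc M)"
        by (simp add: G_def 2 flip: power_add)
      ultimately show ?thesis by simp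
    next
      case 3
      define s where "s = (-1 :: real) ^ (M + k)"
      define B B' where "B = real (M choose k)" and "B' = real (M choose j)"
      define P Q D E where "P = pochhammer (d - c - real M) (M - k)" and "Q = pochhammer (c + 1) (M + k)"
        and "D = pochhammer d k" and "E = pochhammer (c + 1) j"
      have n: "Q > 0" "c + 1 + real (M + k) > 0" using pos c by (auto simp: Q_def)
      have BB: "real k * B = (real M - real k + 1) * B'"
      proof -
        have "Suc j * (M choose Suc j) = (M - j) * (M choose j)"
          using binomial_absorption binomial_absorb_comp by (metis binomial_absorption binomial_absorb_comp)
        hence "real (Suc j * (M choose Suc j)) = real ((M - j) * (M choose j))" by simp
        thus ?thesis using 3 by (simp add: B_def B'_def of_nat_diff algebra_simps)
      qed
      have r1: "pochhammer (d - c - real (Suc M)) (Suc M - k) = (d - c - real M - 1) * P"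
        unfolding P_def using 3 by (subst Suc_diff_le) (simp_all add: pochhammer_rec algebra_simps)
      have r2: "pochhammer (c + 1) (Suc (M + k)) = Q * (c + 1 + real (M + k))"
        by (simp add: pochhammer_Suc Q_def)
      have r4: "pochhammer (d - c - real M) (M + 1 - k) = P * (d - c - real k)"
      proof -
        have "M + 1 - k = Suc (M - k)" using 3 by simp
        then show ?thesis unfolding P_def using 3 by (simp only: pochhammer_Suc) (simp add: of_nat_diff algebra_simps)
      qed
      have r5: "pochhammer d (Suc k) = D * (d + real k)" by (simp add: D_def pochhammer_Suc)
      have r6: "pochhammer (c + 1) k = E * (c + real k)" using 3 by (simp add: E_def pochhammer_Suc algebra_simps)
      have w: "wpt c k = (c + 2 * real k) * E" using 3 by (simp add: wpt_def E_def)
      have ch: "real (Suc M choose k) = B + B'" using 3 by (simp add: B_def B'_def)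
      have e1: "F (Suc M) k = - s * (B + B') * ((c + 2 * real k) * E) * D * ((d - c - real M - 1) * P) / (Q * (c + 1 + real (M + k)))"
        unfolding F_def add_Suc ch w r1 r2 D_def[symmetric] by (simp add: s_def)
      have e2: "F M k = s * B * ((c + 2 * real k) * E) * D * P / Q"
        unfolding F_def w D_def P_def Q_def B_def s_def by simp
      have e3: "G (Suc k) = - s * B * (D * (d + real k)) * P * (E * (c + real k)) / (Q * (c + 1 + real (M + k)))"
        by (simp add: G_def r5 r2 r6 s_def B_def P_def)
      have e4: "G k = s * B' * D * (P * (d - c - real k)) * E / Q"
        unfolding G_def r4 using 3 by (simp add: B'_def s_def D_def Q_def E_def)
      \<comment> \<open>With the common factor removed, the telescoping identity is polynomial in c,
        d, M, k modulo the single relation \<open>BB\<close> between neighbouring binomials.\<close>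
      have key: "- (B + B') * (c + 2 * real k) * (d - c - real M - 1) =
        B * (c + 2 * real k) * (c + 1 + real (M + k)) - B * (d + real k) * (c + real k)
        - B' * (d - c - real k) * (c + 1 + real (M + k))"
        using BB unfolding of_nat_add by algebra
      have "F M k + G (Suc k) - G k = s * E * D * P * (B * (c + 2 * real k) * (c + 1 + real (M + k)) - B * (d + real k) * (c + real k)
        - B' * (d - c - real k) * (c + 1 + real (M + k))) / (Q * (c + 1 + real (M + k)))"
        unfolding e2 e3 e4 using n by (simp add: divide_simps) (simp add: algebra_simps)
      also have "\<dots> = F (Suc M) k" unfolding key[symmetric] e1 by (simp add: algebra_simps)
      finally show ?thesis by simp
    qed
  qed
  have "(\<Sum>k\<le>Suc M. F (Suc M) k) = (\<Sum>k\<le>Suc M. F M k + (G (Suc k) - G k))"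
    by (rule sum.cong) (auto simp: WZ)
  also have "\<dots> = (\<Sum>k\<le>Suc M. F M k) + (G (Suc (Suc M)) - G 0)"
    by (simp only: sum.distrib lessThan_Suc_atMost[symmetric] sum_lessThan_telescope)
  also have "G (Suc (Suc M)) = 0" by (simp add: G_def)
  also have "G 0 = 0" by (simp add: G_def)
  also have "(\<Sum>k\<le>Suc M. F M k) = (\<Sum>k\<le>M. F M k)" by (simp add: F_def)
  also have "\<dots> = 1" using Suc.IH by (simp add: F_def)
  finally show ?case by (simp add: F_def)
qed

text \<open>For k > 0, p = A + k and q = B + k this is (-1)^k (p+q+n-1) (p+q+n-2-k)! / ((n-1)! k!
  (p-k)! (q-k)!), the coefficient of s^(p-k) cnj(s)^(q-k) r^k in the zonal harmonic of bidegree
  (p,q). The arguments are A and B because they are the exponents by which the kernel is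
  sorted.\<close>

definition zcoef :: "nat \<Rightarrow> nat \<Rightarrow> nat \<Rightarrow> nat \<Rightarrow> real" where
  "zcoef n A B k = (-1) ^ k * wpt (real (A + B + n - 1)) k * fact (A + B + n - 1)
     / (fact (n - 1) * fact k * fact A * fact B)"

text \<open>This relation does two jobs. In \<open>zonal_harmonic\<close> it cancels the two kinds
  of terms in the Laplacian; in \<open>magrec_ladder_sum\<close> it turns the terms with a lowered
  power of 1 - Y into the coefficient at (A+1, B+1).\<close>

lemma zcoef_rec:
  assumes "n > 0"
  shows "zcoef n A B (Suc k) * real (Suc k) * real (A + B + k + n)
    = - (real (A + 1) * real (B + 1) * zcoef n (Suc A) (Suc B) k)"
proof -
  define N where "N = A + B + n - 1"
  have N: "A + B + n = Suc N" "A + B + k + n = Suc (N + k)" using assms by (auto simp: N_def)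
  have w: "wpt (real N) (Suc k) * real (Suc (N + k)) = wpt (real N + 2) k * (real N + 1) * (real N + 2)"
  proof (cases k)
    case (Suc j)
    have "pochhammer (real N + 1) (Suc (Suc j)) = pochhammer (real N + 1) (Suc j) * real (Suc (N + Suc j))"
      by (subst pochhammer_Suc) (simp add: algebra_simps)
    moreover have "pochhammer (real N + 1) (Suc (Suc j)) = (real N + 1) * (real N + 2) * pochhammer (real N + 2 + 1) j"
      by (simp add: pochhammer_rec algebra_simps)
    ultimately show ?thesis unfolding Suc wpt_def by (simp add: algebra_simps)
  qed (simp add: wpt_def)
  have "zcoef n A B (Suc k) * real (Suc k) * real (Suc (N + k)) =
     (-1) ^ Suc k * (wpt (real N) (Suc k) * real (Suc (N + k))) * fact N / (fact (n - 1) * fact k * fact A * fact B)"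
    unfolding zcoef_def N_def[symmetric] by (simp add: divide_simps)
  also have "\<dots> = - ((real N + 1) * (real N + 2) * fact N * (-1) ^ k * wpt (real N + 2) k / (fact (n - 1) * fact k * fact A * fact B))"
    unfolding w by simp
  also have "(real N + 1) * (real N + 2) * fact N = fact (Suc (Suc N))" by (simp add: algebra_simps)
  also have "fact (Suc (Suc N)) * (-1) ^ k * wpt (real N + 2) k / (fact (n - 1) * fact k * fact A * fact B)
    = real (A + 1) * real (B + 1) * zcoef n (Suc A) (Suc B) k"
  proof -
    have "Suc A + Suc B + n - 1 = Suc (Suc N)" using assms by (auto simp: N_def)
    moreover have "real (Suc (Suc N)) = real N + 2" by simp
    ultimately show ?thesis unfolding zcoef_def by (simp only:) (simp add: divide_simps)
  qed
  finally show ?thesis unfolding N .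
qed

text \<open>The terminating Gauss series 2F1(-k, b; \<beta>+1; x). It is evaluated at x = 1 - |z|^2,
  so its normalization to 1 at x = 0 refers to the boundary of the ball.\<close>

definition hyp :: "real \<Rightarrow> nat \<Rightarrow> real \<Rightarrow> real poly" where
  "hyp \<beta> k b = (\<Sum>i\<le>k. monom (pochhammer (- real k) i * pochhammer b i / (pochhammer (\<beta> + 1) i * fact i)) i)"

lemma coeff_hyp:
  "coeff (hyp \<beta> k b) i = pochhammer (- real k) i * pochhammer b i / (pochhammer (\<beta> + 1) i * fact i)"
proof (cases "i \<le> k")
  case False
  then have "pochhammer (- real k) i = 0"
    by (intro pochhammer_of_nat_eq_0_lemma) simp
  then show ?thesis using False by (simp add: hyp_def coeff_sum)
qed (simp add: hyp_def coeff_sum)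

lemma smult_sum_right: "smult c (sum f S) = (\<Sum>i\<in>S. smult c (f i))"
  by (rule poly_eqI) (simp add: coeff_sum sum_distrib_left)

text \<open>The Gauss hypergeometric operator with lower parameter \<beta>+1, without its
  zeroth-order term; g is one more than the sum of the two upper parameters.\<close>

definition hop :: "real \<Rightarrow> real \<Rightarrow> real poly \<Rightarrow> real poly" where
  "hop \<beta> g D = [:\<beta> + 1, - g:] * pderiv D + [:0, 1, - 1:] * pderiv (pderiv D)"

lemma coeff_hop:
  "coeff (hop \<beta> g D) i = (real i + 1) * (real i + 1 + \<beta>) * coeff D (Suc i) - real i * (g + real i - 1) * coeff D i"
proof (cases i)
  case 0
  then show ?thesis by (simp add: hop_def coeff_pderiv)
next
  case (Suc j)
  then show ?thesis by (cases j) (simp_all add: hop_def coeff_pderiv coeff_pCons algebra_simps)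
qed

lemma hop_add: "hop \<beta> g (p + q) = hop \<beta> g p + hop \<beta> g q"
  by (simp add: hop_def pderiv_add smult_add_right algebra_simps)

lemma hop_smult: "hop \<beta> g (smult c p) = smult c (hop \<beta> g p)"
  by (rule poly_eqI) (simp add: coeff_hop algebra_simps)

lemma hop_sum: "hop \<beta> g (sum f S) = (\<Sum>x\<in>S. hop \<beta> g (f x))"
proof (induction S rule: infinite_finite_induct)
qed (auto simp: hop_add, simp_all add: hop_def)

lemma hop_hyp:
  assumes "\<beta> > -1"
  shows "hop \<beta> (b - real k + 1) (hyp \<beta> k b) = smult (- real k * b) (hyp \<beta> k b)"
proof (rule poly_eqI)
  fix i
  have p: "pochhammer (\<beta> + 1) i > 0" "\<beta> + 1 + real i > 0"
    using assms by (auto intro!: pochhammer_pos)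
  show "coeff (hop \<beta> (b - real k + 1) (hyp \<beta> k b)) i = coeff (smult (- real k * b) (hyp \<beta> k b)) i"
    unfolding coeff_hop coeff_hyp coeff_smult pochhammer_Suc fact_Suc
    using p by (simp add: divide_simps) (simp add: algebra_simps)
qed

text \<open>Conjugation by (1-x)^k replaces g by g + 2k up to a multiple of (1-x)^(k-1) F. The
  leftover coefficient vanishes for k = 0 and for k = \<beta>+2-g, the two exponents of Gauss's
  equation at x = 1; for the other k it has to be absorbed by a neighbouring term.\<close>

lemma hop_power_mult:
  assumes F: "hop \<beta> (g + 2 * real k) F = smult e F"
  shows "hop \<beta> g ([:1, -1:] ^ k * F) =
     smult (e - real k * (g + real k - 1)) ([:1, -1:] ^ k * F)
     + smult (real k * (g - \<beta> + real k - 2)) ([:1, -1:] ^ (k - 1) * F)"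
proof (cases k)
  case 0
  then show ?thesis using F by simp
next
  case (Suc j)
  define Q where "Q = [:1, -1 :: real:] ^ j"
  have Q': "(1 - x) * poly (pderiv Q) x = - real j * poly Q x" for x
  proof (cases j)
    case (Suc i)
    have "pderiv Q = smult (real j) ([:1, -1:] ^ i) * pderiv [:1, -1:]"
      unfolding Q_def Suc by (rule pderiv_power_Suc)
    then show ?thesis by (simp add: Q_def Suc pderiv_pCons algebra_simps)
  qed (simp add: Q_def)
  have T: "[:1, -1:] ^ k = [:1, -1:] * Q" by (simp add: Suc Q_def)
  have F': "(\<beta> + 1 - (g + 2 * real k) * x) * poly (pderiv F) x + x * (1 - x) * poly (pderiv (pderiv F)) x = e * poly F x" for x
    using arg_cong[OF F, of "\<lambda>p. poly p x"] by (simp add: hop_def algebra_simps)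
  have pT: "pderiv [:1, -1 :: real:] = [:-1:]" by (simp add: pderiv_pCons)

  have TQ: "pderiv ([:1, -1:] * Q) = smult (- real k) Q"
  proof (rule poly_eq_poly_eq_iff[THEN iffD1], rule ext)
    fix x
    show "poly (pderiv ([:1, -1:] * Q)) x = poly (smult (- real k) Q) x"
      unfolding pderiv_mult pT using Q'[of x] by (simp add: Suc algebra_simps)
  qed
  show ?thesis
  proof (rule poly_eq_poly_eq_iff[THEN iffD1], rule ext)
    fix x
    define q q' f f' f'' where "q = poly Q x" and "q' = poly (pderiv Q) x" and "f = poly F x"
      and "f' = poly (pderiv F) x" and "f'' = poly (pderiv (pderiv F)) x"
    have 1: "poly (pderiv ([:1, -1:] * Q * F)) x = - real k * q * f + (1 - x) * q * f'"
      unfolding pderiv_mult[of _ F] TQ by (simp add: q_def f_def f'_def algebra_simps)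
    have 2: "poly (pderiv (pderiv ([:1, -1:] * Q * F))) x = - real k * q' * f - 2 * real k * q * f' + (1 - x) * q * f''"
    proof -
      have e: "pderiv ([:1, -1:] * Q * F) = [:1, -1:] * Q * pderiv F + smult (- real k) (F * Q)"
        unfolding pderiv_mult[of _ F] TQ by simp
      show ?thesis unfolding e pderiv_add pderiv_smult pderiv_mult[of _ "pderiv F"] TQ pderiv_mult[of F Q]
        by (simp add: q_def q'_def f_def f'_def f''_def algebra_simps)
    qed
    have 3: "(1 - x) * q' = - real j * q" using Q' by (simp add: q_def q'_def)
    have 4: "(\<beta> + 1 - (g + 2 * real k) * x) * f' + x * (1 - x) * f'' = e * f"
      using F' by (simp add: f_def f'_def f''_def)
    have kj: "real k = real j + 1" by (simp add: Suc)
    have "poly (hop \<beta> g ([:1, -1:] ^ k * F)) x =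
       (\<beta> + 1 - g * x) * (- real k * q * f + (1 - x) * q * f')
        + x * (1 - x) * (- real k * q' * f - 2 * real k * q * f' + (1 - x) * q * f'')"
      unfolding T hop_def poly_add poly_mult 1 2 by (simp add: algebra_simps)
    also have "\<dots> = (e - real k * (g + real k - 1)) * ((1 - x) * q * f) + real k * (g - \<beta> + real k - 2) * (q * f)"
      using 3 4 kj by algebra
    also have "\<dots> = poly (smult (e - real k * (g + real k - 1)) ([:1, -1:] ^ k * F)
     + smult (real k * (g - \<beta> + real k - 2)) ([:1, -1:] ^ (k - 1) * F)) x"
      unfolding T by (simp add: Suc q_def f_def Q_def algebra_simps)
    finally show "poly (hop \<beta> g ([:1, -1:] ^ k * F)) x = poly (smult (e - real k * (g + real k - 1)) ([:1, -1:] ^ k * F)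
     + smult (real k * (g - \<beta> + real k - 2)) ([:1, -1:] ^ (k - 1) * F)) x" .
  qed
qed

text \<open>The coefficientwise recurrence that the magnetic Laplacian becomes on expansions in
  \<open>s = \<langle>z,w\<rangle>\<close>, its conjugate and \<open>Y = 1 - |w|\<^sup>2\<close>; since its leading factor \<open>(i + 1)(i + 1 + \<beta>)\<close> does not vanish,
  a solution is determined by its values at \<open>Y = 0\<close>.\<close>

definition magrec :: "real \<Rightarrow> nat \<Rightarrow> real \<Rightarrow> real \<Rightarrow> (nat \<Rightarrow> nat \<Rightarrow> real poly) \<Rightarrow> bool" where
  "magrec \<beta> m a R D \<longleftrightarrow> (\<forall>A B i. R * (real A + 1) * (real B + 1) * coeff (D (Suc A) (Suc B)) i
     + (real i + 1) * (real i + 1 + \<beta>) * coeff (D A B) (Suc i)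
     = (real B - real m + real i) * (real A + a + real i) * coeff (D A B) i)"

lemma magrec_unique:
  assumes "magrec \<beta> m a R D" "magrec \<beta> m a R D'" "\<beta> > -1"
    and base: "\<And>A B. coeff (D A B) 0 = coeff (D' A B) 0"
  shows "D A B = D' A B"
proof -
  have "coeff (D A B) i = coeff (D' A B) i" for i A B
  proof (induction i arbitrary: A B)
    case (Suc i)
    have "(real i + 1) * (real i + 1 + \<beta>) * coeff (D A B) (Suc i) = (real i + 1) * (real i + 1 + \<beta>) * coeff (D' A B) (Suc i)"
      using assms(1,2) unfolding magrec_def by (metis Suc.IH add_left_imp_eq)
    moreover have "real i + 1 + \<beta> > 0" using assms(3) by simp
    ultimately show ?case by simp
  qed (rule base)
  then show ?thesis by (auto intro: poly_eqI)
qed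

text \<open>The part of the kernel series that multiplies s^A cnj(s)^B, as a polynomial in Y: the
  term k comes from bidegree (A+k, B+k), whose zonal harmonic contributes (R (1-Y))^k with R = 1 -
  X. The free weight W is where the dependence on X is put later.\<close>

definition ladder_sum :: "nat \<Rightarrow> real \<Rightarrow> nat \<Rightarrow> real \<Rightarrow> real \<Rightarrow> (nat \<Rightarrow> nat \<Rightarrow> real) \<Rightarrow> nat \<Rightarrow> nat \<Rightarrow> real poly" where
  "ladder_sum n \<beta> m a R W A B = (\<Sum>k | B + k \<le> m. smult (W (A + k) (B + k) * zcoef n A B k * R ^ k)
     ([:1, -1:] ^ k * hyp \<beta> (m - B - k) (a + real (A + k))))"

lemma finite_ladder [simp]: "finite {k. B + k \<le> (m :: nat)}"
  by (rule finite_subset[of _ "{..m}"]) auto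

text \<open>Each term (1-Y)^k F_k is an eigenfunction of \<open>hop\<close> up to a multiple of
  (1-Y)^(k-1) F_k. That remainder has a factor k, so k = 0 drops out, and for k = j + 1
  \<open>zcoef_rec\<close> makes it the term j of the ladder at (A+1, B+1). The weight fits because
  W(A+k, B+k) is unchanged by this shift.\<close>

lemma magrec_ladder_sum:
  fixes \<beta> a :: real
  assumes n: "n > 0" and \<beta>: "\<beta> > 0" and a: "a = \<beta> + real m + real n"
  shows "magrec \<beta> m a R (ladder_sum n \<beta> m a R W)"
  unfolding magrec_def
proof (intro allI)
  fix A B i
  \<comment> \<open>The upper parameters belonging to exponents A, B are B - m and A + a, hence g =
    (B - m) + (A + a) + 1 and the eigenvalue (B - m)(A + a).\<close>
  define g where "g = real A + real B + a - real m + 1"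
  define c where "c k = W (A + k) (B + k) * zcoef n A B k * R ^ k" for k
  define F where "F k = hyp \<beta> (m - B - k) (a + real (A + k))" for k
  let ?L = "ladder_sum n \<beta> m a R W" and ?T = "[:1, -1 :: real:]"
  have hop1: "hop \<beta> g (?T ^ k * F k) = smult ((real B - real m) * (real A + a)) (?T ^ k * F k)
     + smult (real k * (real A + real B + real n + real k - 1)) (?T ^ (k - 1) * F k)" if "B + k \<le> m" for k
  proof -
    define e where "e = - real (m - B - k) * (a + real (A + k))"
    have mk: "real (m - B - k) = real m - real B - real k" using that by (simp add: of_nat_diff)
    have "g + 2 * real k = (a + real (A + k)) - real (m - B - k) + 1"
      unfolding g_def mk by simp
    then have "hop \<beta> (g + 2 * real k) (F k) = smult e (F k)"
      unfolding e_def F_def using \<beta> by (simp only: hop_hyp)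
    from hop_power_mult[OF this] have "hop \<beta> g (?T ^ k * F k) = smult (e - real k * (g + real k - 1)) (?T ^ k * F k)
       + smult (real k * (g - \<beta> + real k - 2)) (?T ^ (k - 1) * F k)" .
    moreover have "e - real k * (g + real k - 1) = (real B - real m) * (real A + a)"
      unfolding e_def mk g_def by (simp add: algebra_simps)
    \<comment> \<open>Here the value a = \<beta> + m + n enters: it makes the leftover coefficient
      k(A+B+n+k-1), which is the factor in \<open>zcoef_rec\<close>.\<close>
    moreover have "g - \<beta> + real k - 2 = real A + real B + real n + real k - 1"
      unfolding g_def a by simp
    ultimately show ?thesis by (simp only:)
  qed
  have L: "?L A B = (\<Sum>k | B + k \<le> m. smult (c k) (?T ^ k * F k))"
    unfolding ladder_sum_def c_def F_def ..
  have low: "(\<Sum>k | B + k \<le> m. smult (c k * (real k * (real A + real B + real n + real k - 1))) (?T ^ (k - 1) * F k))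
     = smult (- (R * (real A + 1) * (real B + 1))) (?L (Suc A) (Suc B))" (is "?lhs = ?rhs")
  proof -
    have "?lhs = (\<Sum>k\<in>Suc ` {j. Suc B + j \<le> m}. smult (c k * (real k * (real A + real B + real n + real k - 1))) (?T ^ (k - 1) * F k))"
    proof (rule sum.mono_neutral_right)
      show "\<forall>k\<in>{k. B + k \<le> m} - Suc ` {j. Suc B + j \<le> m}. smult (c k * (real k * (real A + real B + real n + real k - 1))) (?T ^ (k - 1) * F k) = 0"
      proof
        fix k assume "k \<in> {k. B + k \<le> m} - Suc ` {j. Suc B + j \<le> m}"
        then have "k = 0" by (cases k) auto
        then show "smult (c k * (real k * (real A + real B + real n + real k - 1))) (?T ^ (k - 1) * F k) = 0" by simp
      qed
    qed auto
    also have "\<dots> = (\<Sum>j | Suc B + j \<le> m. smult (c (Suc j) * (real (Suc j) * (real A + real B + real n + real j))) (?T ^ j * F (Suc j)))"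
      by (subst sum.reindex) (auto intro!: sum.cong simp: algebra_simps)
    also have "\<dots> = (\<Sum>j | Suc B + j \<le> m. smult (- (R * (real A + 1) * (real B + 1)))
        (smult (W (Suc A + j) (Suc B + j) * zcoef n (Suc A) (Suc B) j * R ^ j)
     ([:1, -1:] ^ j * hyp \<beta> (m - Suc B - j) (a + real (Suc A + j)))))"
    proof (rule sum.cong[OF refl])
      fix j
      have "zcoef n A B (Suc j) * real (Suc j) * (real A + real B + real n + real j) = - (real A + 1) * (real B + 1) * zcoef n (Suc A) (Suc B) j"
        using zcoef_rec[OF n, of A B j] by (simp add: algebra_simps)
      then have "c (Suc j) * (real (Suc j) * (real A + real B + real n + real j)) =
        - (R * (real A + 1) * (real B + 1)) * (W (Suc A + j) (Suc B + j) * zcoef n (Suc A) (Suc B) j * R ^ j)"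
      proof -
        assume h: "zcoef n A B (Suc j) * real (Suc j) * (real A + real B + real n + real j) = - (real A + 1) * (real B + 1) * zcoef n (Suc A) (Suc B) j"
        have "c (Suc j) * (real (Suc j) * (real A + real B + real n + real j)) = W (Suc A + j) (Suc B + j) * R ^ Suc j *
          (zcoef n A B (Suc j) * real (Suc j) * (real A + real B + real n + real j))"
          unfolding c_def by simp
        then show ?thesis unfolding h by (simp add: algebra_simps)
      qed
      moreover have "F (Suc j) = hyp \<beta> (m - Suc B - j) (a + real (Suc A + j))" by (simp add: F_def)
      ultimately show "smult (c (Suc j) * (real (Suc j) * (real A + real B + real n + real j))) (?T ^ j * F (Suc j)) =
        smult (- (R * (real A + 1) * (real B + 1)))
        (smult (W (Suc A + j) (Suc B + j) * zcoef n (Suc A) (Suc B) j * R ^ j)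
         ([:1, -1:] ^ j * hyp \<beta> (m - Suc B - j) (a + real (Suc A + j))))"
        by (simp only: smult_smult)
    qed
    also have "\<dots> = ?rhs" unfolding ladder_sum_def by (simp only: smult_sum_right)
    finally show ?thesis .
  qed
  have "hop \<beta> g (?L A B) = (\<Sum>k | B + k \<le> m. smult ((real B - real m) * (real A + a)) (smult (c k) (?T ^ k * F k))
     + smult (c k * (real k * (real A + real B + real n + real k - 1))) (?T ^ (k - 1) * F k))"
    unfolding L hop_sum hop_smult by (intro sum.cong refl) (simp add: hop1 smult_add_right mult.commute[of "c _" "(real B - real m) * (real A + a)"])
  also have "\<dots> = smult ((real B - real m) * (real A + a)) (?L A B)
       + smult (- (R * (real A + 1) * (real B + 1))) (?L (Suc A) (Suc B))"
    unfolding sum.distrib low L smult_sum_right ..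
  finally have "coeff (hop \<beta> g (?L A B)) i = coeff (smult ((real B - real m) * (real A + a)) (?L A B)
       + smult (- (R * (real A + 1) * (real B + 1))) (?L (Suc A) (Suc B))) i" by simp
  \<comment> \<open>The right-hand side arises from i(g+i-1) + (B-m)(A+a) = (B-m+i)(A+a+i).\<close>
  then show "R * (real A + 1) * (real B + 1) * coeff (?L (Suc A) (Suc B)) i
     + (real i + 1) * (real i + 1 + \<beta>) * coeff (?L A B) (Suc i)
     = (real B - real m + real i) * (real A + a + real i) * coeff (?L A B) i"
    unfolding coeff_hop coeff_add coeff_smult g_def by (simp add: algebra_simps)
qed

text \<open>What depends on p and q in \<kappa>^2 once the Jacobi polynomials are written through
  \<open>hyp\<close>; the common factor \<beta>/(n \<Gamma>(\<beta>+1)) is split off in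
  \<open>radial_part_mult\<close>.\<close>

definition kern_weight :: "nat \<Rightarrow> real \<Rightarrow> nat \<Rightarrow> nat \<Rightarrow> nat \<Rightarrow> real" where
  "kern_weight n \<beta> m p q = Gamma (\<beta> + real m + real n + real p) * pochhammer (\<beta> + 1) (m - q)
     / (fact (m - q) * fact (p + n + m - 1))"

text \<open>A multiple of the coefficients of P_m^(n-1,\<beta>)(2x-1) = P_m^(n-1,\<beta>)(1 -
  2(1-x)) in powers of x; the argument is meant to be x = XY/|1-s|^2.\<close>

definition kern_coeff :: "nat \<Rightarrow> real \<Rightarrow> nat \<Rightarrow> nat \<Rightarrow> real" where
  "kern_coeff n \<beta> m j = (-1) ^ m * Gamma (\<beta> + real m + real n) / (fact (n - 1) * fact m)
     * (pochhammer (- real m) j * pochhammer (\<beta> + real m + real n) j / (pochhammer (\<beta> + 1) j * fact j))"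

text \<open>The coefficient of s^A cnj(s)^B in the sum over j of
  \<open>kern_coeff n \<beta> m j\<close> times (XY)^j (1-s)^(-a-j) (1-cnj s)^(m-j), where a =
  \<beta>+m+n; the Pochhammer quotients are the two binomial series.\<close>

definition kern_poly :: "nat \<Rightarrow> real \<Rightarrow> nat \<Rightarrow> real \<Rightarrow> nat \<Rightarrow> nat \<Rightarrow> real poly" where
  "kern_poly n \<beta> m X A B = (\<Sum>j\<le>m. monom (kern_coeff n \<beta> m j * X ^ j
     * (pochhammer (\<beta> + real m + real n + real j) A / fact A) * (pochhammer (real j - real m) B / fact B)) j)"

lemma coeff_kern_poly: "coeff (kern_poly n \<beta> m X A B) j = kern_coeff n \<beta> m j * X ^ j
     * (pochhammer (\<beta> + real m + real n + real j) A / fact A) * (pochhammer (real j - real m) B / fact B)"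
proof (cases "j \<le> m")
  case False
  then have "pochhammer (- real m) j = 0"
    by (intro pochhammer_of_nat_eq_0_lemma) simp
  then show ?thesis using False by (simp add: kern_poly_def coeff_sum kern_coeff_def)
qed (simp add: kern_poly_def coeff_sum)

text \<open>Split 1 - X. The factor (A+1)(B+1) times the coefficient at (A+1, B+1) already is the
  right-hand side, and -X times it is cancelled by the coefficient of Y^(i+1), because consecutive
  \<open>kern_coeff\<close> have the hypergeometric ratio (i-m)(a+i)/((i+1)(i+1+\<beta>)).\<close>

lemma magrec_kern_poly:
  fixes \<beta> a :: real
  assumes \<beta>: "\<beta> > 0" and a: "a = \<beta> + real m + real n"
  shows "magrec \<beta> m a (1 - X) (kern_poly n \<beta> m X)"
  unfolding magrec_def
proof (intro allI)
  fix A B i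
  define \<kappa> where "\<kappa> = kern_coeff n \<beta> m i"
  have p: "pochhammer (\<beta> + 1) i > 0" "\<beta> + 1 + real i > 0" using \<beta> by (auto intro!: pochhammer_pos)
  have \<kappa>: "kern_coeff n \<beta> m (Suc i) * ((real i + 1) * (real i + 1 + \<beta>)) = \<kappa> * (real i - real m) * (a + real i)"
    unfolding \<kappa>_def kern_coeff_def pochhammer_Suc fact_Suc a using p by (simp add: divide_simps) (simp add: algebra_simps)
  define P Q where "P = pochhammer (a + real i) A" and "Q = pochhammer (real i - real m) B"
  have P1: "pochhammer (a + real i) (Suc A) = P * (a + real i + real A)" by (simp add: P_def pochhammer_Suc)
  have Q1: "pochhammer (real i - real m) (Suc B) = Q * (real i - real m + real B)" by (simp add: Q_def pochhammer_Suc)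
  have P2: "(a + real i) * pochhammer (a + real (Suc i)) A = P * (a + real i + real A)"
    using P1 by (simp add: pochhammer_rec algebra_simps)
  have Q2: "(real i - real m) * pochhammer (real (Suc i) - real m) B = Q * (real i - real m + real B)"
    using Q1 by (simp add: pochhammer_rec algebra_simps)
  have c1: "coeff (kern_poly n \<beta> m X (Suc A) (Suc B)) i * ((real A + 1) * (real B + 1)) =
     \<kappa> * X ^ i * (P * (a + real i + real A)) * (Q * (real i - real m + real B)) / (fact A * fact B)"
    unfolding coeff_kern_poly a[symmetric] P1 Q1 \<kappa>_def by (simp add: divide_simps) (simp add: algebra_simps)
  have c2: "(real i + 1) * (real i + 1 + \<beta>) * coeff (kern_poly n \<beta> m X A B) (Suc i) =
     \<kappa> * X ^ i * X * (P * (a + real i + real A)) * (Q * (real i - real m + real B)) / (fact A * fact B)"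
  proof -
    have "(real i + 1) * (real i + 1 + \<beta>) * coeff (kern_poly n \<beta> m X A B) (Suc i) =
      (kern_coeff n \<beta> m (Suc i) * ((real i + 1) * (real i + 1 + \<beta>))) * X ^ i * X *
        (pochhammer (a + real (Suc i)) A / fact A) * (pochhammer (real (Suc i) - real m) B / fact B)"
      unfolding coeff_kern_poly a[symmetric] by (simp add: mult_ac)
    also have "\<dots> = \<kappa> * X ^ i * X * ((a + real i) * pochhammer (a + real (Suc i)) A) * ((real i - real m) * pochhammer (real (Suc i) - real m) B) / (fact A * fact B)"
      unfolding \<kappa> by (simp add: divide_simps)
    finally show ?thesis unfolding P2 Q2 .
  qed
  have c3: "coeff (kern_poly n \<beta> m X A B) i = \<kappa> * X ^ i * P * Q / (fact A * fact B)"
    unfolding coeff_kern_poly a[symmetric] by (simp add: P_def Q_def \<kappa>_def)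
  have "(1 - X) * (real A + 1) * (real B + 1) * coeff (kern_poly n \<beta> m X (Suc A) (Suc B)) i
    = (1 - X) * (coeff (kern_poly n \<beta> m X (Suc A) (Suc B)) i * ((real A + 1) * (real B + 1)))" by simp
  then show "(1 - X) * (real A + 1) * (real B + 1) * coeff (kern_poly n \<beta> m X (Suc A) (Suc B)) i
     + (real i + 1) * (real i + 1 + \<beta>) * coeff (kern_poly n \<beta> m X A B) (Suc i)
     = (real B - real m + real i) * (real A + a + real i) * coeff (kern_poly n \<beta> m X A B) i"
    unfolding c1 c2 c3 by (simp add: algebra_simps add_divide_distrib diff_divide_distrib)
qed

text \<open>The comparison at X = Y = 0, where every \<open>hyp\<close> is 1. With M = m - B, c = A
  + B + n - 1 and d = a + A the left side becomes a constant times \<open>well_poised_sum\<close>;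
  for B > m both sides vanish.\<close>

lemma kern_base:
  fixes \<beta> a :: real
  assumes n: "n > 0" and \<beta>: "\<beta> > 0" and a: "a = \<beta> + real m + real n"
  shows "(\<Sum>k | B + k \<le> m. kern_weight n \<beta> m (A + k) (B + k) * zcoef n A B k)
     = kern_coeff n \<beta> m 0 * (pochhammer a A / fact A) * (pochhammer (- real m) B / fact B)"
proof (cases "B \<le> m")
  case False
  then have "pochhammer (- real m) B = 0"
    by (intro pochhammer_of_nat_eq_0_lemma) simp
  moreover have "{k. B + k \<le> m} = {}" using False by auto
  ultimately show ?thesis by simp
next
  case True
  define M where "M = m - B"
  define c where "c = A + B + n - 1"
  define d where "d = a + real A"
  have rc: "real c = real A + real B + real n - 1" using n by (simp add: c_def of_nat_diff)
  have S: "{k. B + k \<le> m} = {..M}" using True by (auto simp: M_def)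
  have dpos: "d > 0" using \<beta> n by (simp add: d_def a)
  have G: "Gamma (\<beta> + real m + real n + real (A + k)) = Gamma d * pochhammer d k" for k
  proof -
    have "pochhammer d k = Gamma (d + real k) / Gamma d"
      by (rule pochhammer_Gamma) (use dpos in \<open>auto elim!: nonpos_Ints_cases\<close>)
    moreover have "Gamma d > 0" by (rule Gamma_real_pos[OF dpos])
    ultimately show ?thesis by (simp add: d_def a algebra_simps)
  qed
  have Ga: "Gamma d = Gamma a * pochhammer a A"
  proof -
    have apos: "a > 0" using \<beta> n by (simp add: a)
    have "pochhammer a A = Gamma (a + real A) / Gamma a"
      by (rule pochhammer_Gamma) (use apos in \<open>auto elim!: nonpos_Ints_cases\<close>)
    moreover have "Gamma a > 0" by (rule Gamma_real_pos[OF apos])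
    ultimately show ?thesis by (simp add: d_def)
  qed
  \<comment> \<open>This relation makes the sum well-poised: (\<beta>+1)_(M-k) from the weight is
    exactly the factor (d-c-M)_(M-k).\<close>
  have bd: "\<beta> + 1 = d - real c - real M" using True by (simp add: d_def rc a M_def of_nat_diff)
  have fc: "fact (A + k + n + m - 1) = fact c * pochhammer (real c + 1) (M + k)" for k
  proof -
    have "A + k + n + m - 1 = c + (M + k)" using True n by (simp add: c_def M_def)
    moreover have "fact (c + (M + k)) = fact c * pochhammer (real c + 1) (M + k)"
      by (simp add: pochhammer_fact pochhammer_product'[of 1 c "M + k"] add.commute)
    ultimately show ?thesis by simp
  qed
  have "(\<Sum>k | B + k \<le> m. kern_weight n \<beta> m (A + k) (B + k) * zcoef n A B k) =
    (\<Sum>k\<le>M. ((-1) ^ M * Gamma d / (fact M * fact (n - 1) * fact A * fact B)) *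
       ((-1) ^ (M + k) * real (M choose k) * wpt (real c) k * pochhammer d k
            * pochhammer (d - real c - real M) (M - k) / pochhammer (real c + 1) (M + k)))"
    unfolding S
  proof (rule sum.cong[OF refl])
    fix k assume k: "k \<in> {..M}"
    then have ch: "real (M choose k) = fact M / (fact k * fact (M - k))" by (simp add: binomial_fact)
    have mk: "m - (B + k) = M - k" by (simp add: M_def)
    have s: "(-1 :: real) ^ M * (-1) ^ (M + k) = (-1) ^ k"
      by (simp add: power_add flip: power_mult_distrib)
    have "pochhammer (real c + 1) (M + k) > 0" by (rule pochhammer_pos) simp
    have "kern_weight n \<beta> m (A + k) (B + k) * zcoef n A B k =
       Gamma d * pochhammer d k * pochhammer (d - real c - real M) (M - k) / (fact (M - k) * (fact c * pochhammer (real c + 1) (M + k)))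
       * ((-1) ^ k * wpt (real c) k * fact c / (fact (n - 1) * fact k * fact A * fact B))"
      unfolding kern_weight_def zcoef_def G bd fc mk c_def by simp
    also have "\<dots> = ((-1) ^ M * (-1) ^ (M + k)) * Gamma d * pochhammer d k * pochhammer (d - real c - real M) (M - k) * wpt (real c) k / (fact (M - k) * fact k * pochhammer (real c + 1) (M + k) * fact (n - 1) * fact A * fact B)"
      unfolding s by (simp add: mult_ac)
    also have "\<dots> = ((-1) ^ M * Gamma d / (fact M * fact (n - 1) * fact A * fact B)) *
       ((-1) ^ (M + k) * real (M choose k) * wpt (real c) k * pochhammer d k
            * pochhammer (d - real c - real M) (M - k) / pochhammer (real c + 1) (M + k))"
      unfolding ch by (simp add: mult_ac)
    finally show "kern_weight n \<beta> m (A + k) (B + k) * zcoef n A B k = \<dots>" .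
  qed
  also have "\<dots> = (-1) ^ M * Gamma d / (fact M * fact (n - 1) * fact A * fact B)"
    unfolding sum_distrib_left[symmetric] by (subst well_poised_sum) auto
  also have "\<dots> = kern_coeff n \<beta> m 0 * (pochhammer a A / fact A) * (pochhammer (- real m) B / fact B)"
  proof -
    have "pochhammer (- real m) B = (-1) ^ B * pochhammer (real m - real B + 1) B"
      by (rule pochhammer_minus)
    also have "pochhammer (real m - real B + 1) B = pochhammer (1 + real M) B"
      using True by (simp add: M_def of_nat_diff algebra_simps)
    also have "\<dots> = fact m / fact M"
      using pochhammer_product'[of "1 :: real" M B] True by (simp add: M_def flip: pochhammer_fact)
    finally have "pochhammer (- real m) B = (-1) ^ B * (fact m / fact M)" .
    moreover have "(-1 :: real) ^ m * (-1) ^ B = (-1) ^ M"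
    proof -
      have "m = M + B" using True by (simp add: M_def)
      then show ?thesis by (simp add: power_add flip: power_mult_distrib)
    qed
    ultimately show ?thesis unfolding kern_coeff_def Ga by (simp add: a divide_simps)
  qed
  finally show ?thesis .
qed

text \<open>Uniqueness for \<open>magrec\<close> is used twice. At X = 0 it starts from
  \<open>kern_base\<close> and shows that the ladder with the bare weights is constant in Y. By the
  symmetry between X and Y this is the value at Y = 0 for arbitrary X, from which the second use
  starts.\<close>

lemma kernel_coefficients:
  fixes \<beta> a X Y :: real
  assumes n: "n > 0" and \<beta>: "\<beta> > 0" and a: "a = \<beta> + real m + real n"
  shows "(\<Sum>k | B + k \<le> m. kern_weight n \<beta> m (A + k) (B + k) * poly (hyp \<beta> (m - (B + k)) (a + real (A + k))) X
       * poly (hyp \<beta> (m - (B + k)) (a + real (A + k))) Y * (zcoef n A B k * ((1 - X) * (1 - Y)) ^ k))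
     = (\<Sum>j\<le>m. kern_coeff n \<beta> m j * (X * Y) ^ j
     * (pochhammer (a + real j) A / fact A) * (pochhammer (real j - real m) B / fact B))"
proof -
  have c0h: "coeff (hyp \<beta> k b) 0 = 1" for k b by (simp add: coeff_hyp)
  have c0: "coeff (ladder_sum n \<beta> m a R W A B) 0 = (\<Sum>k | B + k \<le> m. W (A + k) (B + k) * zcoef n A B k * R ^ k)" for R W A B
    unfolding ladder_sum_def by (simp add: coeff_sum coeff_mult coeff_0_power c0h)
  have k0: "kern_poly n \<beta> m 0 A B = [:kern_coeff n \<beta> m 0 * (pochhammer a A / fact A) * (pochhammer (- real m) B / fact B):]" for A B
    by (rule poly_eqI) (auto simp: coeff_kern_poly coeff_pCons a split: nat.split)
  have \<beta>1: "\<beta> > -1" using \<beta> by simp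
  have st1: "ladder_sum n \<beta> m a 1 (kern_weight n \<beta> m) A B = kern_poly n \<beta> m 0 A B" for A B
  proof (rule magrec_unique[OF magrec_ladder_sum[OF n \<beta> a] _ \<beta>1])
    show "magrec \<beta> m a 1 (kern_poly n \<beta> m 0)" using magrec_kern_poly[OF \<beta> a, of 0] by simp
    show "coeff (ladder_sum n \<beta> m a 1 (kern_weight n \<beta> m) A B) 0 = coeff (kern_poly n \<beta> m 0 A B) 0" for A B
      unfolding c0 k0 using kern_base[OF n \<beta> a, where A = A and B = B] by simp
  qed
  have pl: "poly (ladder_sum n \<beta> m a R W A B) y = (\<Sum>k | B + k \<le> m. W (A + k) (B + k) * zcoef n A B k * R ^ k * ((1 - y) ^ k * poly (hyp \<beta> (m - (B + k)) (a + real (A + k))) y))" for R W A B y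
    unfolding ladder_sum_def by (simp add: poly_sum)
  \<comment> \<open>The X-polynomial of each bidegree goes into the weight, and R = 1 - X supplies
    its power.\<close>
  define W where "W p q = kern_weight n \<beta> m p q * poly (hyp \<beta> (m - q) (a + real p)) X" for p q
  have st2: "ladder_sum n \<beta> m a (1 - X) W A B = kern_poly n \<beta> m X A B" for A B
  proof (rule magrec_unique[OF magrec_ladder_sum[OF n \<beta> a] magrec_kern_poly[OF \<beta> a] \<beta>1])
    fix A B
    \<comment> \<open>The exchange of variables: at Y = 0 the new ladder is the old one, evaluated
      at X instead of Y.\<close>
    have "coeff (ladder_sum n \<beta> m a (1 - X) W A B) 0 = poly (ladder_sum n \<beta> m a 1 (kern_weight n \<beta> m) A B) X"
      unfolding c0 pl W_def by (intro sum.cong refl) (simp add: mult_ac)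
    then show "coeff (ladder_sum n \<beta> m a (1 - X) W A B) 0 = coeff (kern_poly n \<beta> m X A B) 0"
      unfolding st1 k0 by (simp add: coeff_kern_poly a)
  qed
  have "(\<Sum>k | B + k \<le> m. kern_weight n \<beta> m (A + k) (B + k) * poly (hyp \<beta> (m - (B + k)) (a + real (A + k))) X
       * poly (hyp \<beta> (m - (B + k)) (a + real (A + k))) Y * (zcoef n A B k * ((1 - X) * (1 - Y)) ^ k))
     = poly (ladder_sum n \<beta> m a (1 - X) W A B) Y"
    unfolding pl W_def by (intro sum.cong refl) (simp add: mult_ac power_mult_distrib)
  also have "\<dots> = (\<Sum>j\<le>m. kern_coeff n \<beta> m j * (X * Y) ^ j
     * (pochhammer (a + real j) A / fact A) * (pochhammer (real j - real m) B / fact B))"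
    unfolding st2 by (simp add: kern_poly_def poly_sum poly_monom power_mult_distrib mult_ac a)
  finally show ?thesis .
qed

text \<open>The expansion at the endpoint -1, where X = 1 - r vanishes. Expanding (X-1)^s leaves,
  for each power of X, a sum of products of two binomials; trinomial revision makes it a Vandermonde
  sum. The sign (-1)^k later disappears in squares and moduli.\<close>

lemma jacobi_poly_hyp:
  assumes \<beta>: "\<beta> > -1"
  shows "jacobi_poly k \<alpha> \<beta> (1 - 2 * r) = (-1) ^ k * pochhammer (\<beta> + 1) k / fact k
     * poly (hyp \<beta> k (real k + \<alpha> + \<beta> + 1)) (1 - r)"
proof -
  define X where "X = 1 - r"
  define b where "b = real k + \<alpha> + \<beta> + 1"
  have x: "((1 - 2 * r) - 1) / 2 = X + (-1)" "((1 - 2 * r) + 1) / 2 = X" by (auto simp: X_def)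
  let ?c = "\<lambda>s. ((real k + \<alpha>) gchoose (k - s)) * ((real k + \<beta>) gchoose s)"
  have inner: "(\<Sum>s\<in>{t..k}. ?c s * real (s choose t)) = ((real k + \<beta>) gchoose t) * ((b - 1 + real (k - t)) gchoose (k - t))"
    if t: "t \<le> k" for t
  proof -
    have "(\<Sum>s\<in>{t..k}. ?c s * real (s choose t)) = (\<Sum>u\<le>k - t. ?c (u + t) * real ((u + t) choose t))"
      by (rule sum.reindex_bij_witness[of _ "\<lambda>u. u + t" "\<lambda>s. s - t"]) (use t in auto)
    also have "\<dots> = (\<Sum>u\<le>k - t. ((real k + \<beta>) gchoose t) * (((real k + \<beta> - real t) gchoose u) * ((real k + \<alpha>) gchoose (k - t - u))))"
    proof (rule sum.cong[OF refl])
      fix u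
      have "((real k + \<beta>) gchoose (u + t)) * (of_nat (u + t) gchoose t) = ((real k + \<beta>) gchoose t) * ((real k + \<beta> - of_nat t) gchoose (u + t - t))"
        by (rule gbinomial_trinomial_revision) simp
      moreover have "k - (u + t) = k - t - u" by simp
      ultimately show "?c (u + t) * real ((u + t) choose t) = ((real k + \<beta>) gchoose t) * (((real k + \<beta> - real t) gchoose u) * ((real k + \<alpha>) gchoose (k - t - u)))"
        by (simp add: binomial_gbinomial mult_ac)
    qed
    also have "\<dots> = ((real k + \<beta>) gchoose t) * ((real k + \<beta> - real t + (real k + \<alpha>)) gchoose (k - t))"
      by (simp only: sum_distrib_left[symmetric] gbinomial_Vandermonde atMost_atLeast0)
    finally show ?thesis using t by (simp add: b_def of_nat_diff algebra_simps)
  qed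
  have "jacobi_poly k \<alpha> \<beta> (1 - 2 * r) = (\<Sum>s\<le>k. ?c s * (X + (-1)) ^ s * X ^ (k - s))"
    unfolding jacobi_poly_def x ..
  also have "\<dots> = (\<Sum>s\<le>k. \<Sum>t\<le>s. ?c s * real (s choose t) * (-1) ^ t * X ^ (k - t))"
  proof (rule sum.cong[OF refl])
    fix s assume s: "s \<in> {..k}"
    have "(X + (-1)) ^ s = (\<Sum>t\<le>s. real (s choose t) * (-1) ^ t * X ^ (s - t))"
      by (subst add.commute, rule binomial_ring)
    then have "?c s * (X + (-1)) ^ s * X ^ (k - s) = (\<Sum>t\<le>s. ?c s * real (s choose t) * (-1) ^ t * (X ^ (s - t) * X ^ (k - s)))"
      by (simp add: sum_distrib_left sum_distrib_right mult_ac)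
    also have "\<dots> = (\<Sum>t\<le>s. ?c s * real (s choose t) * (-1) ^ t * X ^ (k - t))"
      by (rule sum.cong) (use s in \<open>auto simp flip: power_add\<close>)
    finally show "?c s * (X + (-1)) ^ s * X ^ (k - s) = \<dots>" .
  qed
  also have "\<dots> = (\<Sum>t\<le>k. \<Sum>s\<in>{t..k}. ?c s * real (s choose t) * (-1) ^ t * X ^ (k - t))"
  proof -
    have "(\<Sum>s\<le>k. \<Sum>t | t \<in> {..k} \<and> t \<le> s. ?c s * real (s choose t) * (-1) ^ t * X ^ (k - t))
      = (\<Sum>t\<le>k. \<Sum>s | s \<in> {..k} \<and> t \<le> s. ?c s * real (s choose t) * (-1) ^ t * X ^ (k - t))"
      by (rule sum.swap_restrict) auto
    moreover have "{t. t \<in> {..k} \<and> t \<le> s} = {..s}" if "s \<in> {..k}" for s using that by auto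
    moreover have "{s. s \<in> {..k} \<and> t \<le> s} = {t..k}" for t by auto
    ultimately show ?thesis by simp
  qed
  also have "\<dots> = (\<Sum>t\<le>k. (\<Sum>s\<in>{t..k}. ?c s * real (s choose t)) * (-1) ^ t * X ^ (k - t))"
    by (simp only: sum_distrib_right)
  also have "\<dots> = (\<Sum>t\<le>k. ((real k + \<beta>) gchoose t) * ((b - 1 + real (k - t)) gchoose (k - t)) * (-1) ^ t * X ^ (k - t))"
    by (rule sum.cong) (simp_all add: inner)
  also have "\<dots> = (\<Sum>i\<le>k. ((real k + \<beta>) gchoose (k - i)) * ((b - 1 + real i) gchoose i) * (-1) ^ (k - i) * X ^ i)"
    by (rule sum.reindex_bij_witness[of _ "\<lambda>i. k - i" "\<lambda>i. k - i"]) auto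
  also have "\<dots> = (\<Sum>i\<le>k. (-1) ^ k * pochhammer (\<beta> + 1) k / fact k * (pochhammer (- real k) i * pochhammer b i / (pochhammer (\<beta> + 1) i * fact i) * X ^ i))"
  proof (rule sum.cong[OF refl])
    fix i assume "i \<in> {..k}"
    then have i: "i \<le> k" by simp
    have p: "pochhammer (\<beta> + 1) i > 0" by (rule pochhammer_pos) (use \<beta> in simp)
    have 1: "(real k + \<beta>) gchoose (k - i) = pochhammer (\<beta> + 1) k / (pochhammer (\<beta> + 1) i * fact (k - i))"
      using pochhammer_product[OF i, of "\<beta> + 1"] p i by (simp add: gbinomial_pochhammer' of_nat_diff algebra_simps)
    have 2: "(b - 1 + real i) gchoose i = pochhammer b i / fact i"
      by (simp add: gbinomial_pochhammer')
    have 3: "pochhammer (- real k) i = (-1) ^ i * (fact k / fact (k - i))"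
    proof -
      have "pochhammer (- real k) i = (-1) ^ i * pochhammer (real k - real i + 1) i"
        by (rule pochhammer_minus)
      also have "pochhammer (real k - real i + 1) i = pochhammer (1 + real (k - i)) i"
        using i by (simp add: of_nat_diff algebra_simps)
      also have "\<dots> = fact k / fact (k - i)"
        using pochhammer_product'[of "1 :: real" "k - i" i] i by (simp flip: pochhammer_fact)
      finally show ?thesis .
    qed
    have 4: "(-1 :: real) ^ (k - i) = (-1) ^ k * (-1) ^ i"
    proof -
      have "k = (k - i) + i" using i by simp
      then have "(-1 :: real) ^ k = (-1) ^ (k - i) * (-1) ^ i" by (metis power_add)
      then show ?thesis by (simp flip: power_mult_distrib add: mult.assoc)
    qed
    show "((real k + \<beta>) gchoose (k - i)) * ((b - 1 + real i) gchoose i) * (-1) ^ (k - i) * X ^ i =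
      (-1) ^ k * pochhammer (\<beta> + 1) k / fact k * (pochhammer (- real k) i * pochhammer b i / (pochhammer (\<beta> + 1) i * fact i) * X ^ i)"
      unfolding 1 2 3 4 by (simp add: mult_ac)
  qed
  also have "\<dots> = (-1) ^ k * pochhammer (\<beta> + 1) k / fact k * poly (hyp \<beta> k b) X"
    by (simp add: hyp_def poly_sum poly_monom sum_distrib_left)
  finally show ?thesis unfolding X_def b_def .
qed

section \<open>Polynomially bounded sequences and convergence in the powers of s\<close>

definition polyb :: "(nat \<Rightarrow> real) \<Rightarrow> bool" where
  "polyb f \<longleftrightarrow> (\<exists>C N. \<forall>i. \<bar>f i\<bar> \<le> C * (real i + 1) ^ N)"

lemma polybI: "(\<And>i. \<bar>f i\<bar> \<le> C * (real i + 1) ^ N) \<Longrightarrow> polyb f"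
  unfolding polyb_def by blast

lemma polyb_const [simp]: "polyb (\<lambda>i. c)"
  by (rule polybI[of _ "\<bar>c\<bar>" 0]) simp

lemma polyb_of_nat [simp]: "polyb real"
  by (rule polybI[of _ 1 1]) simp

lemma polyb_mult [intro]:
  assumes "polyb f" "polyb g" shows "polyb (\<lambda>i. f i * g i)"
proof -
  obtain C N D M where *: "\<bar>f i\<bar> \<le> C * (real i + 1) ^ N" "\<bar>g i\<bar> \<le> D * (real i + 1) ^ M" for i
    using assms unfolding polyb_def by blast
  show ?thesis
  proof (rule polybI)
    fix i
    have "\<bar>f i * g i\<bar> \<le> (C * (real i + 1) ^ N) * (D * (real i + 1) ^ M)"
      unfolding abs_mult by (rule mult_mono) (use * in \<open>auto intro: order_trans[OF abs_ge_zero]\<close>)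
    then show "\<bar>f i * g i\<bar> \<le> (C * D) * (real i + 1) ^ (N + M)" by (simp add: power_add mult_ac)
  qed
qed

lemma polyb_add [intro]:
  assumes "polyb f" "polyb g" shows "polyb (\<lambda>i. f i + g i)"
proof -
  obtain C N D M where *: "\<bar>f i\<bar> \<le> C * (real i + 1) ^ N" "\<bar>g i\<bar> \<le> D * (real i + 1) ^ M" for i
    using assms unfolding polyb_def by blast
  have C: "C \<ge> 0" "D \<ge> 0" using *[of 0] by auto
  show ?thesis
  proof (rule polybI)
    fix i
    have "\<bar>f i + g i\<bar> \<le> C * (real i + 1) ^ N + D * (real i + 1) ^ M"
      using *[of i] by linarith
    also have "\<dots> \<le> C * (real i + 1) ^ (N + M) + D * (real i + 1) ^ (N + M)"
      by (intro add_mono mult_left_mono power_increasing C) auto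
    finally show "\<bar>f i + g i\<bar> \<le> (C + D) * (real i + 1) ^ (N + M)" by (simp add: algebra_simps)
  qed
qed

lemma polyb_sum [intro]: "(\<And>x. x \<in> S \<Longrightarrow> polyb (f x)) \<Longrightarrow> polyb (\<lambda>i. \<Sum>x\<in>S. f x i)"
  by (induction S rule: infinite_finite_induct) auto

lemma polyb_pochhammer_shift: "polyb (\<lambda>i. pochhammer (c + real i) k)"
proof (induction k)
  case (Suc k)
  have "polyb (\<lambda>i. pochhammer (c + real i) k * ((c + real k) + real i))"
    using Suc by (intro polyb_mult polyb_add) auto
  then show ?case by (simp add: pochhammer_Suc algebra_simps)
qed simp

text \<open>Compare c with an integer N + 1: the quotient (N+1)_i / i! is the binomial of N + i over
  N and hence at most (i+1)^N.\<close>

lemma polyb_pochhammer_fact: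
  assumes "c > 0" shows "polyb (\<lambda>i. pochhammer c i / fact i)"
proof -
  have N: "pochhammer (real (Suc N)) i / fact i \<le> (real i + 1) ^ N" for N i
  proof (induction N)
    case 0
    show ?case by (simp add: pochhammer_fact)
  next
    case (Suc N)
    have "pochhammer (real (Suc N)) (Suc i) = pochhammer (real (Suc N)) i * (real (Suc N) + real i)"
      by (rule pochhammer_Suc)
    moreover have "pochhammer (real (Suc N)) (Suc i) = real (Suc N) * pochhammer (real (Suc (Suc N))) i"
      by (simp add: pochhammer_rec algebra_simps)
    ultimately have "pochhammer (real (Suc (Suc N))) i = pochhammer (real (Suc N)) i * ((real (Suc N) + real i) / real (Suc N))"
      by (simp add: field_simps)
    then have "pochhammer (real (Suc (Suc N))) i / fact i = (pochhammer (real (Suc N)) i / fact i) * ((real (Suc N) + real i) / real (Suc N))"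
      by simp
    also have "\<dots> \<le> (real i + 1) ^ N * (real i + 1)"
      by (rule mult_mono[OF Suc]) (auto simp: divide_simps algebra_simps pochhammer_nonneg)
    finally show ?case by (simp add: mult.commute)
  qed
  obtain N where "c \<le> real N" using real_arch_simple by blast
  then have cN: "c \<le> real (Suc N)" by simp
  show ?thesis
  proof (rule polybI)
    fix i
    have "\<bar>pochhammer c i / fact i\<bar> = pochhammer c i / fact i"
      using assms by (simp add: pochhammer_nonneg)
    also have "pochhammer c i \<le> pochhammer (real (Suc N)) i"
      unfolding pochhammer_prod by (rule prod_mono) (use assms cN in auto)
    then have "pochhammer c i / fact i \<le> pochhammer (real (Suc N)) i / fact i"
      by (rule divide_right_mono) simp
    also have "\<dots> \<le> (real i + 1) ^ N" by (rule N)
    finally show "\<bar>pochhammer c i / fact i\<bar> \<le> 1 * (real i + 1) ^ N" by simp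
  qed
qed

text \<open>Differentiating a power series multiplies its coefficients by the index, so each
  differentiation raises N by one; this needs the induction hypothesis on the whole interval |y| <
  1.\<close>

lemma summable_polynomial_geometric:
  fixes x :: real
  shows "\<bar>x\<bar> < 1 \<Longrightarrow> summable (\<lambda>i. (real i + 1) ^ N * x ^ i)"
proof (induction N arbitrary: x)
  case 0
  then show ?case by (simp add: summable_geometric)
next
  case (Suc N)
  have "summable (\<lambda>i. real i ^ N * y ^ i)" if "norm y < 1" for y :: real
  proof -
    have "summable (\<lambda>i. y * ((real i + 1) ^ N * y ^ i))"
      using Suc.IH[of y] that by (intro summable_mult) auto
    then have "summable (\<lambda>i. real (Suc i) ^ N * y ^ Suc i)" by (simp add: algebra_simps)
    then show ?thesis by (subst (asm) summable_Suc_iff)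
  qed
  then have "summable (\<lambda>i. diffs (\<lambda>i. real i ^ N) i * x ^ i)"
    using Suc.prems by (intro termdiff_converges[of x 1]) auto
  then show ?case by (simp add: diffs_def algebra_simps)
qed

lemma summable_polyb_power:
  fixes s :: complex
  assumes "polyb f" "norm s < 1"
  shows "summable (\<lambda>i. of_real (f i) * s ^ i)"
proof -
  obtain C N where *: "\<bar>f i\<bar> \<le> C * (real i + 1) ^ N" for i
    using assms unfolding polyb_def by blast
  have "summable (\<lambda>i. C * ((real i + 1) ^ N * norm s ^ i))"
    using assms(2) by (intro summable_mult summable_polynomial_geometric) auto
  then show ?thesis
  proof (rule summable_comparison_test')
    fix i
    show "norm (of_real (f i) * s ^ i) \<le> C * ((real i + 1) ^ N * norm s ^ i)"
      using mult_right_mono[OF *[of i], of "norm s ^ i"] by (simp add: norm_mult norm_power mult_ac)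
  qed
qed

lemma poly_hyp: "poly (hyp \<beta> k b) x = (\<Sum>i\<le>k. pochhammer (- real k) i * pochhammer b i / (pochhammer (\<beta> + 1) i * fact i) * x ^ i)"
  by (simp add: hyp_def poly_sum poly_monom)

lemma polyb_poly_hyp: "polyb (\<lambda>i. poly (hyp \<beta> k (b + real i)) x)"
proof -
  have "polyb (\<lambda>i. \<Sum>l\<le>k. (pochhammer (- real k) l / (pochhammer (\<beta> + 1) l * fact l) * x ^ l) * pochhammer (b + real i) l)"
    by (intro polyb_sum polyb_mult polyb_pochhammer_shift polyb_const)
  then show ?thesis by (simp add: poly_hyp mult_ac)
qed

lemma polyb_wpt: "polyb (\<lambda>i. wpt (c + real i) k)"
proof (cases k)
  case (Suc j)
  have "polyb (\<lambda>i. ((c + 2 * real k) + real i) * pochhammer (c + 1 + real i) j)"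
    by (intro polyb_mult polyb_add polyb_pochhammer_shift polyb_const polyb_of_nat)
  then show ?thesis by (simp add: wpt_def Suc algebra_simps)
qed (simp add: wpt_def)

text \<open>The Gamma factor of the weight and the A! of \<open>zcoef\<close> combine to (a+k)_A /
  A!, and the two large factorials have a quotient at most 1 because B \<le> m. Everything else is
  polynomial in A.\<close>

lemma polyb_kern_weight_zcoef:
  assumes n: "n > 0" and \<beta>: "\<beta> > 0" and q: "B + k \<le> m"
  shows "polyb (\<lambda>A. kern_weight n \<beta> m (A + k) (B + k) * zcoef n A B k)"
proof -
  define a where "a = \<beta> + real m + real n"
  define K where "K = Gamma (a + real k) * pochhammer (\<beta> + 1) (m - (B + k)) / fact (m - (B + k)) / (fact (n - 1) * fact k * fact B)"
  define r where "r A = fact (A + B + n - 1) / (fact (A + k + n + m - 1) :: real)" for A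
  have apos: "a + real k > 0" using n \<beta> by (simp add: a_def)
  have G: "Gamma (\<beta> + real m + real n + real (A + k)) = Gamma (a + real k) * pochhammer (a + real k) A" for A
  proof -
    have "pochhammer (a + real k) A = Gamma (a + real k + real A) / Gamma (a + real k)"
      by (rule pochhammer_Gamma) (use apos in \<open>auto elim!: nonpos_Ints_cases\<close>)
    moreover have "Gamma (a + real k) > 0" by (rule Gamma_real_pos[OF apos])
    ultimately show ?thesis by (simp add: a_def algebra_simps)
  qed
  have r: "polyb r"
  proof (rule polybI)
    fix A
    have "fact (A + B + n - 1) \<le> (fact (A + k + n + m - 1) :: real)"
      by (rule fact_mono) (use q in auto)
    then show "\<bar>r A\<bar> \<le> 1 * (real A + 1) ^ 0" by (simp add: r_def)
  qed
  have "polyb (\<lambda>A. (K * (-1) ^ k) * r A * wpt (real (B + n - 1) + real A) k * (pochhammer (a + real k) A / fact A))"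
    by (intro polyb_mult r polyb_const polyb_wpt polyb_pochhammer_fact apos)
  moreover have "kern_weight n \<beta> m (A + k) (B + k) * zcoef n A B k = (K * (-1) ^ k) * r A * wpt (real (B + n - 1) + real A) k * (pochhammer (a + real k) A / fact A)" for A
  proof -
    have "real (A + B + n - 1) = real (B + n - 1) + real A" using n by (simp add: of_nat_diff)
    then show ?thesis
      unfolding kern_weight_def zcoef_def K_def r_def G by (simp add: mult_ac)
  qed
  ultimately show ?thesis by simp
qed

text \<open>\<open>zonal n p q \<langle>z,w\<rangle> (|z|\<^sup>2|w|\<^sup>2)\<close> is the reproducing kernel of \<open>H(p,q)\<close> on the sphere;
  harmonicity in \<open>z\<close> forces the coefficients \<open>zcoef\<close> up to a common factor.\<close>

definition zonal :: "nat \<Rightarrow> nat \<Rightarrow> nat \<Rightarrow> complex \<Rightarrow> real \<Rightarrow> complex" where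
  "zonal n p q s r = (\<Sum>k\<le>min p q. of_real (zcoef n (p - k) (q - k) k) * s ^ (p - k) * cnj s ^ (q - k) * of_real (r ^ k))"

section \<open>Binomial series and the summed kernel\<close>

lemma minus_one_power_cancel: "((-1) ^ k * x) * ((-1) ^ k * y) = x * (y :: complex)"
  by (metis left_minus_one_mult_self mult.assoc mult.left_commute)

lemma pochhammer_powr_sums:
  assumes "norm (s :: complex) < 1"
  shows "(\<lambda>A. of_real (pochhammer c A / fact A) * s ^ A) sums ((1 - s) powr (- of_real c))"
proof -
  have "(\<lambda>A. ((- of_real c) gchoose A) * (- s) ^ A) sums (1 + (- s)) powr (- of_real c)"
    by (rule gen_binomial_complex) (use assms in simp)
  moreover have "((- of_real c) gchoose A) * (- s) ^ A = of_real (pochhammer c A / fact A) * s ^ A" for A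
  proof -
    have "((- of_real c) gchoose A) = (-1) ^ A * (of_real (pochhammer c A / fact A) :: complex)"
      by (simp add: gbinomial_pochhammer pochhammer_of_real)
    moreover have "(- s) ^ A = (-1) ^ A * s ^ A" by (rule power_minus)
    ultimately show ?thesis by (simp only: minus_one_power_cancel)
  qed
  ultimately show ?thesis by simp
qed

lemma pochhammer_neg_binomial:
  assumes "j \<le> m"
  shows "(\<Sum>B\<le>m. of_real (pochhammer (real j - real m) B / fact B) * t ^ B) = (1 - t :: complex) ^ (m - j)"
proof -
  have "(1 - t) ^ (m - j) = (\<Sum>B\<le>m - j. of_nat ((m - j) choose B) * (- t) ^ B)"
    using binomial_ring[of "- t" 1 "m - j"] by simp
  also have "\<dots> = (\<Sum>B\<le>m - j. of_real (pochhammer (real j - real m) B / fact B) * t ^ B)"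
  proof (rule sum.cong[OF refl])
    fix B
    have "real ((m - j) choose B) = (-1) ^ B * (pochhammer (real j - real m) B / fact B)"
      using assms by (simp add: binomial_gbinomial gbinomial_pochhammer of_nat_diff)
    moreover have "(of_nat ((m - j) choose B) :: complex) = of_real (real ((m - j) choose B))" by simp
    ultimately have "(of_nat ((m - j) choose B) :: complex) = (-1) ^ B * of_real (pochhammer (real j - real m) B / fact B)"
      by simp
    moreover have "(- t) ^ B = (-1) ^ B * t ^ B" by (rule power_minus)
    ultimately show "of_nat ((m - j) choose B) * (- t) ^ B = of_real (pochhammer (real j - real m) B / fact B) * t ^ B"
      by (simp only: minus_one_power_cancel)
  qed
  also have "\<dots> = (\<Sum>B\<le>m. of_real (pochhammer (real j - real m) B / fact B) * t ^ B)"
  proof (rule sum.mono_neutral_left)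
    show "\<forall>B\<in>{..m} - {..m - j}. of_real (pochhammer (real j - real m) B / fact B) * t ^ B = 0"
    proof
      fix B assume "B \<in> {..m} - {..m - j}"
      then have "pochhammer (- real (m - j)) B = 0" by (intro pochhammer_of_nat_eq_0_lemma) auto
      then show "of_real (pochhammer (real j - real m) B / fact B) * t ^ B = 0"
        using assms by (simp add: of_nat_diff)
    qed
  qed auto
  finally show ?thesis ..
qed

text \<open>For fixed q and k the terms with p \<ge> k form a series in A = p - k. As (q,k) ranges
  over a finite set, passing from summation by p to summation by A only shifts finitely many
  convergent series; no double series has to be rearranged. The coefficient of s^A then comes from
  \<open>kernel_coefficients\<close> with B = q - k.\<close>

lemma kernel_sums:
  fixes \<beta> a X Y :: real and s :: complex
  assumes n: "n > 0" and \<beta>: "\<beta> > 0" and a: "a = \<beta> + real m + real n" and s: "norm s < 1"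
  shows "(\<lambda>p. \<Sum>q\<le>m. of_real (kern_weight n \<beta> m p q * poly (hyp \<beta> (m - q) (a + real p)) X * poly (hyp \<beta> (m - q) (a + real p)) Y)
      * zonal n p q s ((1 - X) * (1 - Y)))
    sums (\<Sum>j\<le>m. of_real (kern_coeff n \<beta> m j * (X * Y) ^ j) * (1 - s) powr (- of_real (a + real j)) * (1 - cnj s) ^ (m - j))"
proof -
  define w where "w p q = kern_weight n \<beta> m p q * poly (hyp \<beta> (m - q) (a + real p)) X * poly (hyp \<beta> (m - q) (a + real p)) Y" for p q
  define r where "r = (1 - X) * (1 - Y)"
  define h where "h q k A = of_real (w (A + k) q * (zcoef n A (q - k) k * r ^ k)) * s ^ A * cnj s ^ (q - k)" for q k A
  \<comment> \<open>\<open>f\<close> is \<open>h\<close> delayed by k places, padded with zeros;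
    delaying does not change the sum.\<close>
  define f where "f q k p = (if p < k then 0 else h q k (p - k))" for q k p
  define S where "S q k = (\<Sum>A. h q k A)" for q k
  have summ: "summable (h q k)" if "k \<le> q" "q \<le> m" for q k
  proof -
    have "polyb (\<lambda>A. (kern_weight n \<beta> m (A + k) ((q - k) + k) * zcoef n A (q - k) k) * poly (hyp \<beta> (m - q) ((a + real k) + real A)) X * poly (hyp \<beta> (m - q) ((a + real k) + real A)) Y)"
      by (intro polyb_mult polyb_poly_hyp polyb_kern_weight_zcoef n \<beta>) (use that in auto)
    then have pb: "polyb (\<lambda>A. w (A + k) q * zcoef n A (q - k) k)"
      using that by (simp add: w_def add_ac mult_ac)
    have "summable (\<lambda>A. (of_real (r ^ k) * cnj s ^ (q - k)) * (of_real (w (A + k) q * zcoef n A (q - k) k) * s ^ A))"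
      by (intro summable_mult summable_polyb_power pb s)
    then show ?thesis unfolding h_def by (simp add: mult_ac)
  qed
  have hS: "h q k sums S q k" if "k \<le> q" "q \<le> m" for q k
    unfolding S_def by (rule summable_sums[OF summ[OF that]])
  have fS: "f q k sums S q k" if "k \<le> q" "q \<le> m" for q k
  proof -
    have "(\<lambda>i. f q k (i + k)) sums S q k" using hS[OF that] by (simp add: f_def)
    then have "f q k sums (S q k + (\<Sum>i<k. f q k i))" by (subst (asm) sums_iff_shift)
    then show ?thesis by (simp add: f_def)
  qed
  have "(\<lambda>p. \<Sum>q\<le>m. \<Sum>k\<le>q. f q k p) sums (\<Sum>q\<le>m. \<Sum>k\<le>q. S q k)"
    by (intro sums_sum fS) auto
  moreover have "(\<Sum>k\<le>q. f q k p) = of_real (w p q) * zonal n p q s r" for p q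
  proof -
    have "(\<Sum>k\<le>q. f q k p) = (\<Sum>k\<le>min p q. f q k p)"
      by (rule sum.mono_neutral_right) (auto simp: f_def)
    also have "\<dots> = (\<Sum>k\<le>min p q. of_real (w p q) * (of_real (zcoef n (p - k) (q - k) k) * s ^ (p - k) * cnj s ^ (q - k) * of_real (r ^ k)))"
      by (rule sum.cong) (auto simp: f_def h_def)
    finally show ?thesis by (simp add: zonal_def sum_distrib_left)
  qed
  ultimately have main: "(\<lambda>p. \<Sum>q\<le>m. of_real (w p q) * zonal n p q s r) sums (\<Sum>q\<le>m. \<Sum>k\<le>q. S q k)"
    by simp
  have "(\<lambda>A. \<Sum>q\<le>m. \<Sum>k\<le>q. h q k A) sums (\<Sum>q\<le>m. \<Sum>k\<le>q. S q k)"
    by (intro sums_sum hS) auto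
  moreover have "(\<Sum>q\<le>m. \<Sum>k\<le>q. h q k A) = (\<Sum>j\<le>m. (of_real (kern_coeff n \<beta> m j * (X * Y) ^ j) * (1 - cnj s) ^ (m - j)) * (of_real (pochhammer (a + real j) A / fact A) * s ^ A))" for A
  proof -
    have "(\<Sum>q\<le>m. \<Sum>k\<le>q. h q k A) = (\<Sum>B\<le>m. \<Sum>k | B + k \<le> m. h (B + k) k A)"
    proof -
      have "(\<Sum>q\<le>m. \<Sum>k\<le>q. h q k A) = (\<Sum>(q, k)\<in>(SIGMA q:{..m}. {..q}). h q k A)"
        by (rule sum.Sigma) auto
      also have "\<dots> = (\<Sum>(B, k)\<in>(SIGMA B:{..m}. {k. B + k \<le> m}). h (B + k) k A)"
        by (rule sum.reindex_bij_witness[of _ "\<lambda>(B, k). (B + k, k)" "\<lambda>(q, k). (q - k, k)"]) auto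
      also have "\<dots> = (\<Sum>B\<le>m. \<Sum>k | B + k \<le> m. h (B + k) k A)"
        by (rule sum.Sigma[symmetric]) auto
      finally show ?thesis .
    qed
    also have "\<dots> = (\<Sum>B\<le>m. s ^ A * cnj s ^ B * of_real (\<Sum>k | B + k \<le> m. kern_weight n \<beta> m (A + k) (B + k) * poly (hyp \<beta> (m - (B + k)) (a + real (A + k))) X
       * poly (hyp \<beta> (m - (B + k)) (a + real (A + k))) Y * (zcoef n A B k * ((1 - X) * (1 - Y)) ^ k)))"
      unfolding of_real_sum sum_distrib_left by (intro sum.cong refl) (simp add: h_def w_def r_def)
    also have "\<dots> = (\<Sum>B\<le>m. s ^ A * cnj s ^ B * of_real (\<Sum>j\<le>m. kern_coeff n \<beta> m j * (X * Y) ^ j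
     * (pochhammer (a + real j) A / fact A) * (pochhammer (real j - real m) B / fact B)))"
      unfolding kernel_coefficients[OF n \<beta> a] ..
    also have "\<dots> = (\<Sum>j\<le>m. \<Sum>B\<le>m. (of_real (kern_coeff n \<beta> m j * (X * Y) ^ j) * (of_real (pochhammer (a + real j) A / fact A) * s ^ A))
       * (of_real (pochhammer (real j - real m) B / fact B) * cnj s ^ B))"
      unfolding of_real_sum sum_distrib_left by (subst sum.swap) (intro sum.cong refl, simp)
    also have "\<dots> = (\<Sum>j\<le>m. (of_real (kern_coeff n \<beta> m j * (X * Y) ^ j) * (1 - cnj s) ^ (m - j)) * (of_real (pochhammer (a + real j) A / fact A) * s ^ A))"
      unfolding sum_distrib_left[symmetric] by (intro sum.cong refl) (simp add: pochhammer_neg_binomial del: of_real_divide of_real_mult)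
    finally show ?thesis .
  qed
  moreover have "(\<lambda>A. \<Sum>j\<le>m. (of_real (kern_coeff n \<beta> m j * (X * Y) ^ j) * (1 - cnj s) ^ (m - j)) * (of_real (pochhammer (a + real j) A / fact A) * s ^ A))
     sums (\<Sum>j\<le>m. (of_real (kern_coeff n \<beta> m j * (X * Y) ^ j) * (1 - cnj s) ^ (m - j)) * ((1 - s) powr (- of_real (a + real j))))"
    by (intro sums_sum sums_mult pochhammer_powr_sums s)
  ultimately have "(\<Sum>q\<le>m. \<Sum>k\<le>q. S q k) = (\<Sum>j\<le>m. (of_real (kern_coeff n \<beta> m j * (X * Y) ^ j) * (1 - cnj s) ^ (m - j)) * ((1 - s) powr (- of_real (a + real j))))"
    using sums_unique2 by simp
  with main show ?thesis unfolding w_def r_def by (simp add: mult_ac)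
qed

subsection \<open>Wirtinger calculus\<close>

text \<open>\<open>wd j\<close> and \<open>wb j\<close> are the Wirtinger derivatives in \<open>z\<^sub>j\<close> and its conjugate; in
  \<open>has_w f z a b\<close> they have the values \<open>a j\<close> and \<open>b j\<close>.\<close>

definition has_w :: "(complex^'n \<Rightarrow> complex) \<Rightarrow> complex^'n \<Rightarrow> ('n \<Rightarrow> complex) \<Rightarrow> ('n \<Rightarrow> complex) \<Rightarrow> bool" where
  "has_w f z a b \<longleftrightarrow> (f has_derivative (\<lambda>v. \<Sum>j\<in>UNIV. v $ j * a j + cnj (v $ j) * b j)) (at z)"

definition wd :: "'n \<Rightarrow> (complex^'n \<Rightarrow> complex) \<Rightarrow> complex^'n \<Rightarrow> complex" where
  "wd j f z = (frechet_derivative f (at z) (axis j 1) - \<i> * frechet_derivative f (at z) (axis j \<i>)) / 2"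

definition wb :: "'n \<Rightarrow> (complex^'n \<Rightarrow> complex) \<Rightarrow> complex^'n \<Rightarrow> complex" where
  "wb j f z = (frechet_derivative f (at z) (axis j 1) + \<i> * frechet_derivative f (at z) (axis j \<i>)) / 2"

lemma has_w_axis:
  assumes "has_w f z a b"
  shows "frechet_derivative f (at z) (axis j u) = u * a j + cnj u * b j"
proof -
  have "frechet_derivative f (at z) = (\<lambda>v. \<Sum>j\<in>UNIV. v $ j * a j + cnj (v $ j) * b j)"
    using assms unfolding has_w_def by (rule frechet_derivative_at[symmetric])
  moreover have "axis j u $ i * a i + cnj (axis j u $ i) * b i = (if i = j then u * a i + cnj u * b i else 0)" for i
    by (simp add: axis_def)
  ultimately show ?thesis by simp
qed

lemma has_w_wd: "has_w f z a b \<Longrightarrow> wd j f z = a j"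
  unfolding wd_def by (simp add: has_w_axis algebra_simps)

lemma has_w_wb: "has_w f z a b \<Longrightarrow> wb j f z = b j"
  unfolding wb_def by (simp add: has_w_axis algebra_simps)

lemma has_w_const: "has_w (\<lambda>z. c) z (\<lambda>_. 0) (\<lambda>_. 0)"
  by (simp add: has_w_def)

lemma has_w_nth:
  fixes i :: "'n::finite"
  shows "has_w (\<lambda>z. z $ i) z (\<lambda>j. if j = i then 1 else 0) (\<lambda>_. 0)"
proof -
  have "(\<lambda>v :: complex^'n. \<Sum>j\<in>UNIV. v $ j * (if j = i then 1 else 0) + cnj (v $ j) * 0) = (\<lambda>v. v $ i)"
    by (rule ext) (simp add: if_distrib[where f = "\<lambda>x. _ * x"] cong: if_cong)
  then show ?thesis unfolding has_w_def by (simp only: bounded_linear_imp_has_derivative[OF bounded_linear_vec_nth])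
qed

lemma has_w_cnj_nth:
  fixes i :: "'n::finite"
  shows "has_w (\<lambda>z. cnj (z $ i)) z (\<lambda>_. 0) (\<lambda>j. if j = i then 1 else 0)"
proof -
  have "(\<lambda>v :: complex^'n. \<Sum>j\<in>UNIV. v $ j * 0 + cnj (v $ j) * (if j = i then 1 else 0)) = (\<lambda>v. cnj (v $ i))"
    by (rule ext) (simp add: if_distrib[where f = "\<lambda>x. _ * x"] cong: if_cong)
  moreover have "bounded_linear (\<lambda>v :: complex^'n. cnj (v $ i))"
    using bounded_linear_compose[OF bounded_linear_cnj bounded_linear_vec_nth] .
  ultimately show ?thesis unfolding has_w_def by (simp only: bounded_linear_imp_has_derivative)
qed

lemma has_w_add:
  assumes "has_w f z a b" "has_w g z c d"
  shows "has_w (\<lambda>z. f z + g z) z (\<lambda>j. a j + c j) (\<lambda>j. b j + d j)"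
  using has_derivative_add[OF assms[unfolded has_w_def]] unfolding has_w_def
  by (simp add: sum.distrib[symmetric] algebra_simps)

lemma has_w_mult:
  assumes "has_w f z a b" "has_w g z c d"
  shows "has_w (\<lambda>z. f z * g z) z (\<lambda>j. f z * c j + a j * g z) (\<lambda>j. f z * d j + b j * g z)"
  using has_derivative_mult[OF assms[unfolded has_w_def]] unfolding has_w_def
  by (simp add: sum_distrib_left sum_distrib_right sum.distrib[symmetric] algebra_simps)

lemma has_w_power:
  assumes "has_w f z a b"
  shows "has_w (\<lambda>z. f z ^ k) z (\<lambda>j. of_nat k * f z ^ (k - 1) * a j) (\<lambda>j. of_nat k * f z ^ (k - 1) * b j)"
proof (induction k)
  case 0
  show ?case by (simp add: has_w_const)
next
  case (Suc k)
  from has_w_mult[OF assms Suc] show ?case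
    by (cases k) (simp_all add: algebra_simps)
qed

lemma has_w_sum:
  assumes "\<And>i. i \<in> S \<Longrightarrow> has_w (f i) z (a i) (b i)"
  shows "has_w (\<lambda>z. \<Sum>i\<in>S. f i z) z (\<lambda>j. \<Sum>i\<in>S. a i j) (\<lambda>j. \<Sum>i\<in>S. b i j)"
  using assms
proof (induction S rule: infinite_finite_induct)
  case (insert i S)
  then show ?case using has_w_add[of "f i" z "a i" "b i"] by simp
qed (simp_all add: has_w_const)

text \<open>Polynomials in the coordinates and their conjugates, generated inductively:
  differentiability, commutation of derivatives, continuity and Lipschitz bounds then follow by rule
  induction.\<close>

inductive cpoly :: "(complex^'n \<Rightarrow> complex) \<Rightarrow> bool" where
  cpoly_const: "cpoly (\<lambda>z. c)"
| cpoly_nth: "cpoly (\<lambda>z. z $ j)"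
| cpoly_cnj_nth: "cpoly (\<lambda>z. cnj (z $ j))"
| cpoly_add: "cpoly f \<Longrightarrow> cpoly g \<Longrightarrow> cpoly (\<lambda>z. f z + g z)"
| cpoly_mult: "cpoly f \<Longrightarrow> cpoly g \<Longrightarrow> cpoly (\<lambda>z. f z * g z)"

declare cpoly.intros [simp, intro]

lemma cpoly_sum [simp, intro]: "(\<And>i. i \<in> S \<Longrightarrow> cpoly (f i)) \<Longrightarrow> cpoly (\<lambda>z. \<Sum>i\<in>S. f i z)"
  by (induction S rule: infinite_finite_induct) auto

lemma cpoly_has_w: "cpoly f \<Longrightarrow> has_w f z (\<lambda>j. wd j f z) (\<lambda>j. wb j f z)"
proof -
  assume "cpoly f"
  then have "\<exists>a b. has_w f z a b"
  proof induction
    case (cpoly_const c)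
    show ?case using has_w_const by blast
  next
    case (cpoly_nth j)
    show ?case using has_w_nth by blast
  next
    case (cpoly_cnj_nth j)
    show ?case using has_w_cnj_nth by blast
  next
    case (cpoly_add f g)
    then show ?case using has_w_add by blast
  next
    case (cpoly_mult f g)
    then show ?case using has_w_mult by blast
  qed
  then obtain a b where ab: "has_w f z a b" by blast
  then have "a = (\<lambda>j. wd j f z)" "b = (\<lambda>j. wb j f z)" by (auto simp: has_w_wd has_w_wb)
  with ab show ?thesis by simp
qed

text \<open>An inductive form of \<open>bihomogeneous_poly\<close>, equivalent by
  \<open>bihomogeneous_bipoly\<close>. The zero function has a rule of its own because it belongs to
  every bidegree, in particular as a derivative.\<close>

inductive bipoly :: "nat \<Rightarrow> nat \<Rightarrow> (complex^'n \<Rightarrow> complex) \<Rightarrow> bool" where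
  bipoly_zero: "bipoly p q (\<lambda>z. 0)"
| bipoly_const: "bipoly 0 0 (\<lambda>z. c)"
| bipoly_nth: "bipoly p q f \<Longrightarrow> bipoly (Suc p) q (\<lambda>z. z $ j * f z)"
| bipoly_cnj_nth: "bipoly p q f \<Longrightarrow> bipoly p (Suc q) (\<lambda>z. cnj (z $ j) * f z)"
| bipoly_add: "bipoly p q f \<Longrightarrow> bipoly p q g \<Longrightarrow> bipoly p q (\<lambda>z. f z + g z)"

lemma bipoly_mult:
  assumes "bipoly p q f" "bipoly p' q' g"
  shows "bipoly (p + p') (q + q') (\<lambda>z. f z * g z)"
  using assms(1)
proof induction
  case (bipoly_const c)
  have "bipoly p' q' (\<lambda>z. c * g z)" using assms(2)
  proof induction
    case (bipoly_nth p q f j)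
    from bipoly.bipoly_nth[OF bipoly_nth.IH, of j] show ?case by (simp add: mult_ac)
  next
    case (bipoly_cnj_nth p q f j)
    from bipoly.bipoly_cnj_nth[OF bipoly_cnj_nth.IH, of j] show ?case by (simp add: mult_ac)
  next
    case (bipoly_add p q f g)
    from bipoly.bipoly_add[OF bipoly_add.IH] show ?case by (simp add: algebra_simps)
  qed (auto intro: bipoly.intros)
  then show ?case by simp
next
  case (bipoly_nth p q f j)
  from bipoly.bipoly_nth[OF bipoly_nth.IH, of j] show ?case by (simp add: mult_ac)
next
  case (bipoly_cnj_nth p q f j)
  from bipoly.bipoly_cnj_nth[OF bipoly_cnj_nth.IH, of j] show ?case by (simp add: mult_ac)
next
  case (bipoly_add p q f g)
  from bipoly.bipoly_add[OF bipoly_add.IH] show ?case by (simp add: algebra_simps)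
qed (auto intro: bipoly.intros)

lemma bipoly_cmult: "bipoly p q f \<Longrightarrow> bipoly p q (\<lambda>z. c * f z)"
  using bipoly_mult[OF bipoly_const, of p q f c] by simp

lemma bipoly_sum: "(\<And>i. i \<in> S \<Longrightarrow> bipoly p q (f i)) \<Longrightarrow> bipoly p q (\<lambda>z. \<Sum>i\<in>S. f i z)"
  by (induction S rule: infinite_finite_induct) (auto intro: bipoly.intros)

lemma bipoly_coord: "bipoly 1 0 (\<lambda>z. z $ j)"
  using bipoly_nth[OF bipoly_const[of 1], of j] by simp

lemma bipoly_cnj_coord: "bipoly 0 1 (\<lambda>z. cnj (z $ j))"
  using bipoly_cnj_nth[OF bipoly_const[of 1], of j] by simp

lemma bipoly_power: "bipoly p q f \<Longrightarrow> bipoly (k * p) (k * q) (\<lambda>z. f z ^ k)"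
proof (induction k)
  case 0
  show ?case by (simp add: bipoly_const)
next
  case (Suc k)
  from bipoly_mult[OF Suc.prems Suc.IH[OF Suc.prems]] show ?case by simp
qed

lemma bipoly_cpoly: "bipoly p q f \<Longrightarrow> cpoly f"
  by (induction rule: bipoly.induct) auto

lemma cpoly_continuous: "cpoly f \<Longrightarrow> continuous_on S f"
  by (induction rule: cpoly.induct) (auto intro!: continuous_intros)

lemma bipoly_homogeneous: "bipoly p q f \<Longrightarrow> f (c *s z) = c ^ p * cnj c ^ q * f z"
  by (induction rule: bipoly.induct) (auto simp: algebra_simps)

lemma wd_add: "cpoly f \<Longrightarrow> cpoly g \<Longrightarrow> wd j (\<lambda>z. f z + g z) = (\<lambda>z. wd j f z + wd j g z)"
  by (rule ext, rule has_w_wd[OF has_w_add]) (erule cpoly_has_w)+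

lemma wb_add: "cpoly f \<Longrightarrow> cpoly g \<Longrightarrow> wb j (\<lambda>z. f z + g z) = (\<lambda>z. wb j f z + wb j g z)"
  by (rule ext, rule has_w_wb[OF has_w_add]) (erule cpoly_has_w)+

lemma wd_mult: "cpoly f \<Longrightarrow> cpoly g \<Longrightarrow> wd j (\<lambda>z. f z * g z) = (\<lambda>z. f z * wd j g z + wd j f z * g z)"
  by (rule ext, rule has_w_wd[OF has_w_mult]) (erule cpoly_has_w)+

lemma wb_mult: "cpoly f \<Longrightarrow> cpoly g \<Longrightarrow> wb j (\<lambda>z. f z * g z) = (\<lambda>z. f z * wb j g z + wb j f z * g z)"
  by (rule ext, rule has_w_wb[OF has_w_mult]) (erule cpoly_has_w)+

lemma wd_const: "wd j (\<lambda>z. c) = (\<lambda>z. 0)"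
  by (rule ext, rule has_w_wd[OF has_w_const])

lemma wb_const: "wb j (\<lambda>z. c) = (\<lambda>z. 0)"
  by (rule ext, rule has_w_wb[OF has_w_const])

lemma wd_nth: "wd j (\<lambda>z. z $ i) = (\<lambda>z. if j = i then 1 else 0)"
  by (rule ext, rule has_w_wd[OF has_w_nth])

lemma wb_nth: "wb j (\<lambda>z. z $ i) = (\<lambda>z. 0)"
  by (rule ext, rule has_w_wb[OF has_w_nth])

lemma wd_cnj_nth: "wd j (\<lambda>z. cnj (z $ i)) = (\<lambda>z. 0)"
  by (rule ext, rule has_w_wd[OF has_w_cnj_nth])

lemma wb_cnj_nth: "wb j (\<lambda>z. cnj (z $ i)) = (\<lambda>z. if j = i then 1 else 0)"
  by (rule ext, rule has_w_wb[OF has_w_cnj_nth])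

lemma wd_nth_mult: "cpoly f \<Longrightarrow> wd j (\<lambda>z. z $ i * f z) = (\<lambda>z. z $ i * wd j f z + (if j = i then f z else 0))"
  by (subst wd_mult[OF cpoly_nth]) (auto simp: wd_nth fun_eq_iff)

lemma wb_nth_mult: "cpoly f \<Longrightarrow> wb j (\<lambda>z. z $ i * f z) = (\<lambda>z. z $ i * wb j f z)"
  by (subst wb_mult[OF cpoly_nth]) (auto simp: wb_nth fun_eq_iff)

lemma wd_cnj_nth_mult: "cpoly f \<Longrightarrow> wd j (\<lambda>z. cnj (z $ i) * f z) = (\<lambda>z. cnj (z $ i) * wd j f z)"
  by (subst wd_mult[OF cpoly_cnj_nth]) (auto simp: wd_cnj_nth fun_eq_iff)

lemma wb_cnj_nth_mult: "cpoly f \<Longrightarrow> wb j (\<lambda>z. cnj (z $ i) * f z) = (\<lambda>z. cnj (z $ i) * wb j f z + (if j = i then f z else 0))"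
  by (subst wb_mult[OF cpoly_cnj_nth]) (auto simp: wb_cnj_nth fun_eq_iff)

text \<open>The second conjunct is for p = 0, where \<open>p - 1\<close> is truncated. The induction
  needs it: multiplying the derivative by a coordinate gives degree p again only if the derivative
  is zero in that case.\<close>

lemma bipoly_wd: "bipoly p q f \<Longrightarrow> bipoly (p - 1) q (wd j f) \<and> (p = 0 \<longrightarrow> wd j f = (\<lambda>z. 0))"
proof (induction rule: bipoly.induct)
  case (bipoly_nth p q f i)
  have "bipoly p q (\<lambda>z. z $ i * wd j f z)"
    using bipoly_nth.IH bipoly.bipoly_nth[of "p - 1" q "wd j f" i] by (cases p) (auto intro: bipoly_zero)
  then have "bipoly p q (\<lambda>z. z $ i * wd j f z + (if j = i then f z else 0))"
    using bipoly_nth.hyps by (cases "j = i") (auto intro: bipoly.bipoly_add)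
  then show ?case by (simp add: wd_nth_mult[OF bipoly_cpoly[OF bipoly_nth.hyps]])
next
  case (bipoly_cnj_nth p q f i)
  then show ?case by (auto simp: wd_cnj_nth_mult[OF bipoly_cpoly[OF bipoly_cnj_nth.hyps]] intro: bipoly.bipoly_cnj_nth)
qed (auto simp: wd_const wd_add bipoly_cpoly intro: bipoly.intros)

lemma bipoly_wb: "bipoly p q f \<Longrightarrow> bipoly p (q - 1) (wb j f) \<and> (q = 0 \<longrightarrow> wb j f = (\<lambda>z. 0))"
proof (induction rule: bipoly.induct)
  case (bipoly_cnj_nth p q f i)
  have "bipoly p q (\<lambda>z. cnj (z $ i) * wb j f z)"
    using bipoly_cnj_nth.IH bipoly.bipoly_cnj_nth[of p "q - 1" "wb j f" i] by (cases q) (auto intro: bipoly_zero)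
  then have "bipoly p q (\<lambda>z. cnj (z $ i) * wb j f z + (if j = i then f z else 0))"
    using bipoly_cnj_nth.hyps by (cases "j = i") (auto intro: bipoly.bipoly_add)
  then show ?case by (simp add: wb_cnj_nth_mult[OF bipoly_cpoly[OF bipoly_cnj_nth.hyps]])
next
  case (bipoly_nth p q f i)
  then show ?case by (auto simp: wb_nth_mult[OF bipoly_cpoly[OF bipoly_nth.hyps]] intro: bipoly.bipoly_nth)
qed (auto simp: wb_const wb_add bipoly_cpoly intro: bipoly.intros)

lemmas bipoly_wdI = bipoly_wd[THEN conjunct1]
lemmas bipoly_wbI = bipoly_wb[THEN conjunct1]

lemma euler_wd: "bipoly p q f \<Longrightarrow> (\<Sum>j\<in>UNIV. z $ j * wd j f z) = of_nat p * f z"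
proof (induction rule: bipoly.induct)
  case (bipoly_nth p q f i)
  have "(\<Sum>j\<in>UNIV. z $ j * wd j (\<lambda>z. z $ i * f z) z) = (\<Sum>j\<in>UNIV. z $ i * (z $ j * wd j f z) + (if j = i then z $ j * f z else 0))"
    unfolding wd_nth_mult[OF bipoly_cpoly[OF bipoly_nth.hyps]] by (rule sum.cong) (auto simp: algebra_simps)
  also have "\<dots> = z $ i * (of_nat p * f z) + z $ i * f z"
    unfolding sum.distrib sum_distrib_left[symmetric] bipoly_nth.IH by simp
  finally show ?case by (simp add: algebra_simps)
next
  case (bipoly_cnj_nth p q f i)
  have "(\<Sum>j\<in>UNIV. z $ j * wd j (\<lambda>z. cnj (z $ i) * f z) z) = cnj (z $ i) * (\<Sum>j\<in>UNIV. z $ j * wd j f z)"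
    unfolding wd_cnj_nth_mult[OF bipoly_cpoly[OF bipoly_cnj_nth.hyps]] sum_distrib_left by (rule sum.cong) (auto simp: algebra_simps)
  then show ?case unfolding bipoly_cnj_nth.IH by simp
qed (simp_all add: wd_const wd_add bipoly_cpoly distrib_left sum.distrib)

lemma euler_wb: "bipoly p q f \<Longrightarrow> (\<Sum>j\<in>UNIV. cnj (z $ j) * wb j f z) = of_nat q * f z"
proof (induction rule: bipoly.induct)
  case (bipoly_cnj_nth p q f i)
  have "(\<Sum>j\<in>UNIV. cnj (z $ j) * wb j (\<lambda>z. cnj (z $ i) * f z) z) = (\<Sum>j\<in>UNIV. cnj (z $ i) * (cnj (z $ j) * wb j f z) + (if j = i then cnj (z $ j) * f z else 0))"
    unfolding wb_cnj_nth_mult[OF bipoly_cpoly[OF bipoly_cnj_nth.hyps]] by (rule sum.cong) (auto simp: algebra_simps)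
  also have "\<dots> = cnj (z $ i) * (of_nat q * f z) + cnj (z $ i) * f z"
    unfolding sum.distrib sum_distrib_left[symmetric] bipoly_cnj_nth.IH by simp
  finally show ?case by (simp add: algebra_simps)
next
  case (bipoly_nth p q f i)
  have "(\<Sum>j\<in>UNIV. cnj (z $ j) * wb j (\<lambda>z. z $ i * f z) z) = z $ i * (\<Sum>j\<in>UNIV. cnj (z $ j) * wb j f z)"
    unfolding wb_nth_mult[OF bipoly_cpoly[OF bipoly_nth.hyps]] sum_distrib_left by (rule sum.cong) (auto simp: algebra_simps)
  then show ?case unfolding bipoly_nth.IH by simp
qed (simp_all add: wb_const wb_add bipoly_cpoly distrib_left sum.distrib)

lemma cpoly_wd [simp, intro]: "cpoly f \<Longrightarrow> cpoly (wd j f)"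
  by (induction rule: cpoly.induct) (auto simp: wd_const wd_nth wd_cnj_nth wd_add wd_mult)

lemma cpoly_wb [simp, intro]: "cpoly f \<Longrightarrow> cpoly (wb j f)"
  by (induction rule: cpoly.induct) (auto simp: wb_const wb_nth wb_cnj_nth wb_add wb_mult)

lemma wd_wb_commute: "cpoly f \<Longrightarrow> wd i (wb j f) = wb j (wd i f)"
  by (induction rule: cpoly.induct)
     (simp_all add: wd_const wb_const wd_nth wb_nth wd_cnj_nth wb_cnj_nth wd_add wb_add wd_mult wb_mult algebra_simps)

lemma wd_wd_commute: "cpoly f \<Longrightarrow> wd i (wd j f) = wd j (wd i f)"
  by (induction rule: cpoly.induct)
     (simp_all add: wd_const wd_nth wd_cnj_nth wd_add wd_mult algebra_simps)

lemma wb_wb_commute: "cpoly f \<Longrightarrow> wb i (wb j f) = wb j (wb i f)"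
  by (induction rule: cpoly.induct)
     (simp_all add: wb_const wb_nth wb_cnj_nth wb_add wb_mult algebra_simps)

lemma wd_sum: "(\<And>i. i \<in> S \<Longrightarrow> cpoly (f i)) \<Longrightarrow> wd j (\<lambda>z. \<Sum>i\<in>S. f i z) = (\<lambda>z. \<Sum>i\<in>S. wd j (f i) z)"
  by (induction S rule: infinite_finite_induct) (auto simp: wd_const wd_add)

lemma wb_sum: "(\<And>i. i \<in> S \<Longrightarrow> cpoly (f i)) \<Longrightarrow> wb j (\<lambda>z. \<Sum>i\<in>S. f i z) = (\<lambda>z. \<Sum>i\<in>S. wb j (f i) z)"
  by (induction S rule: infinite_finite_induct) (auto simp: wb_const wb_add)

section \<open>The complex Laplacian\<close>

definition clap :: "(complex^'n \<Rightarrow> complex) \<Rightarrow> complex^'n \<Rightarrow> complex" where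
  "clap f z = (\<Sum>j\<in>UNIV. wd j (wb j f) z)"

lemma clap_wd:
  assumes "cpoly f" shows "clap (wd i f) = wd i (clap f)"
proof -
  have "wd j (wb j (wd i f)) = wd i (wd j (wb j f))" for j
    using assms by (metis cpoly_wb wd_wb_commute wd_wd_commute)
  then show ?thesis unfolding clap_def[abs_def] using assms by (simp add: wd_sum)
qed

lemma clap_wb:
  assumes "cpoly f" shows "clap (wb i f) = wb i (clap f)"
proof -
  have "wd j (wb j (wb i f)) = wb i (wd j (wb j f))" for j
    using assms by (metis cpoly_wb wb_wb_commute wd_wb_commute)
  then show ?thesis unfolding clap_def[abs_def] using assms by (simp add: wb_sum)
qed

lemma laplacian_clap:
  assumes f: "cpoly (f :: complex^'n \<Rightarrow> complex)"
  shows "laplacian f z = 4 * clap f z"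
proof -
  have D: "frechet_derivative g (at w) (axis j u) = u * wd j g w + cnj u * wb j g w" if "cpoly g" for g w u and j :: 'n
    by (rule has_w_axis[OF cpoly_has_w[OF that]])
  have B: "(Basis :: (complex^'n) set) = (\<Union>j. (axis j) ` {1, \<i>})"
    by (auto simp: Basis_vec_def Basis_complex_def)
  have "laplacian f z = (\<Sum>j\<in>UNIV. \<Sum>b\<in>axis j ` {1, \<i>}. frechet_derivative (\<lambda>w. frechet_derivative f (at w) b) (at z) b)"
    unfolding laplacian_def B
    by (rule sum.UNION_disjoint) (auto simp: axis_eq_axis)
  also have "\<dots> = (\<Sum>j\<in>UNIV. 4 * wd j (wb j f) z)"
  proof (rule sum.cong[OF refl])
    fix j :: 'n
    have inj: "inj_on (axis j) {1, \<i> :: complex}" by (auto simp: inj_on_def axis_eq_axis)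
    have ne: "(1 :: complex) \<noteq> \<i>" by (simp add: complex_eq_iff)
    have cm: "wb j (wd j f) = wd j (wb j f)" by (simp add: wd_wb_commute f)
    have m: "wd j (\<lambda>w. c * g w) = (\<lambda>w. c * wd j g w)" "wb j (\<lambda>w. c * g w) = (\<lambda>w. c * wb j g w)" if "cpoly g" for g c
      using wd_mult[OF cpoly_const that] wb_mult[OF cpoly_const that] by (simp_all add: wd_const wb_const)
    \<comment> \<open>For u = 1 and u = \<i> the pure second derivatives carry u^2 and its conjugate
      and cancel in the sum; the mixed one carries 2|u|^2 twice, which gives the factor 4.\<close>
    have "frechet_derivative (\<lambda>w. u * wd j f w + cnj u * wb j f w) (at z) (axis j u) =
       u * (u * wd j (wd j f) z + cnj u * wd j (wb j f) z) + cnj u * (u * wd j (wb j f) z + cnj u * wb j (wb j f) z)" for u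
      by (subst D) (simp_all add: f wd_add wb_add m cm)
    then show "(\<Sum>b\<in>axis j ` {1, \<i>}. frechet_derivative (\<lambda>w. frechet_derivative f (at w) b) (at z) b) = 4 * wd j (wb j f) z"
      unfolding sum.reindex[OF inj] o_def D[OF f] using ne by (simp add: algebra_simps)
  qed
  finally show ?thesis by (simp add: clap_def sum_distrib_left)
qed

subsection \<open>Zonal harmonics and the addition formula\<close>

lemma finite_multi_index [simp]: "finite {a :: 'n::finite \<Rightarrow> nat. sum a UNIV = p}"
proof (rule finite_subset)
  show "{a :: 'n \<Rightarrow> nat. sum a UNIV = p} \<subseteq> PiE UNIV (\<lambda>_. {..p})"
    by (auto simp: PiE_def intro: member_le_sum)
qed (auto intro: finite_PiE)

lemma bipoly_monomial: "bipoly (sum a S) 0 (\<lambda>z :: complex^'n. \<Prod>i\<in>S. (z $ i) ^ a i)"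
proof (induction S rule: infinite_finite_induct)
  case (insert i S)
  have "bipoly (a i) 0 (\<lambda>z :: complex^'n. (z $ i) ^ a i)" using bipoly_power[OF bipoly_coord, of "a i" i] by simp
  from bipoly_mult[OF this insert.IH] show ?case using insert.hyps by simp
qed (simp_all add: bipoly_const)

lemma bipoly_cnj_monomial: "bipoly 0 (sum a S) (\<lambda>z :: complex^'n. \<Prod>i\<in>S. (cnj (z $ i)) ^ a i)"
proof (induction S rule: infinite_finite_induct)
  case (insert i S)
  have "bipoly 0 (a i) (\<lambda>z :: complex^'n. (cnj (z $ i)) ^ a i)" using bipoly_power[OF bipoly_cnj_coord, of "a i" i] by simp
  from bipoly_mult[OF this insert.IH] show ?case using insert.hyps by simp
qed (simp_all add: bipoly_const)

text \<open>The change of index behind multiplication by a coordinate: the j-th exponent goes up,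
  and exponents with a j = 0 receive nothing.\<close>

lemma multi_index_shift:
  fixes X :: "('n::finite \<Rightarrow> nat) \<Rightarrow> 'a::comm_monoid_add"
  shows "(\<Sum>a | sum a UNIV = p. X (a(j := Suc (a j)))) = (\<Sum>a | sum a UNIV = Suc p. if a j > 0 then X a else 0)"
proof -
  have s: "sum (a(j := x)) UNIV + a j = sum a UNIV + x" for a :: "'n \<Rightarrow> nat" and x
    by (simp add: sum.remove[of UNIV j])
  have "(\<Sum>a | sum a UNIV = Suc p. if a j > 0 then X a else 0) = (\<Sum>a | sum a UNIV = Suc p \<and> a j > 0. X a)"
    by (rule sum.mono_neutral_cong_right) auto
  also have "\<dots> = (\<Sum>a | sum a UNIV = p. X (a(j := Suc (a j))))"
  proof (rule sum.reindex_bij_witness[of _ "\<lambda>a. a(j := Suc (a j))" "\<lambda>a. a(j := a j - 1)"])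
    fix a :: "'n \<Rightarrow> nat" assume "a \<in> {a. sum a UNIV = Suc p \<and> a j > 0}"
    then show "a(j := a j - 1) \<in> {a. sum a UNIV = p}"
      using s[of a "a j - 1"] by simp
  next
    fix a :: "'n \<Rightarrow> nat" assume "a \<in> {a. sum a UNIV = p}"
    then show "a(j := Suc (a j)) \<in> {a. sum a UNIV = Suc p \<and> a j > 0}"
      using s[of a "Suc (a j)"] by simp
  qed auto
  finally show ?thesis ..
qed

lemma prod_power_shift:
  "(\<Prod>i\<in>UNIV. x i ^ (a(j := Suc (a j))) i) = x j * (\<Prod>i\<in>(UNIV :: 'n::finite set). x i ^ a i :: complex)"
  by (simp add: prod.remove[of UNIV j])

lemma bihomogeneous_bipoly: "bihomogeneous_poly p q f \<longleftrightarrow> bipoly p q (f :: complex^'n \<Rightarrow> complex)"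
proof
  assume "bihomogeneous_poly p q f"
  then obtain c where f: "f = (\<lambda>z. \<Sum>a\<in>{a :: 'n \<Rightarrow> nat. sum a UNIV = p}. \<Sum>b\<in>{b :: 'n \<Rightarrow> nat. sum b UNIV = q}.
        c a b * (\<Prod>i\<in>UNIV. (z $ i) ^ a i) * (\<Prod>i\<in>UNIV. (cnj (z $ i)) ^ b i))"
    unfolding bihomogeneous_poly_def by (auto simp: fun_eq_iff)
  show "bipoly p q f" unfolding f
  proof (intro bipoly_sum)
    fix a b :: "'n \<Rightarrow> nat" assume "a \<in> {a. sum a UNIV = p}" "b \<in> {b. sum b UNIV = q}"
    then show "bipoly p q (\<lambda>z. c a b * (\<Prod>i\<in>UNIV. (z $ i) ^ a i) * (\<Prod>i\<in>UNIV. (cnj (z $ i)) ^ b i))"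
      using bipoly_mult[OF bipoly_cmult[OF bipoly_monomial[of a UNIV], of "c a b"] bipoly_cnj_monomial[of b UNIV]] by simp
  qed
next
  assume "bipoly p q f"
  then show "bihomogeneous_poly p q f"
  proof induction
    case (bipoly_zero p q)
    show ?case unfolding bihomogeneous_poly_def by (rule exI[of _ "\<lambda>_ _. 0"]) simp
  next
    case (bipoly_const c)
    have *: "{a :: 'n \<Rightarrow> nat. \<forall>x. a x = 0} = {\<lambda>_. 0}" by auto
    show ?case unfolding bihomogeneous_poly_def by (rule exI[of _ "\<lambda>_ _. c"]) (simp add: *)
  next
    case (bipoly_nth p q f j)
    then obtain c where f: "f z = (\<Sum>a\<in>{a. sum a UNIV = p}. \<Sum>b\<in>{b. sum b UNIV = q}.
        c a b * (\<Prod>i\<in>UNIV. (z $ i) ^ a i) * (\<Prod>i\<in>UNIV. (cnj (z $ i)) ^ b i))" for z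
      unfolding bihomogeneous_poly_def by blast
    define c' where "c' a b = (if a j > 0 then c (a(j := a j - 1)) b else 0)" for a b
    have "z $ j * f z = (\<Sum>a | sum a UNIV = Suc p. \<Sum>b | sum b UNIV = q.
        c' a b * (\<Prod>i\<in>UNIV. (z $ i) ^ a i) * (\<Prod>i\<in>UNIV. (cnj (z $ i)) ^ b i))" for z
    proof -
      define G where "G a = (\<Sum>b | sum b UNIV = q.
        c' a b * (\<Prod>i\<in>UNIV. (z $ i) ^ a i) * (\<Prod>i\<in>UNIV. (cnj (z $ i)) ^ b i))" for a
      have "z $ j * f z = (\<Sum>a | sum a UNIV = p. G (a(j := Suc (a j))))"
        unfolding f sum_distrib_left G_def prod_power_shift by (intro sum.cong refl) (simp add: c'_def)
      also have "\<dots> = (\<Sum>a | sum a UNIV = Suc p. if a j > 0 then G a else 0)"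
        by (rule multi_index_shift)
      also have "\<dots> = (\<Sum>a | sum a UNIV = Suc p. G a)"
        by (intro sum.cong refl) (simp add: G_def c'_def)
      finally show ?thesis unfolding G_def .
    qed
    then show ?case unfolding bihomogeneous_poly_def by blast
  next
    case (bipoly_cnj_nth p q f j)
    then obtain c where f: "f z = (\<Sum>a\<in>{a. sum a UNIV = p}. \<Sum>b\<in>{b. sum b UNIV = q}.
        c a b * (\<Prod>i\<in>UNIV. (z $ i) ^ a i) * (\<Prod>i\<in>UNIV. (cnj (z $ i)) ^ b i))" for z
      unfolding bihomogeneous_poly_def by blast
    define c' where "c' a b = (if b j > 0 then c a (b(j := b j - 1)) else 0)" for a b
    have "cnj (z $ j) * f z = (\<Sum>a | sum a UNIV = p. \<Sum>b | sum b UNIV = Suc q.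
        c' a b * (\<Prod>i\<in>UNIV. (z $ i) ^ a i) * (\<Prod>i\<in>UNIV. (cnj (z $ i)) ^ b i))" for z
    proof -
      define G where "G a b = c' a b * (\<Prod>i\<in>UNIV. (z $ i) ^ a i) * (\<Prod>i\<in>UNIV. (cnj (z $ i)) ^ b i)" for a b
      have sh: "(\<Prod>i\<in>UNIV. cnj (z $ i) ^ (b(j := Suc (b j))) i) = cnj (z $ j) * (\<Prod>i\<in>UNIV. cnj (z $ i) ^ b i)" for b
        by (rule prod_power_shift[of "\<lambda>i. cnj (z $ i)"])
      have "cnj (z $ j) * f z = (\<Sum>a | sum a UNIV = p. \<Sum>b | sum b UNIV = q. G a (b(j := Suc (b j))))"
        unfolding f sum_distrib_left G_def sh by (intro sum.cong refl) (simp add: c'_def)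
      also have "\<dots> = (\<Sum>a | sum a UNIV = p. \<Sum>b | sum b UNIV = Suc q. if b j > 0 then G a b else 0)"
        by (intro sum.cong refl multi_index_shift)
      also have "\<dots> = (\<Sum>a | sum a UNIV = p. \<Sum>b | sum b UNIV = Suc q. G a b)"
        by (intro sum.cong refl) (simp add: G_def c'_def)
      finally show ?thesis unfolding G_def .
    qed
    then show ?case unfolding bihomogeneous_poly_def by blast
  next
    case (bipoly_add p q f g)
    then obtain c d where f: "f z = (\<Sum>a\<in>{a. sum a UNIV = p}. \<Sum>b\<in>{b. sum b UNIV = q}.
        c a b * (\<Prod>i\<in>UNIV. (z $ i) ^ a i) * (\<Prod>i\<in>UNIV. (cnj (z $ i)) ^ b i))"
      and g: "g z = (\<Sum>a\<in>{a. sum a UNIV = p}. \<Sum>b\<in>{b. sum b UNIV = q}.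
        d a b * (\<Prod>i\<in>UNIV. (z $ i) ^ a i) * (\<Prod>i\<in>UNIV. (cnj (z $ i)) ^ b i))" for z
      unfolding bihomogeneous_poly_def by blast
    show ?case unfolding bihomogeneous_poly_def f g
      by (rule exI[of _ "\<lambda>a b. c a b + d a b"]) (simp add: sum.distrib distrib_right)
  qed
qed

lemma harmonic_polys_iff: "f \<in> harmonic_polys p q \<longleftrightarrow> bipoly p q f \<and> (\<forall>z. clap f z = 0)"
  unfolding harmonic_polys_def bihomogeneous_bipoly using laplacian_clap[of f] bipoly_cpoly[of p q f] by auto

lemma norm_sq_sum: "complex_of_real ((norm z)\<^sup>2) = (\<Sum>j\<in>UNIV. z $ j * cnj (z $ j))"
proof -
  have "(norm z)\<^sup>2 = (\<Sum>j\<in>UNIV. (norm (z $ j))\<^sup>2)"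
    by (simp add: norm_vec_def L2_set_def sum_nonneg)
  then show ?thesis by (simp only: of_real_sum complex_norm_square)
qed

lemma bipoly_hprod: "bipoly 1 0 (\<lambda>z. hprod z w)"
  unfolding hprod_def by (intro bipoly_sum, subst mult.commute) (rule bipoly_cmult[OF bipoly_coord])

lemma bipoly_cnj_hprod: "bipoly 0 1 (\<lambda>z. cnj (hprod z w))"
proof -
  have "(\<lambda>z. cnj (hprod z w)) = (\<lambda>z. \<Sum>j\<in>UNIV. w $ j * cnj (z $ j))" by (simp add: hprod_def mult.commute)
  then show ?thesis by (simp only:) (intro bipoly_sum bipoly_cmult bipoly_cnj_coord)
qed

lemma bipoly_norm_sq: "bipoly 1 1 (\<lambda>z. complex_of_real ((norm z)\<^sup>2))"
  unfolding norm_sq_sum using bipoly_nth[OF bipoly_cnj_coord] by (intro bipoly_sum) simp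

definition zmon :: "complex^'n \<Rightarrow> nat \<Rightarrow> nat \<Rightarrow> nat \<Rightarrow> complex^'n \<Rightarrow> complex" where
  "zmon w a b k z = hprod z w ^ a * cnj (hprod z w) ^ b * of_real ((norm z)\<^sup>2) ^ k"

lemma bipoly_zmon: "bipoly (a + k) (b + k) (zmon w a b k)"
  using bipoly_mult[OF bipoly_mult[OF bipoly_power[OF bipoly_hprod[of w], of a] bipoly_power[OF bipoly_cnj_hprod[of w], of b]] bipoly_power[OF bipoly_norm_sq, of k]]
  by (simp add: zmon_def[abs_def])

lemma has_w_hprod: "has_w (\<lambda>z. hprod z w) z (\<lambda>j. cnj (w $ j)) (\<lambda>_. 0)"
proof -
  have "has_w (\<lambda>z. \<Sum>i\<in>UNIV. z $ i * cnj (w $ i)) z (\<lambda>j. \<Sum>i\<in>UNIV. z $ i * 0 + (if j = i then 1 else 0) * cnj (w $ i)) (\<lambda>j. \<Sum>i\<in>UNIV. z $ i * 0 + 0 * cnj (w $ i))"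
    by (intro has_w_sum has_w_mult has_w_nth has_w_const)
  then show ?thesis by (simp add: hprod_def if_distrib[where f = "\<lambda>x. x * _"] cong: if_cong)
qed

lemma has_w_cnj_hprod: "has_w (\<lambda>z. cnj (hprod z w)) z (\<lambda>_. 0) (\<lambda>j. w $ j)"
proof -
  have "has_w (\<lambda>z. \<Sum>i\<in>UNIV. cnj (z $ i) * w $ i) z (\<lambda>j. \<Sum>i\<in>UNIV. cnj (z $ i) * 0 + 0 * w $ i) (\<lambda>j. \<Sum>i\<in>UNIV. cnj (z $ i) * 0 + (if j = i then 1 else 0) * w $ i)"
    by (intro has_w_sum has_w_mult has_w_cnj_nth has_w_const)
  then show ?thesis by (simp add: hprod_def if_distrib[where f = "\<lambda>x. x * _"] cong: if_cong)
qed

lemma has_w_norm_sq: "has_w (\<lambda>z. complex_of_real ((norm z)\<^sup>2)) z (\<lambda>j. cnj (z $ j)) (\<lambda>j. z $ j)"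
proof -
  have "has_w (\<lambda>z. \<Sum>i\<in>UNIV. z $ i * cnj (z $ i)) z (\<lambda>j. \<Sum>i\<in>UNIV. z $ i * 0 + (if j = i then 1 else 0) * cnj (z $ i)) (\<lambda>j. \<Sum>i\<in>UNIV. z $ i * (if j = i then 1 else 0) + 0 * cnj (z $ i))"
    by (intro has_w_sum has_w_mult has_w_nth has_w_cnj_nth)
  then show ?thesis unfolding norm_sq_sum by (simp add: if_distrib[where f = "\<lambda>x. x * _"] if_distrib[where f = "\<lambda>x. _ * x"] cong: if_cong)
qed

lemma has_w_zmon: "has_w (zmon w a b k) z
   (\<lambda>j. of_nat a * cnj (w $ j) * zmon w (a - 1) b k z + of_nat k * cnj (z $ j) * zmon w a b (k - 1) z)
   (\<lambda>j. of_nat b * w $ j * zmon w a (b - 1) k z + of_nat k * z $ j * zmon w a b (k - 1) z)"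
  using has_w_mult[OF has_w_mult[OF has_w_power[OF has_w_hprod[of w z], of a] has_w_power[OF has_w_cnj_hprod[of w z], of b]] has_w_power[OF has_w_norm_sq[of z], of k]]
  by (simp add: zmon_def[abs_def] algebra_simps)

text \<open>The cross terms contract to s, its conjugate or |z|^2, which restores the monomial with
  k lowered by one. They add up with the n diagonal terms to k(n + a + b + k - 1), so that only two
  monomials remain.\<close>

lemma clap_zmon:
  "clap (zmon w a b k) (z :: complex^'n) = of_nat (a * b) * of_real ((norm w)\<^sup>2) * zmon w (a - 1) (b - 1) k z
     + of_nat k * (of_nat (CARD('n) + a + b + k) - 1) * zmon w a b (k - 1) z"
proof -
  have g: "cpoly (zmon w a b k)" for a b k by (rule bipoly_cpoly[OF bipoly_zmon])
  have wbz: "wb j (zmon w a b k) = (\<lambda>z. (of_nat b * w $ j) * zmon w a (b - 1) k z + of_nat k * (z $ j * zmon w a b (k - 1) z))" for j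
    by (rule ext) (simp add: has_w_wb[OF has_w_zmon])
  have hz: "has_w (\<lambda>z. c * zmon w a (b - 1) k z + d * (z $ j * zmon w a b (k - 1) z)) z
     (\<lambda>l. c * wd l (zmon w a (b - 1) k) z + 0 * zmon w a (b - 1) k z + (d * (z $ j * wd l (zmon w a b (k - 1)) z + (if l = j then 1 else 0) * zmon w a b (k - 1) z) + 0 * (z $ j * zmon w a b (k - 1) z)))
     (\<lambda>l. c * wb l (zmon w a (b - 1) k) z + 0 * zmon w a (b - 1) k z + (d * (z $ j * wb l (zmon w a b (k - 1)) z + 0 * zmon w a b (k - 1) z) + 0 * (z $ j * zmon w a b (k - 1) z)))" for c d j
    by (intro has_w_add has_w_mult has_w_const has_w_nth cpoly_has_w g)
  have wdz: "wd j (zmon w a b k) z = of_nat a * cnj (w $ j) * zmon w (a - 1) b k z + of_nat k * cnj (z $ j) * zmon w a b (k - 1) z" for j a b k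
    by (rule has_w_wd[OF has_w_zmon])
  have S: "(\<Sum>j\<in>UNIV. z $ j * cnj (w $ j)) = hprod z w" "(\<Sum>j\<in>UNIV. w $ j * cnj (z $ j)) = cnj (hprod z w)"
    by (simp_all add: hprod_def mult.commute)
  have "wd j (wb j (zmon w a b k)) z = (of_nat b * w $ j) * wd j (zmon w a (b - 1) k) z + of_nat k * (z $ j * wd j (zmon w a b (k - 1)) z + zmon w a b (k - 1) z)" for j
    unfolding wbz using has_w_wd[OF hz] by simp
  then have "clap (zmon w a b k) z = (\<Sum>j\<in>UNIV. of_nat b * of_nat a * zmon w (a - 1) (b - 1) k z * (w $ j * cnj (w $ j))
      + of_nat b * of_nat k * zmon w a (b - 1) (k - 1) z * (w $ j * cnj (z $ j))
      + of_nat k * of_nat a * zmon w (a - 1) b (k - 1) z * (z $ j * cnj (w $ j))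
      + of_nat k * of_nat (k - 1) * zmon w a b (k - 1 - 1) z * (z $ j * cnj (z $ j))
      + of_nat k * zmon w a b (k - 1) z)"
    unfolding clap_def wdz by (simp add: algebra_simps)
  also have "\<dots> = of_nat b * of_nat a * zmon w (a - 1) (b - 1) k z * of_real ((norm w)\<^sup>2)
      + of_nat k * (of_nat b * (zmon w a (b - 1) (k - 1) z * cnj (hprod z w)))
      + of_nat k * (of_nat a * (zmon w (a - 1) b (k - 1) z * hprod z w))
      + of_nat k * (of_nat (k - 1) * (zmon w a b (k - 1 - 1) z * of_real ((norm z)\<^sup>2)))
      + of_nat CARD('n) * (of_nat k * zmon w a b (k - 1) z)"
    unfolding sum.distrib sum_distrib_left[symmetric] S norm_sq_sum[symmetric] by simp
  also have "of_nat b * (zmon w a (b - 1) (k - 1) z * cnj (hprod z w)) = of_nat b * zmon w a b (k - 1) z"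
    by (cases b) (simp_all add: zmon_def)
  also have "of_nat a * (zmon w (a - 1) b (k - 1) z * hprod z w) = of_nat a * zmon w a b (k - 1) z"
    by (cases a) (simp_all add: zmon_def)
  also have "of_nat (k - 1) * (zmon w a b (k - 1 - 1) z * of_real ((norm z)\<^sup>2)) = of_nat (k - 1) * zmon w a b (k - 1) z"
    by (cases "k - 1") (simp_all add: zmon_def)
  finally show ?thesis by (cases k) (simp_all add: algebra_simps)
qed

text \<open>By \<open>clap_zmon\<close> the Laplacian of the k-th term is t k + u k, and
  \<open>zcoef_rec\<close> says u (k+1) = - t k. The sum collapses; its ends vanish because u 0 has
  the factor k and t M the factor (p-M)(q-M).\<close>

lemma zonal_harmonic: "(\<lambda>z :: complex^'n. zonal CARD('n) p q (hprod z w) ((norm z)\<^sup>2 * (norm w)\<^sup>2)) \<in> harmonic_polys p q"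
proof -
  define M where "M = min p q"
  define c where "c k = complex_of_real (zcoef CARD('n) (p - k) (q - k) k * ((norm w)\<^sup>2) ^ k)" for k
  have Z: "(\<lambda>z :: complex^'n. zonal CARD('n) p q (hprod z w) ((norm z)\<^sup>2 * (norm w)\<^sup>2)) = (\<lambda>z. \<Sum>k\<le>M. c k * zmon w (p - k) (q - k) k z)"
    by (rule ext) (simp add: zonal_def M_def c_def zmon_def power_mult_distrib mult_ac)
  have bp: "bipoly p q (zmon w (p - k) (q - k) k)" if "k \<in> {..M}" for k
    using bipoly_zmon[of "p - k" k "q - k" w] that by (simp add: M_def)
  have "bipoly p q (\<lambda>z. \<Sum>k\<le>M. c k * zmon w (p - k) (q - k) k z)"
    by (intro bipoly_sum bipoly_cmult bp)
  moreover have "clap (\<lambda>z. \<Sum>k\<le>M. c k * zmon w (p - k) (q - k) k z) z = 0" for z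
  proof -
    have cp: "cpoly (zmon w a b k)" for a b k by (rule bipoly_cpoly[OF bipoly_zmon])
    have cm: "wd j (\<lambda>w. d * g w) = (\<lambda>w. d * wd j g w)" "wb j (\<lambda>w. d * g w) = (\<lambda>w. d * wb j g w)" if "cpoly g" for g :: "complex^'n \<Rightarrow> complex" and d j
      using wd_mult[OF cpoly_const that] wb_mult[OF cpoly_const that] by (simp_all add: wd_const wb_const)
    have lin: "clap (\<lambda>z. \<Sum>k\<le>M. c k * zmon w (p - k) (q - k) k z) z = (\<Sum>k\<le>M. c k * clap (zmon w (p - k) (q - k) k) z)"
      unfolding clap_def by (simp add: wd_sum wb_sum cm cp sum_distrib_left) (rule sum.swap)
    define t where "t k = c k * of_nat ((p - k) * (q - k)) * of_real ((norm w)\<^sup>2) * zmon w (p - k - 1) (q - k - 1) k z" for k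
    define u where "u k = c k * of_nat k * (of_nat (CARD('n) + (p - k) + (q - k) + k) - 1) * zmon w (p - k) (q - k) (k - 1) z" for k
    have ut: "u (Suc k) = - t k" if "k < M" for k
    proof -
      define A B where "A = p - Suc k" and "B = q - Suc k"
      have AB: "p - k = Suc A" "q - k = Suc B" "p - Suc k = A" "q - Suc k = B" using that by (auto simp: A_def B_def M_def)
      have "zcoef CARD('n) A B (Suc k) * real (Suc k) * real (A + B + k + CARD('n)) = - (real (A + 1) * real (B + 1) * zcoef CARD('n) (Suc A) (Suc B) k)"
        by (rule zcoef_rec) simp
      then have "complex_of_real (zcoef CARD('n) A B (Suc k) * real (Suc k) * real (A + B + k + CARD('n))) = complex_of_real (- (real (A + 1) * real (B + 1) * zcoef CARD('n) (Suc A) (Suc B) k))"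
        by (simp only:)
      then have e: "of_real (zcoef CARD('n) A B (Suc k)) * of_nat (Suc k) * of_nat (A + B + k + CARD('n)) = - (of_nat (Suc A * Suc B) * complex_of_real (zcoef CARD('n) (Suc A) (Suc B) k))"
        by (simp add: algebra_simps)
      have n1: "of_nat (CARD('n) + A + B + Suc k) - 1 = (of_nat (A + B + k + CARD('n)) :: complex)" by simp
      have "u (Suc k) = (of_real (zcoef CARD('n) A B (Suc k)) * of_nat (Suc k) * of_nat (A + B + k + CARD('n))) * (of_real (((norm w)\<^sup>2) ^ Suc k) * zmon w A B k z)"
        unfolding u_def c_def AB n1 by (simp add: mult_ac)
      also have "\<dots> = - t k" unfolding e t_def c_def AB by (simp add: mult_ac)
      finally show ?thesis .
    qed
    have "(\<Sum>k\<le>M. c k * clap (zmon w (p - k) (q - k) k) z) = (\<Sum>k\<le>M. t k) + (\<Sum>k\<le>M. u k)"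
      unfolding clap_zmon t_def u_def by (simp add: distrib_left sum.distrib mult_ac)
    also have "(\<Sum>k\<le>M. u k) = u 0 + (\<Sum>k<M. u (Suc k))"
      by (simp add: sum.atMost_shift)
    also have "\<dots> = - (\<Sum>k<M. t k)" using ut by (simp add: u_def sum_negf)
    also have "(\<Sum>k\<le>M. t k) + - (\<Sum>k<M. t k) = t M"
      by (simp add: lessThan_Suc_atMost[symmetric])
    also have "t M = 0" by (auto simp: t_def M_def min_def)
    finally show ?thesis using lin by simp
  qed
  ultimately show ?thesis unfolding Z harmonic_polys_iff by blast
qed

section \<open>Invariant integration over the sphere\<close>

lemma measurable_sphere_measure:
  assumes "rotation_invariant_sphere_measure \<sigma>" "f \<in> borel_measurable borel"
  shows "f \<in> borel_measurable \<sigma>"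
proof -
  have "f \<in> borel_measurable (restrict_space borel (sphere 0 1))"
    by (rule measurable_restrict_space1[OF assms(2)])
  moreover have "sets \<sigma> = sets (restrict_space borel (sphere 0 1))"
    using assms(1) by (simp add: rotation_invariant_sphere_measure_def)
  ultimately show ?thesis using measurable_cong_sets by blast
qed

lemma finite_sphere_measure:
  assumes "rotation_invariant_sphere_measure \<sigma>" shows "finite_measure \<sigma>"
  using assms by (intro finite_measureI) (simp add: rotation_invariant_sphere_measure_def)

lemma integrable_sphere_measure:
  fixes f :: "complex^'n \<Rightarrow> 'b::{second_countable_topology,banach}"
  assumes s: "rotation_invariant_sphere_measure \<sigma>" and f: "continuous_on UNIV f"
  shows "integrable \<sigma> f"
proof -
  interpret finite_measure \<sigma> by (rule finite_sphere_measure[OF s])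
  have "compact (f ` sphere 0 1)"
    using f by (intro compact_continuous_image continuous_on_subset[OF f]) auto
  then obtain B where B: "\<And>x. x \<in> sphere 0 1 \<Longrightarrow> norm (f x) \<le> B"
    using compact_imp_bounded bounded_iff by (metis imageI)
  have "space \<sigma> = sphere 0 1" using s by (simp add: rotation_invariant_sphere_measure_def)
  then have "AE x in \<sigma>. norm (f x) \<le> B" using B by (intro AE_I2) auto
  then show ?thesis
    by (rule integrable_const_bound) (intro measurable_sphere_measure[OF s] borel_measurable_continuous_onI f)
qed

lemma integrable_cpoly:
  "rotation_invariant_sphere_measure \<sigma> \<Longrightarrow> cpoly f \<Longrightarrow> integrable \<sigma> f"
  by (intro integrable_sphere_measure cpoly_continuous)

lemma integral_rotate:
  assumes s: "rotation_invariant_sphere_measure \<sigma>" and U: "orthogonal_transformation U"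
    and f: "cpoly f"
  shows "(LINT z|\<sigma>. f (U z)) = (LINT z|\<sigma>. f z)"
proof -
  have sets: "sets \<sigma> = sets (restrict_space borel (sphere 0 1))" and d: "distr \<sigma> \<sigma> U = \<sigma>"
    using s U by (auto simp: rotation_invariant_sphere_measure_def)
  have "continuous_on UNIV U"
    using U by (simp add: linear_continuous_on orthogonal_transformation_linear linear_linear)
  then have "U \<in> restrict_space borel (sphere 0 1) \<rightarrow>\<^sub>M restrict_space borel (sphere 0 1)"
    by (intro measurable_restrict_space3 borel_measurable_continuous_onI)
       (auto simp: orthogonal_transformation_norm[OF U])
  then have "U \<in> \<sigma> \<rightarrow>\<^sub>M \<sigma>"
    using measurable_cong_sets[OF sets sets] by blast
  then have "(LINT z|distr \<sigma> \<sigma> U. f z) = (LINT z|\<sigma>. f (U z))"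
    by (rule integral_distr) (intro measurable_sphere_measure[OF s] borel_measurable_continuous_onI cpoly_continuous f)
  then show ?thesis unfolding d ..
qed

text \<open>Supplies the constant that dominates the difference quotients in
  \<open>integral_rotation_generator\<close>.\<close>

lemma cpoly_lipschitz:
  "cpoly f \<Longrightarrow> \<exists>L\<ge>0. \<forall>x\<in>cball 0 1. \<forall>y\<in>cball 0 1. norm (f x - f y) \<le> L * norm (x - y)"
proof (induction rule: cpoly.induct)
  case (cpoly_const c)
  show ?case by (rule exI[of _ 0]) simp
next
  case (cpoly_nth j)
  show ?case by (rule exI[of _ 1]) (auto simp flip: vector_minus_component intro: component_le_norm_cart Finite_Cartesian_Product.norm_nth_le)
next
  case (cpoly_cnj_nth j)
  have "norm (cnj (x $ j) - cnj (y $ j)) \<le> norm (x - y)" for x y :: "complex^'a"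
    using Finite_Cartesian_Product.norm_nth_le[of "x - y" j] by (metis complex_cnj_diff complex_mod_cnj vector_minus_component)
  then show ?case by (intro exI[of _ 1]) auto
next
  case (cpoly_add f g)
  then obtain L M where L: "L \<ge> 0" "\<forall>x\<in>cball 0 1. \<forall>y\<in>cball 0 1. norm (f x - f y) \<le> L * norm (x - y)"
    and M: "M \<ge> 0" "\<forall>x\<in>cball 0 1. \<forall>y\<in>cball 0 1. norm (g x - g y) \<le> M * norm (x - y)" by blast
  have "norm (f x + g x - (f y + g y)) \<le> (L + M) * norm (x - y)" if "x \<in> cball 0 1" "y \<in> cball 0 1" for x y
  proof -
    have "norm (f x + g x - (f y + g y)) \<le> norm (f x - f y) + norm (g x - g y)"
      by (metis add_diff_add norm_triangle_ineq)
    also have "\<dots> \<le> L * norm (x - y) + M * norm (x - y)" using L(2) M(2) that by (intro add_mono) auto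
    finally show ?thesis by (simp add: distrib_right)
  qed
  then show ?case using L(1) M(1) by (intro exI[of _ "L + M"]) auto
next
  case (cpoly_mult f g)
  then obtain L M where L: "L \<ge> 0" "\<forall>x\<in>cball 0 1. \<forall>y\<in>cball 0 1. norm (f x - f y) \<le> L * norm (x - y)"
    and M: "M \<ge> 0" "\<forall>x\<in>cball 0 1. \<forall>y\<in>cball 0 1. norm (g x - g y) \<le> M * norm (x - y)" by blast
  have bd: "\<exists>B\<ge>0. \<forall>x\<in>cball 0 1. norm (h x) \<le> B" if "cpoly h" for h :: "complex^'a \<Rightarrow> complex"
  proof -
    have "compact (h ` cball 0 1)"
      by (intro compact_continuous_image cpoly_continuous that) auto
    then obtain B where "\<And>x. x \<in> cball 0 1 \<Longrightarrow> norm (h x) \<le> B"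
      using compact_imp_bounded bounded_iff by (metis imageI)
    then show ?thesis by (intro exI[of _ "max B 0"]) (auto simp: le_max_iff_disj)
  qed
  obtain B where B: "B \<ge> 0" "\<forall>x\<in>cball 0 1. norm (f x) \<le> B" using bd[OF cpoly_mult.hyps(1)] by blast
  obtain C where C: "C \<ge> 0" "\<forall>x\<in>cball 0 1. norm (g x) \<le> C" using bd[OF cpoly_mult.hyps(2)] by blast
  have "norm (f x * g x - f y * g y) \<le> (B * M + L * C) * norm (x - y)" if xy: "x \<in> cball 0 1" "y \<in> cball 0 1" for x y
  proof -
    have "f x * g x - f y * g y = f x * (g x - g y) + (f x - f y) * g y" by (simp add: algebra_simps)
    then have "norm (f x * g x - f y * g y) \<le> norm (f x) * norm (g x - g y) + norm (f x - f y) * norm (g y)"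
      by (metis norm_mult norm_triangle_ineq)
    also have "\<dots> \<le> B * (M * norm (x - y)) + (L * norm (x - y)) * C"
      using B C L M xy by (intro add_mono mult_mono) auto
    finally show ?thesis by (simp add: algebra_simps)
  qed
  then show ?case using L(1) M(1) B(1) C(1) by (intro exI[of _ "B * M + L * C"]) auto
qed

text \<open>The integral of f(U t z) does not depend on t, so its derivative at t = 0 is zero;
  dominated convergence along t = 1/(k+1) moves the derivative inside. The orthogonality conditions
  say that A is an infinitesimal rotation of the range of the projection P.\<close>

lemma integral_rotation_generator:
  fixes A P :: "complex^'n \<Rightarrow> complex^'n"
  assumes s: "rotation_invariant_sphere_measure \<sigma>" and f: "cpoly f"
    and A: "linear A" and P: "linear P"
    and orth: "\<And>z. z \<bullet> A z = 0" "\<And>z. A z \<bullet> P z = 0" "\<And>z. z \<bullet> P z = P z \<bullet> P z" "\<And>z. A z \<bullet> A z = P z \<bullet> P z"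
  shows "(LINT z|\<sigma>. (\<Sum>j\<in>UNIV. A z $ j * wd j f z + cnj (A z $ j) * wb j f z)) = 0"
proof -
  interpret finite_measure \<sigma> by (rule finite_sphere_measure[OF s])
  \<comment> \<open>This is exp(tA) when A is a quarter turn on the range of P and zero on its
    complement. The expansion of |U t z|^2 leaves |P z|^2 (sin^2 + cos^2 - 1).\<close>
  define U where "U t z = z + (sin t *\<^sub>R A z + (cos t - 1) *\<^sub>R P z)" for t z
  have U: "orthogonal_transformation (U t)" for t
    unfolding orthogonal_transformation
  proof (intro conjI allI)
    show "linear (U t)" unfolding U_def
      by (intro linear_compose_add linear_compose_scale_right A P linear_id[unfolded id_def])
    fix z
    have "U t z \<bullet> U t z = z \<bullet> z + (P z \<bullet> P z) * ((sin t)\<^sup>2 + (cos t)\<^sup>2 - 1)"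
      unfolding U_def
      by (simp add: inner_add_left inner_add_right orth inner_commute[of "A z" z] inner_commute[of "P z" z] inner_commute[of "P z" "A z"] power2_eq_square algebra_simps)
         (metis distrib_right mult.assoc mult_1 sin_cos_squared_add3)
    then show "norm (U t z) = norm z" by (simp add: norm_eq_sqrt_inner)
  qed
  have sp: "space \<sigma> = sphere 0 1" using s by (simp add: rotation_invariant_sphere_measure_def)
  define D where "D z = (\<Sum>j\<in>UNIV. A z $ j * wd j f z + cnj (A z $ j) * wb j f z)" for z
  define t where "t k = inverse (real (Suc k))" for k
  have t: "t k > 0" for k by (simp add: t_def)
  have t0: "t \<longlonglongrightarrow> 0" unfolding t_def by (rule LIMSEQ_inverse_real_of_nat)
  define S where "S k z = of_real (1 / t k) * (f (U (t k) z) - f z)" for k z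
  have contU: "continuous_on UNIV (U r)" for r
    using U by (simp add: linear_continuous_on orthogonal_transformation_linear linear_linear)
  have contfU: "continuous_on UNIV (\<lambda>z. f (U r z))" for r
    by (rule continuous_on_compose2[OF cpoly_continuous[OF f, of UNIV] contU]) auto
  have contS: "continuous_on UNIV (S k)" for k
    unfolding S_def[abs_def] by (intro continuous_intros contfU cpoly_continuous f)
  have S0: "(LINT z|\<sigma>. S k z) = 0" for k
    unfolding S_def using integral_rotate[OF s U f]
    by (simp add: integrable_sphere_measure[OF s contfU] integrable_cpoly[OF s f])
  have lim: "(\<lambda>k. S k z) \<longlonglongrightarrow> D z" for z
  proof -
    have hU: "((\<lambda>r. U r z) has_derivative (\<lambda>h. h *\<^sub>R A z)) (at 0)"
      unfolding U_def by (auto intro!: derivative_eq_intros)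
    have "(f has_derivative (\<lambda>v. \<Sum>j\<in>UNIV. v $ j * wd j f z + cnj (v $ j) * wb j f z)) (at (U 0 z))"
      using cpoly_has_w[OF f, of z] by (simp add: has_w_def U_def)
    from has_derivative_compose[OF hU this]
    have "((\<lambda>r. f (U r z)) has_derivative (\<lambda>h. \<Sum>j\<in>UNIV. (h *\<^sub>R A z) $ j * wd j f z + cnj ((h *\<^sub>R A z) $ j) * wb j f z)) (at 0)" .
    moreover have "(\<Sum>j\<in>UNIV. (h *\<^sub>R A z) $ j * wd j f z + cnj ((h *\<^sub>R A z) $ j) * wb j f z) = h *\<^sub>R D z" for h
      by (simp add: D_def scaleR_sum_right scaleR_add_right)
    ultimately have "((\<lambda>r. f (U r z)) has_vector_derivative D z) (at 0)"
      by (simp add: has_vector_derivative_def)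
    then have "((\<lambda>r. norm (f (U r z) - f (U 0 z) - (r - 0) *\<^sub>R D z) / norm (r - 0)) \<longlongrightarrow> 0) (at 0)"
      unfolding has_vector_derivative_def has_derivative_iff_norm by blast
    then have "(\<lambda>k. norm (f (U (t k) z) - f (U 0 z) - (t k - 0) *\<^sub>R D z) / norm (t k - 0)) \<longlonglongrightarrow> 0"
      by (rule filterlim_compose) (use t t0 in \<open>auto simp: filterlim_at less_imp_neq[THEN not_sym] intro!: always_eventually\<close>)
    moreover have "norm (f (U (t k) z) - f (U 0 z) - (t k - 0) *\<^sub>R D z) / norm (t k - 0) = norm (S k z - D z)" for k
    proof -
      have "S k z - D z = of_real (1 / t k) * (f (U (t k) z) - f (U 0 z) - (t k - 0) *\<^sub>R D z)"
        using t[of k] by (simp add: S_def U_def scaleR_conv_of_real right_diff_distrib)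
      then show ?thesis using t[of k] by (simp add: norm_divide)
    qed
    ultimately have "(\<lambda>k. norm (S k z - D z)) \<longlonglongrightarrow> 0" by simp
    then show ?thesis by (rule LIM_zero_cancel[OF tendsto_norm_zero_cancel])
  qed
  obtain L where L: "L \<ge> 0" "\<And>x y. x \<in> cball 0 1 \<Longrightarrow> y \<in> cball 0 1 \<Longrightarrow> norm (f x - f y) \<le> L * norm (x - y)"
    using cpoly_lipschitz[OF f] by blast
  obtain a where a: "\<And>z. norm (A z) \<le> norm z * a"
    using bounded_linear.bounded[OF A[unfolded linear_conv_bounded_linear]] by blast
  obtain p where p: "\<And>z. norm (P z) \<le> norm z * p"
    using bounded_linear.bounded[OF P[unfolded linear_conv_bounded_linear]] by blast
  have bound: "norm (S k z) \<le> L * (a + p)" if z: "z \<in> sphere 0 1" for k z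
  proof -
    have "norm (U (t k) z) = norm z" by (rule orthogonal_transformation_norm[OF U])
    then have "norm (f (U (t k) z) - f z) \<le> L * norm (U (t k) z - z)"
      using z by (intro L(2)) auto
    also have "norm (U (t k) z - z) \<le> \<bar>sin (t k)\<bar> * norm (A z) + \<bar>cos (t k) - 1\<bar> * norm (P z)"
      unfolding U_def using norm_triangle_ineq[of "sin (t k) *\<^sub>R A z" "(cos (t k) - 1) *\<^sub>R P z"] by simp
    also have "\<dots> \<le> t k * a + t k * p"
    proof (intro add_mono mult_mono)
      show "\<bar>sin (t k)\<bar> \<le> t k" using abs_sin_x_le_abs_x[of "t k"] t[of k] by simp
      show "\<bar>cos (t k) - 1\<bar> \<le> t k"
      proof -
        have "\<bar>sin (t k / 2)\<bar> * \<bar>sin (t k / 2)\<bar> \<le> (t k / 2) * 1"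
          using abs_sin_x_le_abs_x[of "t k / 2"] t[of k] by (intro mult_mono) auto
        moreover have "\<bar>sin (t k / 2)\<bar> * \<bar>sin (t k / 2)\<bar> = (sin (t k / 2))\<^sup>2" by (simp add: power2_eq_square)
        ultimately show ?thesis using cos_double_sin[of "t k / 2"] by simp
      qed
      show "norm (A z) \<le> a" "norm (P z) \<le> p" using a[of z] p[of z] z by auto
    qed (use t[of k] in auto)
    finally have "norm (f (U (t k) z) - f z) \<le> L * (t k * a + t k * p)" using L(1) by (simp add: mult_left_mono)
    then show ?thesis unfolding S_def using t[of k] by (simp add: norm_mult norm_divide divide_simps algebra_simps)
  qed
  have "(\<lambda>k. LINT z|\<sigma>. S k z) \<longlonglongrightarrow> (LINT z|\<sigma>. D z)"
  proof (rule integral_dominated_convergence[where w = "\<lambda>_. L * (a + p)"])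
    show "D \<in> borel_measurable \<sigma>"
      by (rule borel_measurable_LIMSEQ_metric[where f = S])
         (intro measurable_sphere_measure[OF s] borel_measurable_continuous_onI contS, rule lim)
    show "S k \<in> borel_measurable \<sigma>" for k
      by (intro measurable_sphere_measure[OF s] borel_measurable_continuous_onI contS)
    show "AE x in \<sigma>. norm (S k x) \<le> L * (a + p)" for k
      using bound sp by (intro AE_I2) auto
  qed (use lim in auto)
  then have "(\<lambda>k :: nat. 0 :: complex) \<longlonglongrightarrow> (LINT z|\<sigma>. D z)" by (simp only: S0)
  then have "(LINT z|\<sigma>. D z) = 0" by (rule LIMSEQ_unique[OF _ tendsto_const])
  then show ?thesis unfolding D_def .
qed

text \<open>The operator comes from an elementary complex matrix, which generates no rotation. For i
  = j it is \<i> times a phase rotation up to sign; for i and j distinct it is a complex combination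
  of two real generators, taken with \<omega> = 1 and \<omega> = \<i>.\<close>

lemma integral_unitary_generator:
  assumes s: "rotation_invariant_sphere_measure \<sigma>" and f: "cpoly (f :: complex^'n \<Rightarrow> complex)"
  shows "(LINT z|\<sigma>. z $ i * wd j f z - cnj (z $ j) * wb i f z) = 0"
proof (cases "i = j")
  case True
  define A P where "A z = axis j (\<i> * z $ j)" and "P z = axis j (z $ j)" for z :: "complex^'n"
  have lin: "linear A" "linear P"
    by (auto intro!: linearI simp: A_def P_def vec_eq_iff axis_def algebra_simps)
  have "(LINT z|\<sigma>. (\<Sum>l\<in>UNIV. A z $ l * wd l f z + cnj (A z $ l) * wb l f z)) = 0"
    by (rule integral_rotation_generator[OF s f lin])
       (auto simp: A_def P_def inner_axis inner_axis' inner_complex_def algebra_simps)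
  moreover have "(\<Sum>l\<in>UNIV. A z $ l * wd l f z + cnj (A z $ l) * wb l f z) = \<i> * (z $ i * wd j f z - cnj (z $ j) * wb i f z)" for z
  proof -
    have "(\<Sum>l\<in>UNIV. A z $ l * wd l f z + cnj (A z $ l) * wb l f z) = (\<Sum>l\<in>UNIV. if l = j then \<i> * (z $ i * wd j f z - cnj (z $ j) * wb i f z) else 0)"
      by (rule sum.cong) (auto simp: A_def axis_def True algebra_simps)
    then show ?thesis by simp
  qed
  ultimately show ?thesis by simp
next
  case False
  have gen: "(LINT z|\<sigma>. \<omega> * z $ j * wd i f z - cnj \<omega> * z $ i * wd j f z + cnj \<omega> * cnj (z $ j) * wb i f z - \<omega> * cnj (z $ i) * wb j f z) = 0"
    if "norm \<omega> = 1" for \<omega>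
  proof -
    define A P where "A z = axis i (\<omega> * z $ j) - axis j (cnj \<omega> * z $ i)" and "P z = axis i (z $ i) + axis j (z $ j)" for z :: "complex^'n"
    have lin: "linear A" "linear P"
      by (auto intro!: linearI simp: A_def P_def vec_eq_iff axis_def algebra_simps)
    have "cnj \<omega> * \<omega> = 1" using complex_norm_square[of \<omega>] that by (simp add: mult.commute)
    then have w4: "cnj \<omega> * (\<omega> * x) = x" for x by (metis mult.assoc mult_1)
    have w2: "(\<omega> * x) \<bullet> (\<omega> * x) = x \<bullet> x" "(cnj \<omega> * x) \<bullet> (cnj \<omega> * x) = x \<bullet> x" for x
      using that by (simp_all add: dot_square_norm norm_mult)
    have w3: "x \<bullet> (\<omega> * y) = y \<bullet> (cnj \<omega> * x)" for x y by (simp add: inner_complex_def algebra_simps)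
    have nth: "axis i x $ j = 0" "axis j x $ i = 0" "axis i x $ i = x" "axis j x $ j = x" for x :: complex
      using False by (auto simp: axis_def)
    have "(LINT z|\<sigma>. (\<Sum>l\<in>UNIV. A z $ l * wd l f z + cnj (A z $ l) * wb l f z)) = 0"
      by (rule integral_rotation_generator[OF s f lin])
         (use False in \<open>auto simp: A_def P_def inner_axis inner_axis' inner_diff_left inner_diff_right inner_add_left inner_add_right nth w2 w3 w4 inner_commute\<close>)
    moreover have "(\<Sum>l\<in>UNIV. A z $ l * wd l f z + cnj (A z $ l) * wb l f z) =
        \<omega> * z $ j * wd i f z - cnj \<omega> * z $ i * wd j f z + cnj \<omega> * cnj (z $ j) * wb i f z - \<omega> * cnj (z $ i) * wb j f z" for z
    proof -
      have "(\<Sum>l\<in>UNIV. A z $ l * wd l f z + cnj (A z $ l) * wb l f z) = (\<Sum>l\<in>UNIV. (if l = i then \<omega> * z $ j * wd i f z + cnj \<omega> * cnj (z $ j) * wb i f z else 0)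
          + (if l = j then - cnj \<omega> * z $ i * wd j f z - \<omega> * cnj (z $ i) * wb j f z else 0))"
        by (rule sum.cong) (use False in \<open>auto simp: A_def axis_def algebra_simps\<close>)
      then show ?thesis by (simp add: sum.distrib)
    qed
    ultimately show ?thesis by simp
  qed
  note int = integrable_cpoly[OF s]
  define X Y where "X = (\<lambda>z. z $ i * wd j f z - cnj (z $ j) * wb i f z)" and "Y = (\<lambda>z. z $ j * wd i f z - cnj (z $ i) * wb j f z)"
  have XY: "integrable \<sigma> X" "integrable \<sigma> Y"
    unfolding X_def Y_def by (intro Bochner_Integration.integrable_diff int cpoly.intros cpoly_wd cpoly_wb f)+
  \<comment> \<open>With X for (i,j) and Y for (j,i), the two choices of \<omega> give Y - X and
    \<i>(Y + X), whose integrals determine that of X.\<close>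
  have "(LINT z|\<sigma>. Y z - X z) = 0"
    using gen[of 1] by (simp add: X_def Y_def algebra_simps)
  moreover have "(LINT z|\<sigma>. \<i> * (Y z + X z)) = 0"
    using gen[of \<i>] by (simp add: X_def Y_def algebra_simps)
  ultimately have "(LINT z|\<sigma>. X z) = 0"
    using XY by simp
  then show ?thesis by (simp add: X_def)
qed

lemma sphere_integral_cong:
  assumes "rotation_invariant_sphere_measure \<sigma>" "\<And>z. norm z = 1 \<Longrightarrow> f z = g z"
  shows "(LINT z|\<sigma>. f z) = (LINT z|\<sigma>. g z)"
  using assms by (intro Bochner_Integration.integral_cong) (auto simp: rotation_invariant_sphere_measure_def)

lemma norm_sq_unit: "norm z = 1 \<Longrightarrow> (\<Sum>j\<in>UNIV. z $ j * cnj (z $ j)) = 1"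
  using norm_sq_sum[of z] by simp

text \<open>Apply the invariance to cnj(z_i) Q and sum over i. The squares |z_i|^2 add up to 1 on
  the sphere, Euler's identity gives q, and the n derivatives of the factors cnj(z_i) give
  n.\<close>

lemma integral_by_parts_wd:
  fixes Q :: "complex^'n \<Rightarrow> complex"
  assumes s: "rotation_invariant_sphere_measure \<sigma>" and Q: "bipoly p q Q"
  shows "of_nat (CARD('n) + q) * (LINT z|\<sigma>. cnj (z $ j) * Q z) = (LINT z|\<sigma>. wd j Q z)"
proof -
  have c: "cpoly Q" by (rule bipoly_cpoly[OF Q])
  define F where "F i z = z $ i * wd j (\<lambda>z. cnj (z $ i) * Q z) z - cnj (z $ j) * wb i (\<lambda>z. cnj (z $ i) * Q z) z" for i z
  have iF: "integrable \<sigma> (F i)" for i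
    unfolding F_def[abs_def] by (intro Bochner_Integration.integrable_diff integrable_cpoly[OF s] cpoly.intros cpoly_wd cpoly_wb c)
  have sum: "(\<Sum>i\<in>UNIV. F i z) = wd j Q z - of_nat (CARD('n) + q) * (cnj (z $ j) * Q z)" if "norm z = 1" for z
  proof -
    have "(\<Sum>i\<in>UNIV. F i z) = (\<Sum>i\<in>UNIV. (z $ i * cnj (z $ i)) * wd j Q z - cnj (z $ j) * (cnj (z $ i) * wb i Q z) - cnj (z $ j) * Q z)"
      unfolding F_def wd_cnj_nth_mult[OF c] wb_cnj_nth_mult[OF c] by (rule sum.cong) (auto simp: algebra_simps)
    also have "\<dots> = wd j Q z - cnj (z $ j) * (of_nat q * Q z) - of_nat CARD('n) * (cnj (z $ j) * Q z)"
      unfolding sum_subtractf sum_distrib_left[symmetric] sum_distrib_right[symmetric] euler_wb[OF Q] norm_sq_unit[OF that] by simp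
    finally show ?thesis by (simp add: algebra_simps)
  qed
  have "0 = (\<Sum>i\<in>UNIV. LINT z|\<sigma>. F i z)"
    unfolding F_def by (simp add: integral_unitary_generator[OF s] c)
  also have "\<dots> = (LINT z|\<sigma>. (\<Sum>i\<in>UNIV. F i z))"
    by (rule Bochner_Integration.integral_sum[symmetric]) (rule iF)
  also have "\<dots> = (LINT z|\<sigma>. wd j Q z - of_nat (CARD('n) + q) * (cnj (z $ j) * Q z))"
    by (rule sphere_integral_cong[OF s sum])
  also have "\<dots> = (LINT z|\<sigma>. wd j Q z) - of_nat (CARD('n) + q) * (LINT z|\<sigma>. cnj (z $ j) * Q z)"
    by (subst Bochner_Integration.integral_diff) (auto intro!: integrable_cpoly[OF s] simp: c simp del: of_nat_add)
  finally show ?thesis by simp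
qed

lemma integral_by_parts_wb:
  fixes Q :: "complex^'n \<Rightarrow> complex"
  assumes s: "rotation_invariant_sphere_measure \<sigma>" and Q: "bipoly p q Q"
  shows "of_nat (CARD('n) + p) * (LINT z|\<sigma>. z $ j * Q z) = (LINT z|\<sigma>. wb j Q z)"
proof -
  have c: "cpoly Q" by (rule bipoly_cpoly[OF Q])
  define F where "F i z = z $ j * wd i (\<lambda>z. z $ i * Q z) z - cnj (z $ i) * wb j (\<lambda>z. z $ i * Q z) z" for i z
  have iF: "integrable \<sigma> (F i)" for i
    unfolding F_def[abs_def] by (intro Bochner_Integration.integrable_diff integrable_cpoly[OF s] cpoly.intros cpoly_wd cpoly_wb c)
  have sum: "(\<Sum>i\<in>UNIV. F i z) = of_nat (CARD('n) + p) * (z $ j * Q z) - wb j Q z" if "norm z = 1" for z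
  proof -
    have "(\<Sum>i\<in>UNIV. F i z) = (\<Sum>i\<in>UNIV. z $ j * Q z + z $ j * (z $ i * wd i Q z) - (z $ i * cnj (z $ i)) * wb j Q z)"
      unfolding F_def wd_nth_mult[OF c] wb_nth_mult[OF c] by (rule sum.cong) (auto simp: algebra_simps)
    also have "\<dots> = of_nat CARD('n) * (z $ j * Q z) + z $ j * (of_nat p * Q z) - wb j Q z"
      unfolding sum_subtractf sum.distrib sum_distrib_left[symmetric] sum_distrib_right[symmetric] euler_wd[OF Q] norm_sq_unit[OF that] by simp
    finally show ?thesis by (simp add: algebra_simps)
  qed
  have "0 = (\<Sum>i\<in>UNIV. LINT z|\<sigma>. F i z)"
    unfolding F_def by (simp add: integral_unitary_generator[OF s] c)
  also have "\<dots> = (LINT z|\<sigma>. (\<Sum>i\<in>UNIV. F i z))"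
    by (rule Bochner_Integration.integral_sum[symmetric]) (rule iF)
  also have "\<dots> = (LINT z|\<sigma>. of_nat (CARD('n) + p) * (z $ j * Q z) - wb j Q z)"
    by (rule sphere_integral_cong[OF s sum])
  also have "\<dots> = of_nat (CARD('n) + p) * (LINT z|\<sigma>. z $ j * Q z) - (LINT z|\<sigma>. wb j Q z)"
    by (subst Bochner_Integration.integral_diff) (auto intro!: integrable_cpoly[OF s] simp: c simp del: of_nat_add)
  finally show ?thesis by simp
qed

section \<open>Moments of harmonic polynomials against powers of the Hermitian product\<close>

definition dwd :: "complex^'n \<Rightarrow> (complex^'n \<Rightarrow> complex) \<Rightarrow> complex^'n \<Rightarrow> complex" where
  "dwd w f z = (\<Sum>j\<in>UNIV. w $ j * wd j f z)"

definition dwb :: "complex^'n \<Rightarrow> (complex^'n \<Rightarrow> complex) \<Rightarrow> complex^'n \<Rightarrow> complex" where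
  "dwb w f z = (\<Sum>j\<in>UNIV. cnj (w $ j) * wb j f z)"

lemma bipoly_dwd: "bipoly p q f \<Longrightarrow> bipoly (p - 1) q (dwd w f)"
  unfolding dwd_def[abs_def] by (intro bipoly_sum bipoly_cmult bipoly_wdI)

lemma bipoly_dwb: "bipoly p q f \<Longrightarrow> bipoly p (q - 1) (dwb w f)"
  unfolding dwb_def[abs_def] by (intro bipoly_sum bipoly_cmult bipoly_wbI)

lemma clap_lincomb:
  fixes f :: "'i \<Rightarrow> complex^'n \<Rightarrow> complex"
  assumes "\<And>i. i \<in> S \<Longrightarrow> cpoly (f i)"
  shows "clap (\<lambda>z. \<Sum>i\<in>S. c i * f i z) z = (\<Sum>i\<in>S. c i * clap (f i) z)"
proof -
  have cm: "wd j (\<lambda>w. d * g w) = (\<lambda>w. d * wd j g w)" "wb j (\<lambda>w. d * g w) = (\<lambda>w. d * wb j g w)" if "cpoly g" for g :: "complex^'n \<Rightarrow> complex" and d j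
    using wd_mult[OF cpoly_const that] wb_mult[OF cpoly_const that] by (simp_all add: wd_const wb_const)
  show ?thesis
    unfolding clap_def using assms by (simp add: wd_sum wb_sum cm sum_distrib_left) (rule sum.swap)
qed

lemma harmonic_dwd: "f \<in> harmonic_polys p q \<Longrightarrow> dwd w f \<in> harmonic_polys (p - 1) q"
proof -
  assume f: "f \<in> harmonic_polys p q"
  then have b: "bipoly p q f" and h: "clap f = (\<lambda>z. 0)" by (auto simp: harmonic_polys_iff)
  have "clap (dwd w f) z = 0" for z
    unfolding dwd_def[abs_def] using bipoly_cpoly[OF b] by (simp add: clap_lincomb clap_wd h wd_const)
  then show ?thesis using bipoly_dwd[OF b] by (simp add: harmonic_polys_iff)
qed

lemma harmonic_dwb: "f \<in> harmonic_polys p q \<Longrightarrow> dwb w f \<in> harmonic_polys p (q - 1)"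
proof -
  assume f: "f \<in> harmonic_polys p q"
  then have b: "bipoly p q f" and h: "clap f = (\<lambda>z. 0)" by (auto simp: harmonic_polys_iff)
  have "clap (dwb w f) z = 0" for z
    unfolding dwb_def[abs_def] using bipoly_cpoly[OF b] by (simp add: clap_lincomb clap_wb h wb_const)
  then show ?thesis using bipoly_dwb[OF b] by (simp add: harmonic_polys_iff)
qed

lemma cpoly_zmon [simp]: "cpoly (zmon w a b k)" by (rule bipoly_cpoly[OF bipoly_zmon])

lemma wd_zmon0: "wd j (zmon w b a 0) z = of_nat b * cnj (w $ j) * zmon w (b - 1) a 0 z"
  using has_w_wd[OF has_w_zmon[of w b a 0 z]] by simp

lemma wb_zmon0: "wb j (zmon w b a 0) z = of_nat a * w $ j * zmon w b (a - 1) 0 z"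
  using has_w_wb[OF has_w_zmon[of w b a 0 z]] by simp

text \<open>One conjugate factor of the Hermitian product is written as the sum of w_j cnj(z_j) and
  integrated by parts. The derivative falls either on f, in direction w, or on the power of s, where
  it produces |w|^2.\<close>

lemma zonal_moment_step_wd:
  fixes f :: "complex^'n \<Rightarrow> complex"
  assumes s: "rotation_invariant_sphere_measure \<sigma>" and f: "bipoly p q f"
  shows "of_nat (CARD('n) + q + a) * (LINT z|\<sigma>. f z * zmon w b (Suc a) 0 z) =
     (LINT z|\<sigma>. dwd w f z * zmon w b a 0 z) + of_nat b * of_real ((norm w)\<^sup>2) * (LINT z|\<sigma>. f z * zmon w (b - 1) a 0 z)"
proof -
  note [simp] = bipoly_cpoly[OF f]
  note int = integrable_cpoly[OF s]
  define Q where "Q z = f z * zmon w b a 0 z" for z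
  have Q: "bipoly (p + b) (q + a) Q"
    unfolding Q_def[abs_def] using bipoly_mult[OF f bipoly_zmon[of b 0 a w]] by simp
  have cQ [simp]: "cpoly Q" by (rule bipoly_cpoly[OF Q])
  have dw [simp]: "cpoly (dwd w f)" by (rule bipoly_cpoly[OF bipoly_dwd[OF f]])
  have wQ: "(\<Sum>j\<in>UNIV. w $ j * wd j Q z) = dwd w f z * zmon w b a 0 z + of_nat b * of_real ((norm w)\<^sup>2) * (f z * zmon w (b - 1) a 0 z)" for z
  proof -
    have "wd j Q z = f z * (of_nat b * cnj (w $ j) * zmon w (b - 1) a 0 z) + wd j f z * zmon w b a 0 z" for j
      unfolding Q_def[abs_def] by (simp add: wd_mult wd_zmon0)
    then have "(\<Sum>j\<in>UNIV. w $ j * wd j Q z) = (\<Sum>j\<in>UNIV. (w $ j * wd j f z) * zmon w b a 0 z + (w $ j * cnj (w $ j)) * (of_nat b * (f z * zmon w (b - 1) a 0 z)))"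
      by (simp add: algebra_simps)
    then show ?thesis
      unfolding sum.distrib sum_distrib_right[symmetric] norm_sq_sum[symmetric] dwd_def[symmetric] by simp
  qed
  have hp: "f z * zmon w b (Suc a) 0 z = (\<Sum>j\<in>UNIV. w $ j * (cnj (z $ j) * Q z))" for z
    by (simp add: Q_def zmon_def hprod_def sum_distrib_left sum_distrib_right algebra_simps)
  have "(LINT z|\<sigma>. f z * zmon w b (Suc a) 0 z) = (\<Sum>j\<in>UNIV. w $ j * (LINT z|\<sigma>. cnj (z $ j) * Q z))"
    unfolding hp by (subst Bochner_Integration.integral_sum) (auto intro!: int)
  then have "of_nat (CARD('n) + q + a) * (LINT z|\<sigma>. f z * zmon w b (Suc a) 0 z) =
    (\<Sum>j\<in>UNIV. w $ j * (of_nat (CARD('n) + (q + a)) * (LINT z|\<sigma>. cnj (z $ j) * Q z)))"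
    by (simp only: sum_distrib_left mult.left_commute add.assoc)
  also have "\<dots> = (\<Sum>j\<in>UNIV. w $ j * (LINT z|\<sigma>. wd j Q z))"
    unfolding integral_by_parts_wd[OF s Q] ..
  also have "\<dots> = (LINT z|\<sigma>. (\<Sum>j\<in>UNIV. w $ j * wd j Q z))"
    by (subst Bochner_Integration.integral_sum) (auto intro!: int)
  also have "\<dots> = (LINT z|\<sigma>. dwd w f z * zmon w b a 0 z) + of_nat b * of_real ((norm w)\<^sup>2) * (LINT z|\<sigma>. f z * zmon w (b - 1) a 0 z)"
    unfolding wQ by (subst Bochner_Integration.integral_add) (auto intro!: int)
  finally show ?thesis .
qed

lemma zonal_moment_step_wb:
  fixes f :: "complex^'n \<Rightarrow> complex"
  assumes s: "rotation_invariant_sphere_measure \<sigma>" and f: "bipoly p q f"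
  shows "of_nat (CARD('n) + p + b) * (LINT z|\<sigma>. f z * zmon w (Suc b) a 0 z) =
     (LINT z|\<sigma>. dwb w f z * zmon w b a 0 z) + of_nat a * of_real ((norm w)\<^sup>2) * (LINT z|\<sigma>. f z * zmon w b (a - 1) 0 z)"
proof -
  note [simp] = bipoly_cpoly[OF f]
  note int = integrable_cpoly[OF s]
  define Q where "Q z = f z * zmon w b a 0 z" for z
  have Q: "bipoly (p + b) (q + a) Q"
    unfolding Q_def[abs_def] using bipoly_mult[OF f bipoly_zmon[of b 0 a w]] by simp
  have cQ [simp]: "cpoly Q" by (rule bipoly_cpoly[OF Q])
  have dw [simp]: "cpoly (dwb w f)" by (rule bipoly_cpoly[OF bipoly_dwb[OF f]])
  have wQ: "(\<Sum>j\<in>UNIV. cnj (w $ j) * wb j Q z) = dwb w f z * zmon w b a 0 z + of_nat a * of_real ((norm w)\<^sup>2) * (f z * zmon w b (a - 1) 0 z)" for z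
  proof -
    have "wb j Q z = f z * (of_nat a * w $ j * zmon w b (a - 1) 0 z) + wb j f z * zmon w b a 0 z" for j
      unfolding Q_def[abs_def] by (simp add: wb_mult wb_zmon0)
    then have "(\<Sum>j\<in>UNIV. cnj (w $ j) * wb j Q z) = (\<Sum>j\<in>UNIV. (cnj (w $ j) * wb j f z) * zmon w b a 0 z + (w $ j * cnj (w $ j)) * (of_nat a * (f z * zmon w b (a - 1) 0 z)))"
      by (simp add: algebra_simps)
    then show ?thesis
      unfolding sum.distrib sum_distrib_right[symmetric] norm_sq_sum[symmetric] dwb_def[symmetric] by simp
  qed
  have hp: "f z * zmon w (Suc b) a 0 z = (\<Sum>j\<in>UNIV. cnj (w $ j) * (z $ j * Q z))" for z
    by (simp add: Q_def zmon_def hprod_def sum_distrib_left sum_distrib_right algebra_simps)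
  have "(LINT z|\<sigma>. f z * zmon w (Suc b) a 0 z) = (\<Sum>j\<in>UNIV. cnj (w $ j) * (LINT z|\<sigma>. z $ j * Q z))"
    unfolding hp by (subst Bochner_Integration.integral_sum) (auto intro!: int)
  then have "of_nat (CARD('n) + p + b) * (LINT z|\<sigma>. f z * zmon w (Suc b) a 0 z) =
    (\<Sum>j\<in>UNIV. cnj (w $ j) * (of_nat (CARD('n) + (p + b)) * (LINT z|\<sigma>. z $ j * Q z)))"
    by (simp only: sum_distrib_left mult.left_commute add.assoc)
  also have "\<dots> = (\<Sum>j\<in>UNIV. cnj (w $ j) * (LINT z|\<sigma>. wb j Q z))"
    unfolding integral_by_parts_wb[OF s Q] ..
  also have "\<dots> = (LINT z|\<sigma>. (\<Sum>j\<in>UNIV. cnj (w $ j) * wb j Q z))"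
    by (subst Bochner_Integration.integral_sum) (auto intro!: int)
  also have "\<dots> = (LINT z|\<sigma>. dwb w f z * zmon w b a 0 z) + of_nat a * of_real ((norm w)\<^sup>2) * (LINT z|\<sigma>. f z * zmon w b (a - 1) 0 z)"
    unfolding wQ by (subst Bochner_Integration.integral_add) (auto intro!: int)
  finally show ?thesis .
qed

text \<open>Peeling off factors keeps f harmonic and lowers its bidegree no faster than the
  exponents, so both strict inequalities survive down to a = b = 0.\<close>

lemma zonal_moment_zero:
  fixes f :: "complex^'n \<Rightarrow> complex"
  assumes s: "rotation_invariant_sphere_measure \<sigma>"
  shows "f \<in> harmonic_polys p q \<Longrightarrow> a < p \<Longrightarrow> b < q \<Longrightarrow> (LINT z|\<sigma>. f z * zmon w b a 0 z) = 0"
proof (induction "a + b" arbitrary: a b p q f rule: less_induct)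
  case less
  have f: "bipoly p q f" and h: "clap f z = 0" for z using less.prems by (auto simp: harmonic_polys_iff)
  consider a' where "a = Suc a'" | b' where "a = 0" "b = Suc b'" | "a = 0" "b = 0"
    by (cases a; cases b) auto
  then show ?case
  proof cases
    case 1
    have "(LINT z|\<sigma>. dwd w f z * zmon w b a' 0 z) = 0"
      by (rule less.hyps[OF _ harmonic_dwd]) (use less.prems 1 in auto)
    moreover have "of_nat b * of_real ((norm w)\<^sup>2) * (LINT z|\<sigma>. f z * zmon w (b - 1) a' 0 z) = 0"
      using less.hyps[of a' "b - 1" f p q] less.prems 1 by (cases b) auto
    ultimately have "of_nat (CARD('n) + q + a') * (LINT z|\<sigma>. f z * zmon w b (Suc a') 0 z) = 0"
      using zonal_moment_step_wd[OF s f, of a' w b] by (simp only:) simp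
    then show ?thesis using 1 by (simp del: of_nat_add)
  next
    case 2
    have "(LINT z|\<sigma>. dwb w f z * zmon w b' a 0 z) = 0"
      by (rule less.hyps[OF _ harmonic_dwb]) (use less.prems 2 in auto)
    then have "of_nat (CARD('n) + p + b') * (LINT z|\<sigma>. f z * zmon w (Suc b') a 0 z) = 0"
      using zonal_moment_step_wb[OF s f, of b' w a] 2 by simp
    then show ?thesis using 2 by (simp del: of_nat_add)
  next
    case 3
    note c = bipoly_cpoly[OF f]
    \<comment> \<open>For exponent 0, Euler's identity writes q f through the derivatives of f, and
      integration by parts turns the integral into that of \<open>clap f\<close>, which is 0; q is
      positive because b < q.\<close>
    have "of_nat (CARD('n) + (q - 1)) * (of_nat q * (LINT z|\<sigma>. f z)) = of_nat (CARD('n) + (q - 1)) * (LINT z|\<sigma>. (\<Sum>j\<in>UNIV. cnj (z $ j) * wb j f z))"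
      unfolding euler_wb[OF f] by simp
    also have "\<dots> = (\<Sum>j\<in>UNIV. of_nat (CARD('n) + (q - 1)) * (LINT z|\<sigma>. cnj (z $ j) * wb j f z))"
      by (subst Bochner_Integration.integral_sum) (auto intro!: integrable_cpoly[OF s] simp: c sum_distrib_left)
    also have "\<dots> = (\<Sum>j\<in>UNIV. LINT z|\<sigma>. wd j (wb j f) z)"
      by (intro sum.cong refl integral_by_parts_wd[OF s bipoly_wbI[OF f]])
    also have "\<dots> = (LINT z|\<sigma>. clap f z)"
      unfolding clap_def by (subst Bochner_Integration.integral_sum) (auto intro!: integrable_cpoly[OF s] simp: c)
    also have "\<dots> = 0" by (simp add: h)
    finally show ?thesis using less.prems 3 zero_less_card_finite[where 'a = 'n] by (simp add: zmon_def del: of_nat_add)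
  qed
qed

text \<open>At the top exponents the second term of each step has too low a degree and vanishes.
  What remains differentiates f in direction w until it is constant; evaluated at w each derivative
  is a multiple of f w by Euler's identity, and these multiples are the factorials.\<close>

lemma zonal_moment:
  fixes f :: "complex^'n \<Rightarrow> complex"
  assumes s: "rotation_invariant_sphere_measure \<sigma>"
  shows "f \<in> harmonic_polys p q \<Longrightarrow> (LINT z|\<sigma>. f z * zmon w q p 0 z)
    = of_real (fact p * fact q * fact (CARD('n) - 1) / fact (CARD('n) - 1 + p + q)) * f w"
proof (induction "p + q" arbitrary: p q f)
  case 0
  then have f: "bipoly 0 0 f" by (auto simp: harmonic_polys_iff)
  \<comment> \<open>Homogeneity with scalar 0: in bidegree (0,0) the factor is 0^0 = 1.\<close>
  have "f z = f 0" for z using bipoly_homogeneous[OF f, of 0 z] by simp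
  then have "f z = f w" for z by metis
  then have "(\<lambda>z. f z * zmon w q p 0 z) = (\<lambda>z. f w)" using 0 by (simp add: zmon_def fun_eq_iff)
  moreover have "measure \<sigma> (space \<sigma>) = 1" using s by (simp add: rotation_invariant_sphere_measure_def measure_def)
  ultimately show ?case using 0 by simp
next
  case (Suc N)
  have f: "bipoly p q f" using Suc.prems by (auto simp: harmonic_polys_iff)
  define c where "c p q = (fact p * fact q * fact (CARD('n) - 1) / fact (CARD('n) - 1 + p + q) :: real)" for p q
  consider p' where "p = Suc p'" | q' where "p = 0" "q = Suc q'" using Suc.hyps(2) by (cases p; cases q) auto
  then show ?case
  proof cases
    case 1
    have "(LINT z|\<sigma>. dwd w f z * zmon w q p' 0 z) = of_real (c p' q) * dwd w f w"
      unfolding c_def by (rule Suc.hyps(1)) (use Suc.hyps(2) 1 harmonic_dwd[OF Suc.prems, of w] in auto)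
    also have "dwd w f w = of_nat p * f w" unfolding dwd_def by (rule euler_wd[OF f])
    finally have A: "(LINT z|\<sigma>. dwd w f z * zmon w q p' 0 z) = of_real (c p' q) * (of_nat p * f w)" .
    have B: "of_nat q * of_real ((norm w)\<^sup>2) * (LINT z|\<sigma>. f z * zmon w (q - 1) p' 0 z) = 0"
      using zonal_moment_zero[OF s Suc.prems, of p' "q - 1" w] 1 by (cases q) auto
    have N: "CARD('n) + q + p' = CARD('n) - 1 + p + q" using 1 by (simp add: Suc_leI)
    have e: "of_nat (CARD('n) - 1 + p + q) * (LINT z|\<sigma>. f z * zmon w q p 0 z) = of_real (c p' q) * (of_nat p * f w)"
      using zonal_moment_step_wd[OF s f, of p' w q] unfolding N 1[symmetric] A B by simp
    have "real (CARD('n) - 1 + p + q) * c p q = c p' q * real p"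
    proof -
      have "CARD('n) - 1 + p + q = Suc (CARD('n) - 1 + p' + q)" using 1 by simp
      then show ?thesis unfolding c_def 1 by (simp only: fact_Suc of_nat_mult) (simp add: divide_simps)
    qed
    then have "complex_of_real (real (CARD('n) - 1 + p + q) * c p q) = complex_of_real (c p' q * real p)" by (simp only:)
    then have "of_nat (CARD('n) - 1 + p + q) * of_real (c p q) = complex_of_real (c p' q) * of_nat p" by (simp only: of_real_mult of_real_of_nat_eq)
    with e have "of_nat (CARD('n) - 1 + p + q) * (LINT z|\<sigma>. f z * zmon w q p 0 z) = of_nat (CARD('n) - 1 + p + q) * (of_real (c p q) * f w)"
      by (simp only: mult.assoc[symmetric])
    moreover have "(of_nat (CARD('n) - 1 + p + q) :: complex) \<noteq> 0"
      using 1 by (simp only: of_nat_eq_0_iff)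
    ultimately show ?thesis unfolding c_def using mult_left_cancel by blast
  next
    case 2
    have "(LINT z|\<sigma>. dwb w f z * zmon w q' p 0 z) = of_real (c p q') * dwb w f w"
      unfolding c_def by (rule Suc.hyps(1)) (use Suc.hyps(2) 2 harmonic_dwb[OF Suc.prems, of w] in auto)
    also have "dwb w f w = of_nat q * f w" unfolding dwb_def by (rule euler_wb[OF f])
    finally have A: "(LINT z|\<sigma>. dwb w f z * zmon w q' p 0 z) = of_real (c p q') * (of_nat q * f w)" .
    have N: "CARD('n) + p + q' = CARD('n) - 1 + p + q" using 2 by (simp add: Suc_leI)
    have e: "of_nat (CARD('n) - 1 + p + q) * (LINT z|\<sigma>. f z * zmon w q p 0 z) = of_real (c p q') * (of_nat q * f w)"
      using zonal_moment_step_wb[OF s f, of q' w p] unfolding N 2(2)[symmetric] A using 2(1) by simp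
    have "real (CARD('n) - 1 + p + q) * c p q = c p q' * real q"
    proof -
      have "CARD('n) - 1 + p + q = Suc (CARD('n) - 1 + p + q')" using 2 by simp
      then show ?thesis unfolding c_def 2(2) by (simp only: fact_Suc of_nat_mult) (simp add: divide_simps)
    qed
    then have "complex_of_real (real (CARD('n) - 1 + p + q) * c p q) = complex_of_real (c p q' * real q)" by (simp only:)
    then have "of_nat (CARD('n) - 1 + p + q) * of_real (c p q) = complex_of_real (c p q') * of_nat q" by (simp only: of_real_mult of_real_of_nat_eq)
    with e have "of_nat (CARD('n) - 1 + p + q) * (LINT z|\<sigma>. f z * zmon w q p 0 z) = of_nat (CARD('n) - 1 + p + q) * (of_real (c p q) * f w)"
      by (simp only: mult.assoc[symmetric])
    moreover have "(of_nat (CARD('n) - 1 + p + q) :: complex) \<noteq> 0"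
      using 2 by (simp only: of_nat_eq_0_iff)
    ultimately show ?thesis unfolding c_def using mult_left_cancel by blast
  qed
qed

section \<open>The reproducing kernel and the addition formula\<close>

definition zonal_fun :: "nat \<Rightarrow> nat \<Rightarrow> complex^'n \<Rightarrow> complex^'n \<Rightarrow> complex" where
  "zonal_fun p q w z = zonal CARD('n) p q (hprod z w) ((norm z)\<^sup>2 * (norm w)\<^sup>2)"

lemma zonal_fun_harmonic: "zonal_fun p q w \<in> harmonic_polys p q"
  using zonal_harmonic[of p q w] by (simp add: zonal_fun_def[abs_def])

text \<open>On the sphere the term k of the kernel is a multiple of a moment with exponents p - k
  and q - k, so only k = 0 contributes. Its moment constant is the reciprocal of the leading
  \<open>zcoef\<close>; this is what fixes the common factor there.\<close>

lemma zonal_reproducing: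
  fixes f :: "complex^'n \<Rightarrow> complex"
  assumes s: "rotation_invariant_sphere_measure \<sigma>" and f: "f \<in> harmonic_polys p q"
  shows "(LINT z|\<sigma>. f z * cnj (zonal_fun p q w z)) = f w"
proof -
  have c: "cpoly f" using f bipoly_cpoly by (auto simp: harmonic_polys_iff)
  define d where "d k = zcoef CARD('n) (p - k) (q - k) k * ((norm w)\<^sup>2) ^ k" for k
  have "(LINT z|\<sigma>. f z * cnj (zonal_fun p q w z)) = (LINT z|\<sigma>. (\<Sum>k\<le>min p q. of_real (d k) * (f z * zmon w (q - k) (p - k) 0 z)))"
    by (rule sphere_integral_cong[OF s]) (simp add: zonal_fun_def zonal_def zmon_def d_def sum_distrib_left mult_ac)
  also have "\<dots> = (\<Sum>k\<le>min p q. of_real (d k) * (LINT z|\<sigma>. f z * zmon w (q - k) (p - k) 0 z))"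
    by (subst Bochner_Integration.integral_sum) (auto intro!: integrable_cpoly[OF s] simp: c)
  also have "\<dots> = (\<Sum>k\<in>{0}. of_real (d k) * (LINT z|\<sigma>. f z * zmon w (q - k) (p - k) 0 z))"
    by (rule sum.mono_neutral_right) (auto intro!: zonal_moment_zero[OF s f])
  also have "\<dots> = of_real (d 0 * (fact p * fact q * fact (CARD('n) - 1) / fact (CARD('n) - 1 + p + q))) * f w"
    by (simp add: zonal_moment[OF s f])
  also have "d 0 * (fact p * fact q * fact (CARD('n) - 1) / fact (CARD('n) - 1 + p + q)) = 1"
  proof -
    have "p + q + CARD('n) - 1 = CARD('n) - 1 + p + q" by (simp add: Suc_leI)
    then show ?thesis by (simp add: d_def zcoef_def wpt_def)
  qed
  finally show ?thesis by simp
qed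

lemma norm_vector_smult: "norm (c *s z) = norm c * norm (z :: complex^'n)"
  by (simp add: norm_vec_def L2_set_def norm_mult power_mult_distrib real_sqrt_mult flip: sum_distrib_left)

text \<open>The zonal function lies in the span of the basis, and its coefficients are read off from
  the reproducing property. Membership in the span only speaks about the unit sphere; homogeneity
  extends the identity to all z.\<close>

lemma addition_formula:
  fixes h :: "nat \<Rightarrow> nat \<Rightarrow> nat \<Rightarrow> complex^'n \<Rightarrow> complex"
  assumes s: "rotation_invariant_sphere_measure \<sigma>" and h: "orthonormal_harmonics \<sigma> h"
  shows "(\<Sum>j = 1..dim_H TYPE('n) p q. h p q j z * cnj (h p q j w)) = zonal_fun p q w z"
proof -
  define J where "J = {1..dim_H TYPE('n) p q}"
  have hh: "h p q j \<in> harmonic_polys p q" if "j \<in> J" for j using h that by (auto simp: orthonormal_harmonics_def J_def)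
  have on: "(LINT z|\<sigma>. h p q i z * cnj (h p q j z)) = (if i = j then 1 else 0)" if "i \<in> J" "j \<in> J" for i j
    using h that unfolding orthonormal_harmonics_def J_def by blast
  have sp: "module.span scale_fun ((\<lambda>j. sphere_restr (h p q j)) ` J) = Hpq p q"
    using h unfolding orthonormal_harmonics_def J_def by blast
  interpret V: vector_space scale_fun by (rule vector_space_scale_fun)
  have ch: "cpoly (h p q j)" if "j \<in> J" for j using hh[OF that] bipoly_cpoly by (auto simp: harmonic_polys_iff)
  have icnj: "integrable \<sigma> (\<lambda>z. f z * cnj (g z))" if "cpoly f" "cpoly g" for f g
    by (rule integrable_sphere_measure[OF s]) (intro continuous_intros cpoly_continuous that)
  have "sphere_restr (zonal_fun p q w) \<in> V.span ((\<lambda>j. sphere_restr (h p q j)) ` J)"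
    unfolding sp Hpq_def using zonal_fun_harmonic by blast
  then have "\<exists>c. \<forall>z. sphere_restr (zonal_fun p q w) z = (\<Sum>j\<in>J. c j * sphere_restr (h p q j) z)"
  proof (induction rule: V.span_induct_alt)
    case base
    show ?case by (rule exI[of _ "\<lambda>_. 0"]) simp
  next
    case (step a x y)
    then obtain c l where c: "\<forall>z. y z = (\<Sum>j\<in>J. c j * sphere_restr (h p q j) z)" and l: "l \<in> J" "x = sphere_restr (h p q l)" by blast
    have "finite J" by (simp add: J_def)
    have "(scale_fun a x + y) z = (\<Sum>j\<in>J. (c j + (if j = l then a else 0)) * sphere_restr (h p q j) z)" for z
      using c l \<open>finite J\<close> by (simp add: scale_fun_def distrib_right sum.distrib if_distrib[where f = "\<lambda>x. x * _"] cong: if_cong)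
    then show ?case by (intro exI allI)
  qed
  then obtain c where c: "\<forall>z. sphere_restr (zonal_fun p q w) z = (\<Sum>j\<in>J. c j * sphere_restr (h p q j) z)" by blast
  have c1: "zonal_fun p q w z = (\<Sum>j\<in>J. c j * h p q j z)" if "norm z = 1" for z
    using spec[OF c, of z] that by (simp add: sphere_restr_def)
  have cl: "c l = cnj (h p q l w)" if l: "l \<in> J" for l
  proof -
    have "cnj (h p q l w) = (LINT z|\<sigma>. cnj (h p q l z * cnj (zonal_fun p q w z)))"
      unfolding zonal_reproducing[OF s hh[OF l], of w, symmetric] by (rule Bochner_Integration.integral_cnj[symmetric])
    also have "\<dots> = (LINT z|\<sigma>. (\<Sum>j\<in>J. c j * (h p q j z * cnj (h p q l z))))"
      by (rule sphere_integral_cong[OF s]) (simp add: c1 sum_distrib_left mult_ac)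
    also have "\<dots> = (\<Sum>j\<in>J. c j * (LINT z|\<sigma>. h p q j z * cnj (h p q l z)))"
      by (subst Bochner_Integration.integral_sum) (auto intro!: icnj ch l)
    also have "\<dots> = (\<Sum>j\<in>J. c j * (if j = l then 1 else 0))"
      by (rule sum.cong) (auto simp: on l)
    also have "\<dots> = c l" using l by (simp add: J_def if_distrib[where f = "\<lambda>x. _ * x"] cong: if_cong)
    finally show ?thesis ..
  qed
  \<comment> \<open>For z = 0 any unit vector will do.\<close>
  obtain x :: "complex^'n" where x: "norm x = 1" "z = of_real (norm z) *s x"
  proof (cases "z = 0")
    case True
    have "norm (axis undefined 1 :: complex^'n) = 1" by (simp add: norm_axis_1)
    then show ?thesis using that[of "axis undefined 1"] True by simp
  next
    case False
    show ?thesis by (rule that[of "of_real (inverse (norm z)) *s z"])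
      (use False in \<open>simp_all add: vector_smult_assoc norm_vector_smult norm_inverse\<close>)
  qed
  have "zonal_fun p q w z = of_real (norm z) ^ p * of_real (norm z) ^ q * zonal_fun p q w x"
    using bipoly_homogeneous[of p q "zonal_fun p q w" "of_real (norm z)" x] zonal_fun_harmonic[of p q w] x(2)
    by (simp add: harmonic_polys_iff)
  also have "zonal_fun p q w x = (\<Sum>j\<in>J. h p q j x * cnj (h p q j w))"
    unfolding c1[OF x(1)] by (rule sum.cong) (simp_all add: cl)
  also have "of_real (norm z) ^ p * of_real (norm z) ^ q * (\<Sum>j\<in>J. h p q j x * cnj (h p q j w)) = (\<Sum>j\<in>J. h p q j z * cnj (h p q j w))"
    unfolding sum_distrib_left
  proof (rule sum.cong[OF refl])
    fix j assume "j \<in> J"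
    then have "h p q j z = of_real (norm z) ^ p * of_real (norm z) ^ q * h p q j x"
      using bipoly_homogeneous[of p q "h p q j" "of_real (norm z)" x] hh x(2) by (simp add: harmonic_polys_iff)
    then show "of_real (norm z) ^ p * of_real (norm z) ^ q * (h p q j x * cnj (h p q j w)) = h p q j z * cnj (h p q j w)" by simp
  qed
  finally show ?thesis by (simp add: J_def)
qed

text \<open>Polar coordinates produce an invariant measure of their own, not visibly the given one.
  Both measures have the same reproducing kernel, so the Gram matrix M for the new one satisfies h_i
  = sum of M_l h_l; pairing this with h_j under the old measure identifies M_j.\<close>

lemma orthonormal_harmonics_transfer:
  fixes h :: "nat \<Rightarrow> nat \<Rightarrow> nat \<Rightarrow> complex^'n \<Rightarrow> complex"
  assumes s: "rotation_invariant_sphere_measure \<sigma>" and h: "orthonormal_harmonics \<sigma> h"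
    and s': "rotation_invariant_sphere_measure \<sigma>'"
    and i: "i \<in> {1..dim_H TYPE('n) p q}" and j: "j \<in> {1..dim_H TYPE('n) p q}"
  shows "(LINT z|\<sigma>'. h p q i z * cnj (h p q j z)) = (if i = j then 1 else 0)"
proof -
  define J where "J = {1..dim_H TYPE('n) p q}"
  have hh: "h p q j \<in> harmonic_polys p q" if "j \<in> J" for j using h that by (auto simp: orthonormal_harmonics_def J_def)
  have on: "(LINT z|\<sigma>. h p q i z * cnj (h p q j z)) = (if i = j then 1 else 0)" if "i \<in> J" "j \<in> J" for i j
    using h that unfolding orthonormal_harmonics_def J_def by blast
  have ch: "cpoly (h p q j)" if "j \<in> J" for j using hh[OF that] bipoly_cpoly by (auto simp: harmonic_polys_iff)
  note iJ = i[folded J_def] and jJ = j[folded J_def]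
  have icnj: "integrable s (\<lambda>z. f z * cnj (g z))" if "rotation_invariant_sphere_measure s" "cpoly f" "cpoly g" for f g :: "complex^'n \<Rightarrow> complex" and s
    by (rule integrable_sphere_measure[OF that(1)]) (intro continuous_intros cpoly_continuous that)
  define M where "M l = (LINT z|\<sigma>'. h p q i z * cnj (h p q l z))" for l
  have exp: "h p q i w = (\<Sum>l\<in>J. h p q l w * M l)" for w
  proof -
    have "h p q i w = (LINT z|\<sigma>'. h p q i z * cnj (zonal_fun p q w z))"
      by (rule zonal_reproducing[OF s' hh[OF iJ], symmetric])
    also have "\<dots> = (LINT z|\<sigma>'. (\<Sum>l\<in>J. h p q l w * (h p q i z * cnj (h p q l z))))"
      by (simp add: addition_formula[OF s h, symmetric] J_def sum_distrib_left mult_ac)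
    also have "\<dots> = (\<Sum>l\<in>J. h p q l w * M l)"
      unfolding M_def by (subst Bochner_Integration.integral_sum) (auto intro!: icnj[OF s'] ch iJ)
    finally show ?thesis .
  qed
  have "(if i = j then 1 else 0) = (LINT w|\<sigma>. h p q i w * cnj (h p q j w))" by (rule on[OF iJ jJ, symmetric])
  also have "\<dots> = (LINT w|\<sigma>. (\<Sum>l\<in>J. M l * (h p q l w * cnj (h p q j w))))"
    by (subst exp) (simp add: sum_distrib_left sum_distrib_right mult_ac)
  also have "\<dots> = (\<Sum>l\<in>J. M l * (LINT w|\<sigma>. h p q l w * cnj (h p q j w)))"
    by (subst Bochner_Integration.integral_sum) (auto intro!: icnj[OF s] ch jJ)
  also have "\<dots> = (\<Sum>l\<in>J. M l * (if l = j then 1 else 0))"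
    by (rule sum.cong) (auto simp: on jJ)
  also have "\<dots> = M j" using jJ by (simp add: J_def if_distrib[where f = "\<lambda>x. _ * x"] cong: if_cong)
  finally show ?thesis by (simp add: M_def)
qed

subsection \<open>Orthonormal series and weak integrals\<close>

context complex_hilbert
begin

sublocale V: vector_space sC by (rule vector_space_sC)

lemma ip_add_right: "ip x (y + z) = ip x y + ip x z"
  by (metis ip_commute ip_add_left complex_cnj_add)

lemma ip_sC_right: "ip x (sC c y) = cnj c * ip x y"
  by (metis ip_commute ip_sC_left complex_cnj_mult complex_cnj_cnj)

lemma ip_scaleR_left: "ip (r *\<^sub>R x) y = of_real r * ip x y"
  by (metis sC_of_real ip_sC_left)

lemma ip_scaleR_right: "ip x (r *\<^sub>R y) = of_real r * ip x y"
  by (metis sC_of_real ip_sC_right complex_cnj_complex_of_real)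

lemma ip_zero [simp]: "ip 0 y = 0" "ip x 0 = 0"
  using ip_scaleR_left[of 0 0 y] ip_scaleR_right[of x 0 0] by simp_all

lemma ip_diff_left: "ip (x - y) z = ip x z - ip y z"
  using ip_add_left[of "x - y" y z] by simp

lemma ip_diff_right: "ip x (y - z) = ip x y - ip x z"
  using ip_add_right[of x "y - z" z] by simp

lemma ip_sum_left: "ip (sum f S) y = (\<Sum>i\<in>S. ip (f i) y)"
  by (induction S rule: infinite_finite_induct) (auto simp: ip_add_left)

lemma ip_sum_right: "ip x (sum f S) = (\<Sum>i\<in>S. ip x (f i))"
  by (induction S rule: infinite_finite_induct) (auto simp: ip_add_right)

lemma cauchy_schwarz: "cmod (ip x y) \<le> norm x * norm y"
proof (cases "y = 0")
  case False
  define c where "c = ip x y / of_real ((norm y)\<^sup>2)"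
  have ny: "(norm y)\<^sup>2 > 0" using False by simp
  have yx: "ip y x = cnj (ip x y)" by (rule ip_commute)
  have "of_real ((norm (x - sC c y))\<^sup>2) = ip x x - cnj c * ip x y - c * cnj (ip x y) + c * cnj c * ip y y"
    unfolding ip_self[symmetric] by (simp add: ip_diff_left ip_diff_right ip_sC_left ip_sC_right yx algebra_simps)
  also have "\<dots> = of_real ((norm x)\<^sup>2 - (cmod (ip x y))\<^sup>2 / (norm y)\<^sup>2)"
  proof -
    have s: "of_real ((cmod (ip x y))\<^sup>2) = ip x y * cnj (ip x y)" by (rule complex_norm_square)
    have 1: "cnj c * ip x y = of_real ((cmod (ip x y))\<^sup>2 / (norm y)\<^sup>2)" "c * cnj (ip x y) = of_real ((cmod (ip x y))\<^sup>2 / (norm y)\<^sup>2)"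
      unfolding of_real_divide s by (simp_all add: c_def)
    have "cnj c * ip y y = cnj (ip x y)" using ny by (simp add: c_def ip_self)
    then have 2: "c * cnj c * ip y y = c * cnj (ip x y)" by (simp add: mult.assoc)
    show ?thesis unfolding 2 unfolding 1 by (simp add: ip_self)
  qed
  finally have "(norm (x - sC c y))\<^sup>2 = (norm x)\<^sup>2 - (cmod (ip x y))\<^sup>2 / (norm y)\<^sup>2"
    using of_real_eq_iff by blast
  then have "(cmod (ip x y))\<^sup>2 / (norm y)\<^sup>2 \<le> (norm x)\<^sup>2"
    using zero_le_power2[of "norm (x - sC c y)"] by simp
  then have "(cmod (ip x y))\<^sup>2 \<le> (norm x * norm y)\<^sup>2"
    using ny by (simp add: divide_simps power_mult_distrib)
  then show ?thesis by (rule power2_le_imp_le) simp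
qed simp

lemma bounded_linear_ip_left: "bounded_linear (\<lambda>x. ip x y)"
  by (rule bounded_linear_intro[of _ "norm y"])
     (auto simp: ip_add_left ip_scaleR_left cauchy_schwarz scaleR_conv_of_real)

lemma bounded_linear_ip_right: "bounded_linear (\<lambda>y. ip x y)"
  by (rule bounded_linear_intro[of _ "norm x"])
     (auto simp: ip_add_right ip_scaleR_right scaleR_conv_of_real mult.commute[of "norm _" "norm x"] cauchy_schwarz)

lemma ip_eqI:
  assumes "\<And>v. ip x v = ip y v" shows "x = y"
proof -
  have "ip (x - y) (x - y) = 0" using assms by (simp add: ip_diff_left)
  then show ?thesis by (simp add: ip_self)
qed

lemma norm_lincomb:
  assumes on: "\<And>i k. i \<in> F \<Longrightarrow> k \<in> F \<Longrightarrow> ip (e i) (e k) = (if i = k then 1 else 0)" and F: "finite F"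
  shows "(norm (\<Sum>i\<in>F. sC (c i) (e i)))\<^sup>2 = (\<Sum>i\<in>F. (cmod (c i))\<^sup>2)"
proof -
  have "of_real ((norm (\<Sum>i\<in>F. sC (c i) (e i)))\<^sup>2) = (\<Sum>i\<in>F. \<Sum>k\<in>F. c i * cnj (c k) * ip (e i) (e k))"
    unfolding ip_self[symmetric] ip_sum_left ip_sum_right ip_sC_left ip_sC_right
    by (subst sum.swap) (simp add: sum_distrib_left mult_ac)
  also have "\<dots> = (\<Sum>i\<in>F. \<Sum>k\<in>F. if k = i then c i * cnj (c i) else 0)"
    by (intro sum.cong refl) (auto simp: on)
  also have "\<dots> = of_real (\<Sum>i\<in>F. (cmod (c i))\<^sup>2)"
    unfolding of_real_sum complex_norm_square using F by simp
  finally show ?thesis using of_real_eq_iff by blast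
qed

lemma bessel:
  assumes on: "\<And>i k. i \<in> F \<Longrightarrow> k \<in> F \<Longrightarrow> ip (e i) (e k) = (if i = k then 1 else 0)" and F: "finite F"
  shows "(\<Sum>i\<in>F. (cmod (ip u (e i)))\<^sup>2) \<le> (norm u)\<^sup>2"
proof -
  define s where "s = (\<Sum>i\<in>F. sC (ip u (e i)) (e i))"
  define t where "t = (\<Sum>i\<in>F. (cmod (ip u (e i)))\<^sup>2)"
  have us: "ip u s = of_real t"
    unfolding s_def t_def ip_sum_right ip_sC_right of_real_sum complex_norm_square by (simp add: mult.commute)
  have su: "ip s u = of_real t" by (subst ip_commute) (simp add: us)
  have ss: "ip s s = of_real t"
    unfolding ip_self s_def t_def using norm_lincomb[OF on F] by simp
  have "of_real ((norm (u - s))\<^sup>2) = complex_of_real ((norm u)\<^sup>2 - t)"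
    unfolding ip_self[symmetric] ip_diff_left ip_diff_right us su ss by (simp add: ip_self)
  then have "(norm (u - s))\<^sup>2 = (norm u)\<^sup>2 - t" using of_real_eq_iff by blast
  then show ?thesis unfolding t_def using zero_le_power2[of "norm (u - s)"] by linarith
qed

text \<open>Coherent states are series over p of finite sums over q and j. The blocks
  \<open>B p\<close> mirror this, and orthonormality reduces the Cauchy criterion to the one for
  squared coefficients.\<close>

lemma summable_blocks:
  assumes on: "\<And>i k. i \<in> I \<Longrightarrow> k \<in> I \<Longrightarrow> ip (e i) (e k) = (if i = k then 1 else 0)"
    and B: "\<And>p. finite (B p)" "\<And>p. B p \<subseteq> I" "\<And>p p'. p \<noteq> p' \<Longrightarrow> B p \<inter> B p' = {}"
    and sm: "summable (\<lambda>p :: nat. \<Sum>i\<in>B p. (cmod (c i))\<^sup>2)"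
  shows "summable (\<lambda>p. \<Sum>i\<in>B p. sC (c i) (e i))"
  unfolding summable_Cauchy
proof (intro allI impI)
  fix \<epsilon> :: real assume \<epsilon>: "\<epsilon> > 0"
  then have "\<epsilon>\<^sup>2 > 0" by simp
  then obtain N where N: "\<And>m n. m \<ge> N \<Longrightarrow> norm (\<Sum>p\<in>{m..<n}. \<Sum>i\<in>B p. (cmod (c i))\<^sup>2) < \<epsilon>\<^sup>2"
    using sm[unfolded summable_Cauchy, rule_format, of "\<epsilon>\<^sup>2"] by blast
  have "norm (\<Sum>p\<in>{m..<n}. \<Sum>i\<in>B p. sC (c i) (e i)) < \<epsilon>" if "m \<ge> N" for m n
  proof -
    define F where "F = (\<Union>p\<in>{m..<n}. B p)"
    have U': "(\<Sum>p\<in>{m..<n}. \<Sum>i\<in>B p. g i) = sum g F" for g :: "_ \<Rightarrow> real"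
      unfolding F_def by (rule sum.UNION_disjoint[symmetric]) (simp_all add: B(1,3))
    have Uv: "(\<Sum>p\<in>{m..<n}. \<Sum>i\<in>B p. sC (c i) (e i)) = (\<Sum>i\<in>F. sC (c i) (e i))"
      unfolding F_def by (rule sum.UNION_disjoint[symmetric]) (simp_all add: B(1,3))
    have "F \<subseteq> I" "finite F" unfolding F_def using B(1,2) by blast+
    then have "(norm (\<Sum>i\<in>F. sC (c i) (e i)))\<^sup>2 = (\<Sum>i\<in>F. (cmod (c i))\<^sup>2)"
      by (intro norm_lincomb on) blast+
    also have "\<dots> < \<epsilon>\<^sup>2" using N[OF that, of n] unfolding U' real_norm_def by linarith
    finally show ?thesis unfolding Uv by (rule power2_less_imp_less) (use \<epsilon> in simp)
  qed
  then show "\<exists>N. \<forall>m\<ge>N. \<forall>n. norm (\<Sum>p\<in>{m..<n}. \<Sum>i\<in>B p. sC (c i) (e i)) < \<epsilon>" by blast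
qed

lemma ip_blocks_basis:
  assumes on: "\<And>i k. i \<in> I \<Longrightarrow> k \<in> I \<Longrightarrow> ip (e i) (e k) = (if i = k then 1 else 0)"
    and B: "\<And>p. finite (B p)" "\<And>p. B p \<subseteq> I" "\<And>p p'. p \<noteq> p' \<Longrightarrow> B p \<inter> B p' = {}"
    and sm: "summable (\<lambda>p :: nat. \<Sum>i\<in>B p. (cmod (c i))\<^sup>2)"
    and k: "k \<in> B p0"
  shows "ip (\<Sum>p. \<Sum>i\<in>B p. sC (c i) (e i)) (e k) = c k"
proof -
  have S: "(\<lambda>p. ip (\<Sum>i\<in>B p. sC (c i) (e i)) (e k)) sums ip (\<Sum>p. \<Sum>i\<in>B p. sC (c i) (e i)) (e k)"
    by (intro bounded_linear.sums[OF bounded_linear_ip_left] summable_sums summable_blocks[OF on B sm]) auto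
  have *: "ip (\<Sum>i\<in>B p. sC (c i) (e i)) (e k) = (if p = p0 then c k else 0)" for p
  proof -
    have "ip (\<Sum>i\<in>B p. sC (c i) (e i)) (e k) = (\<Sum>i\<in>B p. if i = k then c k else 0)"
      unfolding ip_sum_left ip_sC_left using B(2) k by (intro sum.cong refl) (auto simp: on subset_iff)
    also have "\<dots> = (if k \<in> B p then c k else 0)" using B(1) by simp
    also have "k \<in> B p \<longleftrightarrow> p = p0" using B(3)[of p p0] k by auto
    finally show ?thesis .
  qed
  show ?thesis
    by (rule sums_unique2[OF S[unfolded *] sums_single])
qed

text \<open>Riesz representation through the basis: the vector has the coefficients l(e i). The
  functional is conjugate linear because it is to equal v \<mapsto> \<langle>a,v\<rangle>; the two
  agree on the basis and hence on the closure of its span.\<close>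

lemma riesz:
  assumes e: "orthonormal_basis sC ip I e"
    and B: "\<And>p :: nat. finite (B p)" "\<And>p. B p \<subseteq> I" "\<And>p p'. p \<noteq> p' \<Longrightarrow> B p \<inter> B p' = {}" "I \<subseteq> (\<Union>p. B p)"
    and add: "\<And>x y. l (x + y) = l x + l y" and sc: "\<And>a x. l (sC a x) = cnj a * l x"
    and bd: "\<And>x. cmod (l x) \<le> C * norm x"
  shows "\<exists>a. \<forall>v. ip a v = l v"
proof -
  have on: "ip (e i) (e k) = (if i = k then 1 else 0)" if "i \<in> I" "k \<in> I" for i k
    using e that by (auto simp: orthonormal_basis_def)
  define c where "c i = l (e i)" for i
  have bl: "bounded_linear l"
    by (rule bounded_linear_intro[of _ C])
       (auto simp: add mult.commute bd scaleR_conv_of_real sc simp flip: sC_of_real intro: order_trans[OF bd])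
  have lsum: "l (sum f S) = (\<Sum>i\<in>S. l (f i))" for f and S :: "'b set"
    using linear_sum[OF bounded_linear.linear[OF bl]] .
  \<comment> \<open>Testing l on the partial sum with its own coefficients gives t \<le> C sqrt t
    for the sum t of squares, which bounds t independently of F.\<close>
  have fin: "(\<Sum>i\<in>F. (cmod (c i))\<^sup>2) \<le> C\<^sup>2" if F: "finite F" "F \<subseteq> I" for F
  proof -
    define x where "x = (\<Sum>i\<in>F. sC (c i) (e i))"
    define t where "t = (\<Sum>i\<in>F. (cmod (c i))\<^sup>2)"
    have t0: "t \<ge> 0" by (simp add: t_def sum_nonneg)
    have "l x = of_real t" unfolding x_def lsum sc t_def c_def[symmetric] of_real_sum complex_norm_square by (simp add: mult.commute)
    then have "t \<le> C * norm x" using bd[of x] t0 by simp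
    moreover have "(norm x)\<^sup>2 = t" unfolding x_def t_def using F by (intro norm_lincomb on) auto
    then have "norm x = sqrt t" using real_sqrt_unique by force
    ultimately have 1: "sqrt t * sqrt t \<le> C * sqrt t" using t0 by simp
    have "sqrt t \<le> \<bar>C\<bar>"
    proof (cases "t = 0")
      case False
      then have "sqrt t > 0" using t0 by simp
      with 1 have "sqrt t \<le> C" by (rule mult_right_le_imp_le)
      then show ?thesis by simp
    qed simp
    then have "(sqrt t)\<^sup>2 \<le> \<bar>C\<bar>\<^sup>2" using t0 by (intro power_mono) auto
    then show ?thesis using t0 by (simp add: t_def)
  qed
  have sm: "summable (\<lambda>p. \<Sum>i\<in>B p. (cmod (c i))\<^sup>2)"
  proof (rule summableI_nonneg_bounded)
    show "(\<Sum>p<N. \<Sum>i\<in>B p. (cmod (c i))\<^sup>2) \<le> C\<^sup>2" for N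
    proof -
      have "(\<Sum>p<N. \<Sum>i\<in>B p. (cmod (c i))\<^sup>2) = (\<Sum>i\<in>(\<Union>p\<in>{..<N}. B p). (cmod (c i))\<^sup>2)"
        by (rule sum.UNION_disjoint[symmetric]) (simp_all add: B(1,3))
      also have "\<dots> \<le> C\<^sup>2" using B by (intro fin) auto
      finally show ?thesis .
    qed
  qed (auto intro: sum_nonneg)
  define a where "a = (\<Sum>p. \<Sum>i\<in>B p. sC (c i) (e i))"
  have ae: "ip a (e k) = l (e k)" if k: "k \<in> I" for k
  proof -
    obtain p0 where "k \<in> B p0" using k B(4) by blast
    then show ?thesis
      unfolding a_def c_def[symmetric] using ip_blocks_basis[OF on B(1,2,3) sm] by blast
  qed
  define Z where "Z = {v. ip a v - l v = 0}"
  have "closed Z" unfolding Z_def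
    by (intro closed_Collect_eq continuous_intros linear_continuous_on bl bounded_linear_ip_right)
  moreover have "V.span (e ` I) \<subseteq> Z"
  proof (rule V.span_minimal)
    show "e ` I \<subseteq> Z" using ae by (auto simp: Z_def)
    show "V.subspace Z"
    proof (rule V.subspaceI)
      have "l 0 = 0" using bl linear_0 bounded_linear.linear by blast
      then show "0 \<in> Z" by (simp add: Z_def)
    qed (auto simp: Z_def add sc ip_add_right ip_sC_right)
  qed
  ultimately have "closure (V.span (e ` I)) \<subseteq> Z" by (rule closure_minimal[rotated])
  then have "Z = UNIV" using e by (auto simp: orthonormal_basis_def)
  then show ?thesis by (auto simp: Z_def)
qed

text \<open>Resolves the definite description. Since the vectors c w have norm at most 1, |g
  \<langle>u,c\<rangle> \<langle>c,v\<rangle>| is at most |v| |g \<langle>u,c\<rangle>|, so for each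
  u the integral is a bounded conjugate linear functional of v and \<open>riesz\<close> yields the
  operator; \<open>ip_eqI\<close> makes it unique.\<close>

lemma weak_integral_ip:
  assumes e: "orthonormal_basis sC ip I e"
    and B: "\<And>p :: nat. finite (B p)" "\<And>p. B p \<subseteq> I" "\<And>p p'. p \<noteq> p' \<Longrightarrow> B p \<inter> B p' = {}" "I \<subseteq> (\<Union>p. B p)"
    and g: "g \<in> borel_measurable M" and c: "\<And>u. (\<lambda>w. ip u (c w)) \<in> borel_measurable M"
    and nc: "\<And>w. w \<in> space M \<Longrightarrow> norm (c w) \<le> 1"
    and int: "\<And>u. integrable M (\<lambda>w. g w * ip u (c w))"
  shows "ip (weak_integral ip M (\<lambda>w u. sC (g w) (rank_one sC ip (c w) u)) u) v = (LINT w|M. g w * ip u (c w) * ip (c w) v)"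
proof -
  define T where "T w u = sC (g w) (rank_one sC ip (c w) u)" for w u
  have T: "ip (T w u) v = g w * ip u (c w) * ip (c w) v" for w u v
    by (simp add: T_def rank_one_def ip_sC_left)
  have c': "(\<lambda>w. ip (c w) v) \<in> borel_measurable M" for v
    using measurable_compose[OF c[of v] borel_measurable_continuous_onI[OF continuous_on_cnj[OF continuous_on_id]]]
    by (simp add: ip_commute[of "c _" v])
  have bound: "norm (g w * ip u (c w) * ip (c w) v) \<le> norm (norm v *\<^sub>R (g w * ip u (c w)))" if "w \<in> space M" for w u v
  proof -
    have "cmod (ip (c w) v) \<le> norm (c w) * norm v" by (rule cauchy_schwarz)
    also have "\<dots> \<le> 1 * norm v" using nc[OF that] by (intro mult_right_mono) auto
    finally have "cmod (g w * ip u (c w)) * cmod (ip (c w) v) \<le> cmod (g w * ip u (c w)) * norm v"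
      by (intro mult_left_mono) auto
    then show ?thesis by (simp add: norm_mult mult_ac)
  qed
  have iT: "integrable M (\<lambda>w. g w * ip u (c w) * ip (c w) v)" for u v
  proof (rule Bochner_Integration.integrable_bound)
    show "integrable M (\<lambda>w. norm v *\<^sub>R (g w * ip u (c w)))" by (intro integrable_scaleR_right int)
    show "(\<lambda>w. g w * ip u (c w) * ip (c w) v) \<in> borel_measurable M"
      by (intro borel_measurable_times g c c')
    show "AE w in M. norm (g w * ip u (c w) * ip (c w) v) \<le> norm (norm v *\<^sub>R (g w * ip u (c w)))"
      using bound by (intro AE_I2) auto
  qed
  have "\<exists>a. \<forall>v. ip a v = (LINT w|M. g w * ip u (c w) * ip (c w) v)" for u
  proof (rule riesz[OF e B])
    fix x y a
    show "(LINT w|M. g w * ip u (c w) * ip (c w) (x + y)) = (LINT w|M. g w * ip u (c w) * ip (c w) x) + (LINT w|M. g w * ip u (c w) * ip (c w) y)"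
      unfolding ip_add_right distrib_left by (intro Bochner_Integration.integral_add iT)
    have "(LINT w|M. g w * ip u (c w) * ip (c w) (sC a x)) = (LINT w|M. cnj a * (g w * ip u (c w) * ip (c w) x))"
      unfolding ip_sC_right by (simp add: mult_ac)
    then show "(LINT w|M. g w * ip u (c w) * ip (c w) (sC a x)) = cnj a * (LINT w|M. g w * ip u (c w) * ip (c w) x)"
      by simp
    have "cmod (LINT w|M. g w * ip u (c w) * ip (c w) x) \<le> (LINT w|M. norm (g w * ip u (c w) * ip (c w) x))"
      by (rule integral_norm_bound)
    also have "\<dots> \<le> (LINT w|M. norm (norm x *\<^sub>R (g w * ip u (c w))))"
      by (intro integral_mono integrable_norm iT integrable_scaleR_right int bound)
    also have "\<dots> = (LINT w|M. norm (g w * ip u (c w))) * norm x" by simp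
    finally show "cmod (LINT w|M. g w * ip u (c w) * ip (c w) x) \<le> (LINT w|M. norm (g w * ip u (c w))) * norm x" .
  qed auto
  then have "\<exists>A. \<forall>u v. ip (A u) v = (LINT w|M. g w * ip u (c w) * ip (c w) v)"
    by (intro choice allI)
  then obtain A where A: "\<And>u v. ip (A u) v = (LINT w|M. g w * ip u (c w) * ip (c w) v)" by blast
  have "weak_integral ip M T = A"
    unfolding weak_integral_def
  proof (rule the_equality)
    show "\<forall>u v. has_bochner_integral M (\<lambda>w. ip (T w u) v) (ip (A u) v)"
      unfolding T A using iT by (simp add: has_bochner_integral_integrable)
    fix A' assume "\<forall>u v. has_bochner_integral M (\<lambda>w. ip (T w u) v) (ip (A' u) v)"
    then have "ip (A' u) v = ip (A u) v" for u v
      unfolding T A by (metis has_bochner_integral_integral_eq)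
    then show "A' = A" by (intro ext ip_eqI)
  qed
  then show ?thesis using A by (simp add: T_def[abs_def])
qed

end

subsection \<open>Polar coordinates\<close>

lemma nn_integral_lborel_shift:
  fixes f :: "'a::euclidean_space \<Rightarrow> ennreal"
  assumes [measurable]: "f \<in> borel_measurable borel"
  shows "(\<integral>\<^sup>+x. f (t + x) \<partial>lborel) = (\<integral>\<^sup>+x. f x \<partial>lborel)"
    and "(\<integral>\<^sup>+x. f (t - x) \<partial>lborel) = (\<integral>\<^sup>+x. f x \<partial>lborel)"
  subgoal
    by (subst (2) lborel_affine[of 1 t]) (simp_all add: nn_integral_density nn_integral_distr)
  subgoal
    by (subst (2) lborel_affine[of "-1" t]) (simp_all add: nn_integral_density nn_integral_distr)
  done

lemma borel_measurable_orthogonal: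
  fixes U :: "'a::euclidean_space \<Rightarrow> 'a"
  assumes "orthogonal_transformation U" shows "U \<in> borel \<rightarrow>\<^sub>M borel"
  using assms by (intro borel_measurable_continuous_onI) (simp add: linear_continuous_on orthogonal_transformation_linear linear_linear)

text \<open>Both \<open>lborel\<close> and its image under \<open>U\<close> are translation invariant, so Fubini makes them
  proportional; the unit ball fixes the factor.\<close>

lemma nn_integral_lborel_orthogonal:
  fixes f :: "'a::euclidean_space \<Rightarrow> ennreal" and U :: "'a \<Rightarrow> 'a"
  assumes U: "orthogonal_transformation U" and f [measurable]: "f \<in> borel_measurable borel"
  shows "(\<integral>\<^sup>+x. f (U x) \<partial>lborel) = (\<integral>\<^sup>+x. f x \<partial>lborel)"
proof -
  have [measurable]: "U \<in> borel \<rightarrow>\<^sub>M borel" by (rule borel_measurable_orthogonal[OF U])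
  define g :: "'a \<Rightarrow> ennreal" where "g = indicator (ball 0 1)"
  have [measurable]: "g \<in> borel_measurable borel" unfolding g_def by (rule borel_measurable_indicator) simp
  have gU: "g (U x) = g x" for x
    using orthogonal_transformation_norm[OF U, of x] by (simp add: g_def indicator_def)
  define V where "V = (\<integral>\<^sup>+x. g x \<partial>(lborel :: 'a measure))"
  have V: "V = emeasure lborel (ball (0::'a) 1)" unfolding V_def g_def by simp
  have inv: "\<exists>x'. U x' = y" for y
    using orthogonal_transformation_surj[OF U] by (metis surjD)
  have shiftU: "(\<integral>\<^sup>+x. f (U x) * g (y + U x) \<partial>lborel) = (\<integral>\<^sup>+x. f (U x - y) * g (U x) \<partial>lborel)" for y
  proof -
    obtain y' where y': "U y' = y" using inv by blast
    have lin: "U (- y' + x) = U x - y" for x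
      using orthogonal_transformation_linear[OF U] y' by (simp add: linear_diff)
    have "(\<integral>\<^sup>+x. f (U x) * g (y + U x) \<partial>lborel) = (\<integral>\<^sup>+x. f (U (- y' + x)) * g (y + U (- y' + x)) \<partial>lborel)"
      by (rule nn_integral_lborel_shift(1)[symmetric]) measurable
    then show ?thesis unfolding lin by simp
  qed
  have "(\<integral>\<^sup>+x. f (U x) \<partial>lborel) * V = (\<integral>\<^sup>+x. f (U x) * V \<partial>lborel)"
    by (rule nn_integral_multc[symmetric]) measurable
  also have "\<dots> = (\<integral>\<^sup>+x. (\<integral>\<^sup>+y. f (U x) * g (y + U x) \<partial>lborel) \<partial>lborel)"
  proof (rule nn_integral_cong)
    fix x
    have "V = (\<integral>\<^sup>+y. g (U x + y) \<partial>lborel)"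
      unfolding V_def by (rule nn_integral_lborel_shift(1)[symmetric]) measurable
    then show "f (U x) * V = (\<integral>\<^sup>+y. f (U x) * g (y + U x) \<partial>lborel)"
      by (simp add: nn_integral_cmult add.commute)
  qed
  also have "\<dots> = (\<integral>\<^sup>+y. (\<integral>\<^sup>+x. f (U x) * g (y + U x) \<partial>lborel) \<partial>lborel)"
    by (rule lborel_pair.Fubini'[symmetric]) measurable
  also have "\<dots> = (\<integral>\<^sup>+y. (\<integral>\<^sup>+x. f (U x - y) * g (U x) \<partial>lborel) \<partial>lborel)"
    unfolding shiftU ..
  also have "\<dots> = (\<integral>\<^sup>+x. (\<integral>\<^sup>+y. f (U x - y) * g (U x) \<partial>lborel) \<partial>lborel)"
    by (rule lborel_pair.Fubini') measurable
  also have "\<dots> = (\<integral>\<^sup>+x. (\<integral>\<^sup>+y. f y \<partial>lborel) * g x \<partial>lborel)"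
    by (rule nn_integral_cong) (simp add: nn_integral_multc nn_integral_lborel_shift gU)
  also have "\<dots> = (\<integral>\<^sup>+x. f x \<partial>lborel) * V"
    unfolding V_def by (rule nn_integral_cmult) measurable
  finally have "(\<integral>\<^sup>+x. f (U x) \<partial>lborel) * V = (\<integral>\<^sup>+x. f x \<partial>lborel) * V" .
  moreover have "V \<noteq> 0" "V \<noteq> \<infinity>"
  proof -
    show "V \<noteq> \<infinity>" unfolding V using emeasure_lborel_ball_finite[of "0::'a" 1] by simp
    show "V \<noteq> 0" unfolding V
    proof -
      have "unit_ball_vol (real DIM('a)) > 0" by (rule unit_ball_vol_pos) simp
      then have "unit_ball_vol (real DIM('a)) \<noteq> 0" by (rule less_imp_neq[THEN not_sym])
      then show "emeasure lborel (ball (0::'a) 1) \<noteq> 0" by (simp add: emeasure_ball)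
    qed
  qed
  ultimately show ?thesis by (metis ennreal_mult_divide_eq infinity_ennreal_def)
qed

text \<open>The sphere measure is the law of the direction of z when z has density W(|z|)/c. It
  inherits invariance from Lebesgue measure, and the splitting into radius and direction needed for
  the weight W holds by construction.\<close>

lemma polar_measure:
  fixes W :: "real \<Rightarrow> ennreal"
  assumes [measurable]: "W \<in> borel_measurable borel"
    and c: "c = (\<integral>\<^sup>+z. W (norm z) \<partial>(lborel :: (complex^'n) measure))" "c \<noteq> 0" "c \<noteq> \<infinity>"
  shows "\<exists>\<sigma>' :: (complex^'n) measure. rotation_invariant_sphere_measure \<sigma>' \<and>
     (\<forall>F\<in>borel_measurable borel. (\<integral>\<^sup>+z. W (norm z) * F (sgn z) \<partial>lborel) = c * (\<integral>\<^sup>+z. F z \<partial>\<sigma>'))"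
proof -
  define N where "N = restrict_space borel (sphere (0 :: complex^'n) 1)"
  \<comment> \<open>An arbitrary unit vector at 0 makes \<open>dir\<close> map everything into the
    sphere; off the null set {0} it is \<open>sgn\<close>.\<close>
  define dir :: "complex^'n \<Rightarrow> complex^'n" where "dir z = (if z = 0 then axis undefined 1 else inverse (norm z) *\<^sub>R z)" for z
  have dirb [measurable]: "dir \<in> borel \<rightarrow>\<^sub>M borel" unfolding dir_def by measurable
  have dirN [measurable]: "dir \<in> borel \<rightarrow>\<^sub>M N"
    unfolding N_def by (rule measurable_restrict_space2[OF _ dirb]) (auto simp: dir_def norm_axis_1)
  define w where "w z = W (norm z) / c" for z :: "complex^'n"
  have [measurable]: "w \<in> borel_measurable borel" unfolding w_def[abs_def] by measurable
  define \<sigma>' where "\<sigma>' = distr (density lborel w) N dir"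
  have sets: "sets \<sigma>' = sets N" and space: "space \<sigma>' = sphere 0 1"
    by (simp_all add: \<sigma>'_def N_def space_restrict_space)
  have int: "(\<integral>\<^sup>+z. F z \<partial>\<sigma>') = (\<integral>\<^sup>+z. w z * F (dir z) \<partial>lborel)" if F [measurable]: "F \<in> borel_measurable N" for F
    unfolding \<sigma>'_def by (simp add: nn_integral_distr nn_integral_density)
  have AE0: "AE z in lborel. z \<noteq> (0 :: complex^'n)" by (rule AE_lborel_singleton)
  have tot: "emeasure \<sigma>' (sphere 0 1) = 1"
  proof -
    have "emeasure \<sigma>' (space \<sigma>') = (\<integral>\<^sup>+z. 1 \<partial>\<sigma>')" by simp
    also have "\<dots> = (\<integral>\<^sup>+z. w z * 1 \<partial>lborel)" by (rule int) simp
    also have "\<dots> = c / c" unfolding w_def by (simp add: nn_integral_divide c(1))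
    also have "\<dots> = 1" using c(2,3) by (simp add: ennreal_divide_self top.not_eq_extremum)
    finally show ?thesis unfolding space .
  qed
  have rot: "distr \<sigma>' \<sigma>' U = \<sigma>'" if U: "orthogonal_transformation U" for U
  proof (rule measure_eqI)
    have [measurable]: "U \<in> borel \<rightarrow>\<^sub>M borel" by (rule borel_measurable_orthogonal[OF U])
    have UN [measurable]: "U \<in> N \<rightarrow>\<^sub>M N"
      unfolding N_def by (intro measurable_restrict_space3) (auto simp: orthogonal_transformation_norm[OF U])
    have U\<sigma>: "U \<in> \<sigma>' \<rightarrow>\<^sub>M \<sigma>'" using UN measurable_cong_sets[OF sets sets] by blast
    fix A assume "A \<in> sets (distr \<sigma>' \<sigma>' U)"
    then have A: "A \<in> sets \<sigma>'" and AN [measurable]: "A \<in> sets N" by (simp_all add: sets)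
    have iA: "(\<integral>\<^sup>+z. indicator A (U z) \<partial>\<sigma>') = (\<integral>\<^sup>+z. w z * indicator A (U (dir z)) \<partial>lborel)"
      by (rule int) measurable
    have "emeasure (distr \<sigma>' \<sigma>' U) A = (\<integral>\<^sup>+z. indicator A z \<partial>(distr \<sigma>' \<sigma>' U))"
      using A by simp
    also have "\<dots> = (\<integral>\<^sup>+z. indicator A (U z) \<partial>\<sigma>')"
      using A by (intro nn_integral_distr U\<sigma>) simp
    also have "\<dots> = (\<integral>\<^sup>+z. w z * indicator A (U (dir z)) \<partial>lborel)" by (rule iA)
    also have "\<dots> = (\<integral>\<^sup>+z. w (U z) * indicator A (dir (U z)) \<partial>lborel)"
    proof (rule nn_integral_cong_AE)
      show "AE z in lborel. w z * indicator A (U (dir z)) = w (U z) * indicator A (dir (U z))"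
        using AE0
      proof eventually_elim
        fix z :: "complex^'n" assume z: "z \<noteq> 0"
        have n: "norm (U z) = norm z" by (rule orthogonal_transformation_norm[OF U])
        then have "U z \<noteq> 0" using z by (metis norm_eq_zero)
        then have "dir (U z) = U (dir z)" using z n orthogonal_transformation_scaleR[OF U] by (simp add: dir_def)
        then show "w z * indicator A (U (dir z)) = w (U z) * indicator A (dir (U z))" using n by (simp add: w_def)
      qed
    qed
    also have "\<dots> = (\<integral>\<^sup>+z. w z * indicator A (dir z) \<partial>lborel)"
      by (rule nn_integral_lborel_orthogonal[OF U]) measurable
    also have "\<dots> = (\<integral>\<^sup>+z. indicator A z \<partial>\<sigma>')" by (rule int[symmetric]) measurable
    also have "\<dots> = emeasure \<sigma>' A" using A by simp
    finally show "emeasure (distr \<sigma>' \<sigma>' U) A = emeasure \<sigma>' A" .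
  qed simp
  have "rotation_invariant_sphere_measure \<sigma>'"
    unfolding rotation_invariant_sphere_measure_def using sets space tot rot by (simp add: N_def)
  moreover have "(\<integral>\<^sup>+z. W (norm z) * F (sgn z) \<partial>lborel) = c * (\<integral>\<^sup>+z. F z \<partial>\<sigma>')" if F: "F \<in> borel_measurable borel" for F
  proof -
    have FN [measurable]: "F \<in> borel_measurable N" unfolding N_def by (rule measurable_restrict_space1[OF F])
    have "c * (\<integral>\<^sup>+z. F z \<partial>\<sigma>') = (\<integral>\<^sup>+z. c * (w z * F (dir z)) \<partial>lborel)"
      unfolding int[OF FN] by (rule nn_integral_cmult[symmetric]) measurable
    also have "\<dots> = (\<integral>\<^sup>+z. W (norm z) * F (sgn z) \<partial>lborel)"
    proof (rule nn_integral_cong_AE)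
      show "AE z in lborel. c * (w z * F (dir z)) = W (norm z) * F (sgn z)"
        using AE0
      proof eventually_elim
        fix z :: "complex^'n" assume z: "z \<noteq> 0"
        then have "dir z = sgn z" by (simp add: dir_def sgn_div_norm)
        moreover have "c * w z = W (norm z)"
          unfolding w_def using c(2,3) by (simp add: ennreal_times_divide ennreal_mult_divide_eq mult.commute[of c] top.not_eq_extremum)
        ultimately show "c * (w z * F (dir z)) = W (norm z) * F (sgn z)" by (simp flip: mult.assoc)
      qed
    qed
    finally show ?thesis ..
  qed
  ultimately show ?thesis by blast
qed

text \<open>Both sides integrate w against measures on the line: the image of the ball under |z|^2,
  and a multiple of n r^(n-1) on [0,1]. They agree on half-lines because in real dimension 2n the
  set |z|^2 \<le> y has volume proportional to y^n.\<close>

lemma radial_nn_integral: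
  fixes w :: "real \<Rightarrow> ennreal"
  assumes [measurable]: "w \<in> borel_measurable borel"
  shows "(\<integral>\<^sup>+z. w ((norm z)\<^sup>2) * indicator (ball 0 1) z \<partial>(lborel :: (complex^'n) measure)) =
     emeasure lborel (ball (0 :: complex^'n) 1) * (\<integral>\<^sup>+r. w r * ennreal (real CARD('n) * r ^ (CARD('n) - 1)) * indicator {0..1} r \<partial>lborel)"
proof -
  let ?n = "CARD('n)"
  define v where "v = unit_ball_vol (real (2 * ?n))"
  have v0: "v > 0" by (simp add: v_def unit_ball_vol_pos)
  have vB: "emeasure lborel (ball (0 :: complex^'n) 1) = ennreal v"
    by (subst emeasure_ball) (simp_all add: v_def mult.commute)
  define M where "M = distr (density lborel (indicator (ball (0 :: complex^'n) 1))) borel (\<lambda>z. (norm z)\<^sup>2)"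
  define N where "N = density lborel (\<lambda>r. ennreal (v * (real ?n * r ^ (?n - 1))) * indicator {0..1} r)"
  have [measurable]: "(\<lambda>z :: complex^'n. (norm z)\<^sup>2) \<in> borel_measurable borel" by measurable
  have eM: "emeasure M A = emeasure lborel (ball (0 :: complex^'n) 1 \<inter> {z. (norm z)\<^sup>2 \<in> A})" if [measurable]: "A \<in> sets borel" for A
  proof -
    have S: "{z :: complex^'n. (norm z)\<^sup>2 \<in> A} \<in> sets lborel" by simp
    have Bm: "indicator (ball (0 :: complex^'n) 1) \<in> borel_measurable lborel"
      by (rule borel_measurable_indicator) simp
    have "emeasure M A = emeasure (density lborel (indicator (ball (0 :: complex^'n) 1))) {z. (norm z)\<^sup>2 \<in> A}"
      unfolding M_def by (subst emeasure_distr) (auto simp: vimage_def)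
    also have "\<dots> = (\<integral>\<^sup>+z. indicator (ball (0 :: complex^'n) 1) z * indicator {z. (norm z)\<^sup>2 \<in> A} z \<partial>lborel)"
      by (rule emeasure_density[OF Bm S])
    also have "\<dots> = (\<integral>\<^sup>+z. indicator (ball (0 :: complex^'n) 1 \<inter> {z. (norm z)\<^sup>2 \<in> A}) z \<partial>lborel)"
      unfolding indicator_inter_arith ..
    also have "\<dots> = emeasure lborel (ball (0 :: complex^'n) 1 \<inter> {z. (norm z)\<^sup>2 \<in> A})"
      by (rule nn_integral_indicator) (use S in simp)
    finally show ?thesis .
  qed
  have eN: "emeasure N A = (\<integral>\<^sup>+r. ennreal (v * (real ?n * r ^ (?n - 1))) * indicator {0..1} r * indicator A r \<partial>lborel)" if [measurable]: "A \<in> sets borel" for A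
    unfolding N_def by (subst emeasure_density) auto
  have tail: "emeasure M {x<..} = emeasure N {x<..}" for x
  proof (cases "x < 1")
    case False
    have "ball (0 :: complex^'n) 1 \<inter> {z. (norm z)\<^sup>2 \<in> {x<..}} = {}"
    proof -
      have "\<not> x < (norm z)\<^sup>2" if "norm z < 1" for z :: "complex^'n"
        using power_le_one[of "norm z" 2] that False by simp
      then show ?thesis by auto
    qed
    moreover have "(\<integral>\<^sup>+r. ennreal (v * (real ?n * r ^ (?n - 1))) * indicator {0..1} r * indicator {x<..} r \<partial>lborel) = (\<integral>\<^sup>+(r::real). 0 \<partial>lborel)"
      using False by (intro nn_integral_cong) (auto simp: indicator_def)
    ultimately show ?thesis by (simp add: eM eN)
  next
    case True
    \<comment> \<open>A negative threshold cuts nothing off, so it acts as 0.\<close>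
    define y where "y = max x 0"
    have y: "0 \<le> y" "y < 1" using True by (auto simp: y_def)
    have "emeasure N {x<..} = (\<integral>\<^sup>+r. ennreal (v * (real ?n * r ^ (?n - 1))) * indicator {y..1} r \<partial>lborel)"
    proof (subst eN, simp, rule nn_integral_cong_AE)
      show "AE r in lborel. ennreal (v * (real ?n * r ^ (?n - 1))) * indicator {0..1} r * indicator {x<..} r = ennreal (v * (real ?n * r ^ (?n - 1))) * indicator {y..1} r"
        using AE_lborel_singleton[of y] by eventually_elim (auto simp: indicator_def y_def max_def split: if_splits)
    qed
    also have "\<dots> = ennreal (v * 1 ^ ?n - v * y ^ ?n)"
      using y v0 by (intro nn_integral_FTC_Icc) (auto intro!: derivative_eq_intros)
    finally have N: "emeasure N {x<..} = ennreal (v - v * y ^ ?n)" by simp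
    have cb: "emeasure lborel (cball (0 :: complex^'n) (sqrt y)) = ennreal (v * y ^ ?n)"
    proof -
      have d: "DIM(complex^'n) = 2 * ?n" by simp
      have sq: "sqrt y ^ (2 * ?n) = y ^ ?n" using y by (simp only: power_mult real_sqrt_pow2)
      have "emeasure lborel (cball (0 :: complex^'n) (sqrt y)) = ennreal (unit_ball_vol (real DIM(complex^'n)) * sqrt y ^ DIM(complex^'n))"
        using y by (intro emeasure_cball) simp
      then show ?thesis unfolding d sq v_def .
    qed
    have M: "emeasure M {x<..} = ennreal (v - v * y ^ ?n)"
    proof (cases "x < 0")
      case True
      then have "ball (0 :: complex^'n) 1 \<inter> {z. (norm z)\<^sup>2 \<in> {x<..}} = ball 0 1"
        by (auto intro: less_le_trans[OF _ zero_le_power2])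
      moreover have "y = 0" using True by (simp add: y_def)
      ultimately show ?thesis by (simp add: eM vB zero_power)
    next
      case False
      then have xy: "x = y" by (simp add: y_def)
      have "ball (0 :: complex^'n) 1 \<inter> {z. (norm z)\<^sup>2 \<in> {x<..}} = ball 0 1 - cball 0 (sqrt y)"
      proof (rule set_eqI)
        fix z :: "complex^'n"
        have "y < (norm z)\<^sup>2 \<longleftrightarrow> sqrt y < norm z"
          by (metis abs_norm_cancel real_sqrt_abs real_sqrt_less_iff)
        then show "z \<in> ball 0 1 \<inter> {z. (norm z)\<^sup>2 \<in> {x<..}} \<longleftrightarrow> z \<in> ball 0 1 - cball 0 (sqrt y)"
          by (simp add: xy not_le)
      qed
      then have "emeasure M {x<..} = emeasure lborel (ball (0 :: complex^'n) 1 - cball 0 (sqrt y))" by (simp add: eM)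
      also have "\<dots> = emeasure lborel (ball (0 :: complex^'n) 1) - emeasure lborel (cball (0 :: complex^'n) (sqrt y))"
      proof (rule emeasure_Diff)
        have "sqrt y < 1" using y by simp
        then show "cball (0 :: complex^'n) (sqrt y) \<subseteq> ball 0 1" by (auto simp: cball_subset_ball_iff)
      qed (simp_all add: cb)
      also have "\<dots> = ennreal (v - v * y ^ ?n)" unfolding cb vB using y v0 by (simp add: ennreal_minus)
      finally show ?thesis .
    qed
    show ?thesis unfolding M N ..
  qed
  have "M = N"
  proof (rule measure_eqI_lessThan)
    show "emeasure M {x<..} < \<infinity>" for x
    proof -
      have "emeasure M {x<..} \<le> emeasure lborel (ball (0 :: complex^'n) 1)"
        by (subst eM) (auto intro!: emeasure_mono)
      then show ?thesis unfolding vB using ennreal_less_top order_le_less_trans by (metis infinity_ennreal_def)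
    qed
  qed (simp_all add: M_def N_def tail[unfolded M_def N_def])
  have "(\<integral>\<^sup>+z. w ((norm z)\<^sup>2) * indicator (ball 0 1) z \<partial>(lborel :: (complex^'n) measure)) = (\<integral>\<^sup>+r. w r \<partial>M)"
  proof -
    have "indicator (ball (0 :: complex^'n) 1) \<in> borel_measurable lborel"
      by (rule borel_measurable_indicator) simp
    then have "(\<integral>\<^sup>+z. w ((norm z)\<^sup>2) \<partial>density lborel (indicator (ball (0 :: complex^'n) 1)))
       = (\<integral>\<^sup>+z. indicator (ball (0 :: complex^'n) 1) z * w ((norm z)\<^sup>2) \<partial>lborel)"
      by (rule nn_integral_density) measurable
    moreover have "(\<integral>\<^sup>+r. w r \<partial>M) = (\<integral>\<^sup>+z. w ((norm z)\<^sup>2) \<partial>density lborel (indicator (ball (0 :: complex^'n) 1)))"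
      unfolding M_def by (rule nn_integral_distr) simp_all
    ultimately show ?thesis by (simp add: mult.commute)
  qed
  also have "\<dots> = (\<integral>\<^sup>+r. ennreal v * (w r * ennreal (real ?n * r ^ (?n - 1)) * indicator {0..1} r) \<partial>lborel)"
    unfolding \<open>M = N\<close> N_def using v0
    by (subst nn_integral_density) (auto intro!: nn_integral_cong simp: indicator_def ennreal_mult mult_ac)
  also have "\<dots> = ennreal v * (\<integral>\<^sup>+r. w r * ennreal (real ?n * r ^ (?n - 1)) * indicator {0..1} r \<partial>lborel)"
    by (rule nn_integral_cmult) measurable
  finally show ?thesis unfolding vB .
qed

subsection \<open>Radial norms and a Bessel inequality on the ball\<close>

text \<open>Euler's limit for \<Gamma>(x), rearranged as \<Gamma>(l+1+x) ~ l! l^x; the exponential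
  is the form of the power in \<open>Gamma_series\<close>.\<close>

lemma Gamma_shift_asymp:
  fixes x :: real
  assumes x: "x > 0"
  shows "(\<lambda>l. Gamma (real l + 1 + x) / (fact l * exp (x * ln (real l)))) \<longlonglongrightarrow> 1"
proof -
  have g: "Gamma x > 0" by (rule Gamma_real_pos[OF x])
  have "(\<lambda>l. Gamma x / Gamma_series x l) \<longlonglongrightarrow> Gamma x / Gamma x"
    by (intro tendsto_intros Gamma_series_LIMSEQ) (use g in simp)
  moreover have "Gamma x / Gamma_series x l = Gamma (real l + 1 + x) / (fact l * exp (x * ln (real l)))" for l
  proof -
    have "pochhammer x (l + 1) = Gamma (x + real (l + 1)) / Gamma x"
      by (rule pochhammer_Gamma) (use x in \<open>auto elim!: nonpos_Ints_cases\<close>)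
    then show ?thesis using g by (simp add: Gamma_series_def algebra_simps)
  qed
  ultimately show ?thesis using g by simp
qed

text \<open>Written at l + 1 + offset, the numerator and the denominator have the same number of
  factorials and, because x0 = \<beta> + m + 1, the same total power of l. The quotient therefore
  tends to 1.\<close>

lemma Gamma_quotient_Bseq:
  assumes n: "n > 0" and \<beta>: "\<beta> > 0" and a: "a = \<beta> + real m + real n"
  shows "Bseq (\<lambda>p. (Gamma (a + real p + real i))\<^sup>2 * Gamma (real n + real p + real q)
     / (Gamma (a + real p) * Gamma (real p + real n + real m) * Gamma (real n + real p + real q + \<beta> + 2 * real i)))"
    (is "Bseq ?S")
proof -
  define x0 where "x0 = \<beta> + real m + 1"
  define G where "G x l = Gamma (real l + 1 + x) / (fact l * exp (x * ln (real l)))" for x and l :: nat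
  have GG: "Gamma (real l + 1 + x) = G x l * (fact l * exp (x * ln (real l)))" for x l
    by (simp add: G_def)
  have lim: "(\<lambda>p. G x (p + (n - 1))) \<longlonglongrightarrow> 1" if "x > 0" for x
    unfolding G_def by (rule LIMSEQ_ignore_initial_segment) (rule Gamma_shift_asymp[OF that])
  have "(\<lambda>p. (G (x0 + real i) (p + (n - 1)))\<^sup>2 * G (real q + 1) (p + (n - 1))
      / (G x0 (p + (n - 1)) * G (real m + 1) (p + (n - 1)) * G (real q + 1 + \<beta> + 2 * real i) (p + (n - 1)))) \<longlonglongrightarrow> 1\<^sup>2 * 1 / (1 * 1 * 1)"
    by (intro tendsto_intros lim) (use \<beta> in \<open>auto simp: x0_def\<close>)
  \<comment> \<open>Starting from \<open>Suc p\<close> makes every offset positive, as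
    \<open>Gamma_shift_asymp\<close> demands; boundedness is insensitive to the missing first
    term.\<close>
  moreover have "(G (x0 + real i) l)\<^sup>2 * G (real q + 1) l / (G x0 l * G (real m + 1) l * G (real q + 1 + \<beta> + 2 * real i) l) = ?S (Suc p)"
    if l: "l = p + (n - 1)" for p l
  proof -
    define L where "L = ln (real l)"
    have rl: "real l = real p + real n - 1" using n l by (simp add: of_nat_diff)
    have e1: "a + real (Suc p) + real i = real l + 1 + (x0 + real i)" "a + real (Suc p) = real l + 1 + x0"
      "real n + real (Suc p) + real q = real l + 1 + (real q + 1)" "real (Suc p) + real n + real m = real l + 1 + (real m + 1)"
      "real n + real (Suc p) + real q + \<beta> + 2 * real i = real l + 1 + (real q + 1 + \<beta> + 2 * real i)"
      by (simp_all add: rl x0_def a)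
    have E: "(exp ((x0 + real i) * L))\<^sup>2 * exp ((real q + 1) * L) = exp (x0 * L) * exp ((real m + 1) * L) * exp ((real q + 1 + \<beta> + 2 * real i) * L)"
      unfolding power2_eq_square exp_add[symmetric] by (simp add: x0_def algebra_simps)
    have f: "(fact l :: real)\<^sup>2 * fact l = fact l * fact l * fact l" by (simp add: power2_eq_square)
    have "?S (Suc p) = ((G (x0 + real i) l)\<^sup>2 * G (real q + 1) l) * (((fact l)\<^sup>2 * fact l) * ((exp ((x0 + real i) * L))\<^sup>2 * exp ((real q + 1) * L)))
       / ((G x0 l * G (real m + 1) l * G (real q + 1 + \<beta> + 2 * real i) l) * ((fact l * fact l * fact l) * (exp (x0 * L) * exp ((real m + 1) * L) * exp ((real q + 1 + \<beta> + 2 * real i) * L))))"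
      unfolding e1(1,5) unfolding e1(2-4) unfolding GG L_def[symmetric] by (simp only: power_mult_distrib mult_ac)
    also have "\<dots> = (G (x0 + real i) l)\<^sup>2 * G (real q + 1) l / (G x0 l * G (real m + 1) l * G (real q + 1 + \<beta> + 2 * real i) l)"
      unfolding E f by (rule mult_divide_mult_cancel_right) simp
    finally show ?thesis ..
  qed
  ultimately have "(\<lambda>p. ?S (Suc p)) \<longlonglongrightarrow> 1\<^sup>2 * 1 / (1 * 1 * 1)" by simp
  then have "Bseq (\<lambda>p. ?S (Suc p))" by (intro convergent_imp_Bseq convergentI)
  then show ?thesis by (subst (asm) Bseq_Suc_iff)
qed

lemma beta_nn_integral:
  assumes k: "k > 0" and b: "b > 0"
  shows "(\<integral>\<^sup>+r. ennreal (r ^ (k - 1) * (1 - r) powr (b - 1)) * indicator {0..1} r \<partial>lborel) = ennreal (Beta (real k) b)"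
proof -
  have "(\<integral>\<^sup>+r. ennreal (r ^ (k - 1) * (1 - r) powr (b - 1)) * indicator {0..1} r \<partial>lborel) =
     (\<integral>\<^sup>+r. ennreal (r powr (real k - 1) * (1 - r) powr (b - 1)) * indicator {0..1} r \<partial>lborel)"
  proof (rule nn_integral_cong_AE)
    show "AE r in lborel. ennreal (r ^ (k - 1) * (1 - r) powr (b - 1)) * indicator {0..1} r =
        ennreal (r powr (real k - 1) * (1 - r) powr (b - 1)) * indicator {0..1} r"
      using AE_lborel_singleton[of "0 :: real"]
    proof eventually_elim
      fix r :: real assume "r \<noteq> 0"
      then have "r \<in> {0..1} \<Longrightarrow> r powr (real k - 1) = r ^ (k - 1)"
        using k by (simp add: of_nat_diff flip: powr_realpow)
      then show "ennreal (r ^ (k - 1) * (1 - r) powr (b - 1)) * indicator {0..1} r =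
        ennreal (r powr (real k - 1) * (1 - r) powr (b - 1)) * indicator {0..1} r"
        by (auto simp: indicator_def)
    qed
  qed
  also have "\<dots> = ennreal (Beta (real k) b)"
    by (rule nn_integral_has_integral_lebesgue') (use has_integral_Beta_real[of "real k" b] k b in auto)
  finally show ?thesis .
qed

lemma kern_weight_nonneg: "\<beta> > 0 \<Longrightarrow> n > 0 \<Longrightarrow> kern_weight n \<beta> m p q \<ge> 0"
  unfolding kern_weight_def
  by (intro divide_nonneg_nonneg mult_nonneg_nonneg less_imp_le[OF Gamma_real_pos] pochhammer_nonneg) auto

text \<open>The square of the polynomial is at most k + 1 times the sum of the squares of its terms.
  Each such term integrates to a Beta value, and together with the weight it becomes a constant
  times the quotient of \<open>Gamma_quotient_Bseq\<close>. As q and i take finitely many values,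
  one C serves all p.\<close>

lemma radial_norm_bound:
  assumes n: "n > 0" and \<beta>: "\<beta> > 0" and a: "a = \<beta> + real m + real n"
  shows "\<exists>C\<ge>0. \<forall>p q. q \<le> m \<longrightarrow> ennreal (kern_weight n \<beta> m p q) *
    (\<integral>\<^sup>+r. ennreal (r ^ (n + p + q - 1) * (1 - r) powr (\<beta> - 1) * (poly (hyp \<beta> (m - q) (a + real p)) (1 - r))\<^sup>2) * indicator {0..1} r \<partial>lborel) \<le> ennreal C"
proof -
  define c where "c k i = pochhammer (- real k) i / (pochhammer (\<beta> + 1) i * fact i)" for k i
  define S where "S i q p = (Gamma (a + real p + real i))\<^sup>2 * Gamma (real n + real p + real q)
     / (Gamma (a + real p) * Gamma (real p + real n + real m) * Gamma (real n + real p + real q + \<beta> + 2 * real i))" for i q p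
  have "\<exists>B. \<forall>p. \<bar>S i q p\<bar> \<le> B" for i q
    using Gamma_quotient_Bseq[OF n \<beta> a, of i q] unfolding Bseq_def S_def by auto
  then obtain B where B: "\<And>i q p. \<bar>S i q p\<bar> \<le> B i q" by metis
  define D where "D q i = pochhammer (\<beta> + 1) (m - q) / fact (m - q) * ((real (m - q) + 1) * (c (m - q) i)\<^sup>2 * Gamma (\<beta> + 2 * real i))" for q i
  have D0: "D q i \<ge> 0" for q i
    unfolding D_def using \<beta> by (intro mult_nonneg_nonneg divide_nonneg_nonneg pochhammer_nonneg less_imp_le[OF Gamma_real_pos]) auto
  have B0: "B i q \<ge> 0" for i q using B[of i q 0] by linarith
  define C where "C = (\<Sum>q\<le>m. \<Sum>i\<le>m - q. D q i * B i q)"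
  have C0: "C \<ge> 0" unfolding C_def by (intro sum_nonneg mult_nonneg_nonneg D0 B0)
  have apos: "a > 0" using \<beta> by (simp add: a)
  have main: "ennreal (kern_weight n \<beta> m p q) *
    (\<integral>\<^sup>+r. ennreal (r ^ (n + p + q - 1) * (1 - r) powr (\<beta> - 1) * (poly (hyp \<beta> (m - q) (a + real p)) (1 - r))\<^sup>2) * indicator {0..1} r \<partial>lborel) \<le> ennreal C"
    if q: "q \<le> m" for p q
  proof -
    define k where "k = m - q"
    define P where "P i = pochhammer (a + real p) i" for i
    have P: "P i = Gamma (a + real p + real i) / Gamma (a + real p)" for i
      unfolding P_def by (rule pochhammer_Gamma) (use apos in \<open>auto elim!: nonpos_Ints_cases\<close>)
    have pt: "ennreal (r ^ (n + p + q - 1) * (1 - r) powr (\<beta> - 1) * (poly (hyp \<beta> k (a + real p)) (1 - r))\<^sup>2) * indicator {0..1} r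
       \<le> (\<Sum>i\<le>k. ennreal ((real k + 1) * (c k i)\<^sup>2 * (P i)\<^sup>2) * (ennreal (r ^ (n + p + q - 1) * (1 - r) powr (\<beta> + 2 * real i - 1)) * indicator {0..1} r))" for r
    proof (cases "r \<in> {0..1}")
      case True
      have "(poly (hyp \<beta> k (a + real p)) (1 - r))\<^sup>2 = (\<Sum>i\<le>k. c k i * P i * (1 - r) ^ i)\<^sup>2"
        unfolding poly_hyp c_def P_def by (simp add: mult_ac)
      also have "\<dots> \<le> (\<Sum>i\<le>k. (c k i * P i * (1 - r) ^ i)\<^sup>2) * real (card {..k})"
        by (rule sum_squared_le_sum_of_squares)
      also have "\<dots> = (\<Sum>i\<le>k. (real k + 1) * (c k i)\<^sup>2 * (P i)\<^sup>2 * ((1 - r) ^ i)\<^sup>2)"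
        by (simp add: sum_distrib_right sum_distrib_left power_mult_distrib mult_ac add_ac)
      finally have "r ^ (n + p + q - 1) * (1 - r) powr (\<beta> - 1) * (poly (hyp \<beta> k (a + real p)) (1 - r))\<^sup>2 \<le>
        r ^ (n + p + q - 1) * (1 - r) powr (\<beta> - 1) * (\<Sum>i\<le>k. (real k + 1) * (c k i)\<^sup>2 * (P i)\<^sup>2 * ((1 - r) ^ i)\<^sup>2)"
        using True by (intro mult_left_mono mult_nonneg_nonneg) auto
      also have "\<dots> = (\<Sum>i\<le>k. ((real k + 1) * (c k i)\<^sup>2 * (P i)\<^sup>2) * (r ^ (n + p + q - 1) * (1 - r) powr (\<beta> + 2 * real i - 1)))"
        unfolding sum_distrib_left
      proof (rule sum.cong[OF refl])
        fix i
        have "(1 - r) powr (\<beta> - 1) * ((1 - r) ^ i)\<^sup>2 = (1 - r) powr (\<beta> + 2 * real i - 1)"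
        proof (cases "r = 1")
          case False
          then have "1 - r > 0" using True by simp
          then have "(1 - r) powr real (i * 2) = (1 - r) ^ (i * 2)" by (rule powr_realpow)
          then have "((1 - r) ^ i)\<^sup>2 = (1 - r) powr (2 * real i)"
            by (simp only: power_mult of_nat_mult of_nat_numeral mult.commute)
          then show ?thesis by (simp add: powr_add[symmetric] algebra_simps)
        qed simp
        note e = this
        have "r ^ (n + p + q - 1) * (1 - r) powr (\<beta> - 1) * ((real k + 1) * (c k i)\<^sup>2 * (P i)\<^sup>2 * ((1 - r) ^ i)\<^sup>2) =
          (real k + 1) * (c k i)\<^sup>2 * (P i)\<^sup>2 * (r ^ (n + p + q - 1) * ((1 - r) powr (\<beta> - 1) * ((1 - r) ^ i)\<^sup>2))"
          by (simp only: mult_ac)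
        then show "r ^ (n + p + q - 1) * (1 - r) powr (\<beta> - 1) * ((real k + 1) * (c k i)\<^sup>2 * (P i)\<^sup>2 * ((1 - r) ^ i)\<^sup>2) =
          (real k + 1) * (c k i)\<^sup>2 * (P i)\<^sup>2 * (r ^ (n + p + q - 1) * (1 - r) powr (\<beta> + 2 * real i - 1))"
          unfolding e .
      qed
      finally have "ennreal (r ^ (n + p + q - 1) * (1 - r) powr (\<beta> - 1) * (poly (hyp \<beta> k (a + real p)) (1 - r))\<^sup>2) \<le>
        ennreal (\<Sum>i\<le>k. ((real k + 1) * (c k i)\<^sup>2 * (P i)\<^sup>2) * (r ^ (n + p + q - 1) * (1 - r) powr (\<beta> + 2 * real i - 1)))"
        by (rule ennreal_leI)
      also have "\<dots> = (\<Sum>i\<le>k. ennreal ((real k + 1) * (c k i)\<^sup>2 * (P i)\<^sup>2) * ennreal (r ^ (n + p + q - 1) * (1 - r) powr (\<beta> + 2 * real i - 1)))"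
        using True by (subst sum_ennreal[symmetric]) (auto simp: ennreal_mult)
      finally show ?thesis using True by simp
    qed simp
    have Bt: "(\<integral>\<^sup>+r. ennreal (r ^ (n + p + q - 1) * (1 - r) powr (\<beta> + 2 * real i - 1)) * indicator {0..1} r \<partial>lborel)
        = ennreal (Beta (real n + real p + real q) (\<beta> + 2 * real i))" for i
      using beta_nn_integral[of "n + p + q" "\<beta> + 2 * real i"] n \<beta> by simp
    have "(\<integral>\<^sup>+r. ennreal (r ^ (n + p + q - 1) * (1 - r) powr (\<beta> - 1) * (poly (hyp \<beta> k (a + real p)) (1 - r))\<^sup>2) * indicator {0..1} r \<partial>lborel)
       \<le> (\<integral>\<^sup>+r. (\<Sum>i\<le>k. ennreal ((real k + 1) * (c k i)\<^sup>2 * (P i)\<^sup>2) * (ennreal (r ^ (n + p + q - 1) * (1 - r) powr (\<beta> + 2 * real i - 1)) * indicator {0..1} r)) \<partial>lborel)"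
      by (rule nn_integral_mono) (rule pt)
    also have "\<dots> = (\<Sum>i\<le>k. ennreal ((real k + 1) * (c k i)\<^sup>2 * (P i)\<^sup>2) * ennreal (Beta (real n + real p + real q) (\<beta> + 2 * real i)))"
      by (subst nn_integral_sum) (simp_all add: nn_integral_cmult Bt del: One_nat_def)
    also have "\<dots> = ennreal (\<Sum>i\<le>k. (real k + 1) * (c k i)\<^sup>2 * (P i)\<^sup>2 * Beta (real n + real p + real q) (\<beta> + 2 * real i))"
    proof -
      have "Beta (real n + real p + real q) (\<beta> + 2 * real i) \<ge> 0" for i
        unfolding Beta_def using n \<beta> by (intro divide_nonneg_nonneg mult_nonneg_nonneg less_imp_le[OF Gamma_real_pos]) auto
      then show ?thesis by (subst sum_ennreal[symmetric]) (auto simp: ennreal_mult)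
    qed
    finally have "ennreal (kern_weight n \<beta> m p q) *
      (\<integral>\<^sup>+r. ennreal (r ^ (n + p + q - 1) * (1 - r) powr (\<beta> - 1) * (poly (hyp \<beta> k (a + real p)) (1 - r))\<^sup>2) * indicator {0..1} r \<partial>lborel)
      \<le> ennreal (kern_weight n \<beta> m p q) * ennreal (\<Sum>i\<le>k. (real k + 1) * (c k i)\<^sup>2 * (P i)\<^sup>2 * Beta (real n + real p + real q) (\<beta> + 2 * real i))"
      by (rule mult_left_mono) simp
    also have "\<dots> = ennreal (kern_weight n \<beta> m p q * (\<Sum>i\<le>k. (real k + 1) * (c k i)\<^sup>2 * (P i)\<^sup>2 * Beta (real n + real p + real q) (\<beta> + 2 * real i)))"
      by (rule ennreal_mult'[symmetric]) (rule kern_weight_nonneg[OF \<beta> n])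
    also have "kern_weight n \<beta> m p q * (\<Sum>i\<le>k. (real k + 1) * (c k i)\<^sup>2 * (P i)\<^sup>2 * Beta (real n + real p + real q) (\<beta> + 2 * real i))
        = (\<Sum>i\<le>k. D q i * S i q p)"
      unfolding sum_distrib_left
    proof (rule sum.cong[OF refl])
      fix i
      have g: "Gamma (a + real p) \<noteq> 0"
      proof -
        have "a + real p > 0" using apos by simp
        then show ?thesis using Gamma_real_pos less_irrefl by metis
      qed
      have fc: "fact (p + n + m - 1) = Gamma (real p + real n + real m)"
        using n by (simp add: Gamma_fact[symmetric] of_nat_diff)
      have ga: "Gamma (\<beta> + real m + real n + real p) = Gamma (a + real p)" by (simp add: a)
      show "kern_weight n \<beta> m p q * ((real k + 1) * (c k i)\<^sup>2 * (P i)\<^sup>2 * Beta (real n + real p + real q) (\<beta> + 2 * real i)) = D q i * S i q p"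
        unfolding kern_weight_def D_def S_def P k_def Beta_def fc ga using g
        by (simp add: power_divide add.assoc) (simp add: power2_eq_square mult_ac)
    qed
    also have "(\<Sum>i\<le>k. D q i * S i q p) \<le> (\<Sum>i\<le>m - q. D q i * B i q)"
      unfolding k_def using B by (intro sum_mono mult_left_mono D0) (meson abs_ge_self order_trans)
    also have "\<dots> \<le> C"
      unfolding C_def using q by (intro member_le_sum[where f = "\<lambda>q. \<Sum>i\<le>m - q. D q i * B i q"]) (auto intro!: sum_nonneg mult_nonneg_nonneg D0 B0)
    finally show ?thesis unfolding k_def by (simp add: ennreal_leI)
  qed
  then show ?thesis using C0 by blast
qed

section \<open>Radial factors of the basis functions\<close>

definition radial_part :: "'n::finite itself \<Rightarrow> real \<Rightarrow> nat \<Rightarrow> nat \<Rightarrow> nat \<Rightarrow> real \<Rightarrow> real" where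
  "radial_part _ \<nu> m p q t = kappa TYPE('n) \<nu> m p q * (1 - t) powr (\<nu> - real m)
     * jacobi_poly (m - q) (real CARD('n) + real p + real q - 1) (2 * (\<nu> - real m) - real CARD('n)) (1 - 2 * t)"

lemma Phi_radial_part:
  "Phi h \<nu> m p q j (z :: complex^'n) = of_real (radial_part TYPE('n) \<nu> m p q ((norm z)\<^sup>2)) * h p q j z"
  by (simp add: Phi_def radial_part_def)

text \<open>Two arguments are needed for the kernel and t = u for the norms. In the product the
  signs of the two Jacobi expansions cancel, and \<kappa>^2 meets the squared boundary factor
  (\<beta>+1)_k / k!.\<close>

lemma radial_part_mult:
  fixes \<nu> \<beta> a :: real and m :: nat
  assumes \<beta>: "\<beta> = 2 * (\<nu> - real m) - real CARD('n::finite)" "\<beta> > 0" and a: "a = \<beta> + real m + real CARD('n)" and q: "q \<le> m"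
  shows "radial_part TYPE('n) \<nu> m p q t * radial_part TYPE('n) \<nu> m p q u =
    \<beta> / (real CARD('n) * Gamma (\<beta> + 1)) * kern_weight CARD('n) \<beta> m p q
      * (poly (hyp \<beta> (m - q) (a + real p)) (1 - t) * poly (hyp \<beta> (m - q) (a + real p)) (1 - u))
      * ((1 - t) powr (\<nu> - real m) * (1 - u) powr (\<nu> - real m))"
proof -
  let ?n = "real CARD('n)"
  define k where "k = m - q"
  have mk: "real m = real k + real q" using q by (simp add: k_def of_nat_diff)
  \<comment> \<open>The reciprocal of \<kappa>^2, rewritten in terms of \<beta> and a.\<close>
  define x where "x = (?n * Gamma (\<beta> + real k + 1) * Gamma (real p + ?n + real m)) / (fact k * \<beta> * Gamma (a + real p))"
  have n0: "?n > 0" by simp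
  have apos: "a + real p > 0" using \<beta> by (simp add: a)
  have g: "Gamma (\<beta> + real k + 1) > 0" "Gamma (real p + ?n + real m) > 0" "Gamma (a + real p) > 0" "Gamma (\<beta> + 1) > 0"
  proof -
    have "\<beta> + real k + 1 > 0" "real p + ?n + real m > 0" "\<beta> + 1 > 0"
      using \<beta>(2) n0 of_nat_0_le_iff[of p] of_nat_0_le_iff[of m] of_nat_0_le_iff[of k] by linarith+
    then show "Gamma (\<beta> + real k + 1) > 0" "Gamma (real p + ?n + real m) > 0" "Gamma (a + real p) > 0" "Gamma (\<beta> + 1) > 0"
      using apos by (simp_all only: Gamma_real_pos)
  qed
  have xpos: "x > 0" unfolding x_def by (intro divide_pos_pos mult_pos_pos g \<beta>(2) n0) simp
  have kap: "kappa TYPE('n) \<nu> m p q = x powr (- 1 / 2)"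
  proof -
    have "2 * \<nu> - real m - ?n - real q + 1 = \<beta> + real k + 1" "2 * \<nu> - real m + real p = a + real p"
      by (simp_all add: \<beta>(1) a mk)
    then show ?thesis unfolding kappa_def Let_def x_def k_def[symmetric] \<beta>(1)[symmetric] by (simp only:)
  qed
  have kap2: "kappa TYPE('n) \<nu> m p q * kappa TYPE('n) \<nu> m p q = 1 / x"
    unfolding kap powr_add[symmetric] using xpos by (simp add: powr_minus_divide)
  have jac: "jacobi_poly k (?n + real p + real q - 1) \<beta> (1 - 2 * t) = (-1) ^ k * pochhammer (\<beta> + 1) k / fact k * poly (hyp \<beta> k (a + real p)) (1 - t)" for t
  proof -
    have e: "real k + (?n + real p + real q - 1) + \<beta> + 1 = a + real p" by (simp add: a mk)
    have "\<beta> > -1" using \<beta>(2) by simp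
    from jacobi_poly_hyp[OF this, of k "?n + real p + real q - 1" t] show ?thesis unfolding e .
  qed
  have GB: "Gamma (\<beta> + real k + 1) = Gamma (\<beta> + 1) * pochhammer (\<beta> + 1) k"
  proof -
    have "pochhammer (\<beta> + 1) k = Gamma (\<beta> + 1 + real k) / Gamma (\<beta> + 1)"
      by (rule pochhammer_Gamma) (use \<beta>(2) in \<open>auto elim!: nonpos_Ints_cases\<close>)
    then show ?thesis using g by (simp add: add_ac)
  qed
  have fc: "fact (p + CARD('n) + m - 1) = Gamma (real p + ?n + real m)"
  proof -
    have h: "Suc (p + CARD('n) + m - 1) = p + CARD('n) + m" by simp
    have "1 + real (p + CARD('n) + m - 1) = real (Suc (p + CARD('n) + m - 1))" by (rule of_nat_Suc[symmetric])
    also have "\<dots> = real p + ?n + real m" unfolding h by simp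
    finally show ?thesis by (metis Gamma_fact)
  qed
  have pp: "pochhammer (\<beta> + 1) k > 0" by (rule pochhammer_pos) (use \<beta> in simp)
  have s: "(-1 :: real) ^ k * (-1) ^ k = 1" by (simp flip: power_mult_distrib)
  define E where "E = pochhammer (\<beta> + 1) k / fact k"
  have W: "1 / x * (E * E) = \<beta> / (?n * Gamma (\<beta> + 1)) * kern_weight CARD('n) \<beta> m p q"
  proof -
    have "kern_weight CARD('n) \<beta> m p q = Gamma (a + real p) * E / Gamma (real p + ?n + real m)"
      unfolding kern_weight_def k_def[symmetric] E_def fc by (simp add: a)
    moreover have "1 / ((n' * (G1 * pc) * Gm) / (fk * b * Ga)) * (pc / fk * (pc / fk)) = b / (n' * G1) * (Ga * (pc / fk) / Gm)"
      if "pc > 0" "fk > 0" for n' G1 pc Gm fk b Ga :: real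
      using that by simp
    ultimately show ?thesis unfolding x_def E_def GB using pp by simp
  qed
  have "radial_part TYPE('n) \<nu> m p q t * radial_part TYPE('n) \<nu> m p q u =
    (kappa TYPE('n) \<nu> m p q * kappa TYPE('n) \<nu> m p q) * (((-1) ^ k * (-1) ^ k) * (E * E))
      * (poly (hyp \<beta> k (a + real p)) (1 - t) * poly (hyp \<beta> k (a + real p)) (1 - u))
      * ((1 - t) powr (\<nu> - real m) * (1 - u) powr (\<nu> - real m))"
    unfolding radial_part_def k_def[symmetric] \<beta>(1)[symmetric] jac E_def by (simp add: mult_ac)
  also have "\<dots> = (1 / x * (E * E))
      * (poly (hyp \<beta> k (a + real p)) (1 - t) * poly (hyp \<beta> k (a + real p)) (1 - u))
      * ((1 - t) powr (\<nu> - real m) * (1 - u) powr (\<nu> - real m))"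
    unfolding kap2 s by simp
  finally show ?thesis unfolding W k_def .
qed

section \<open>The weighted measure on the ball and its symmetries\<close>

definition muB :: "(complex^'n) measure" where
  "muB = density lborel (\<lambda>z. indicator (ball 0 1) z * ennreal (1 / (1 - (norm z)\<^sup>2) ^ (CARD('n) + 1)))"

lemma sets_muB [simp, measurable_cong]: "sets muB = sets borel" by (simp add: muB_def)
lemma muB_density_measurable [measurable]:
  "(\<lambda>z :: complex^'n. indicator (ball 0 1) z * ennreal (1 / (1 - (norm z)\<^sup>2) ^ (CARD('n) + 1))) \<in> borel_measurable borel"
  by (intro borel_measurable_times_ennreal borel_measurable_indicator) simp_all

lemma nn_integral_muB:
  "f \<in> borel_measurable borel \<Longrightarrow> (\<integral>\<^sup>+z. f z \<partial>muB) =
     (\<integral>\<^sup>+z. indicator (ball 0 1) z * ennreal (1 / (1 - (norm z)\<^sup>2) ^ (CARD('n) + 1)) * f z \<partial>(lborel :: (complex^'n) measure))"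
  unfolding muB_def by (rule nn_integral_density) (use muB_density_measurable in simp_all)

text \<open>\<open>muB\<close> is the version of \<open>mu_n\<close> over Borel sets and without
  normalization; estimates are made there and carried back by the factor, the reciprocal of the
  volume of the ball.\<close>

lemma nn_integral_mu_n:
  assumes f: "f \<in> borel_measurable borel"
  shows "(\<integral>\<^sup>+z. f z \<partial>(mu_n :: (complex^'n) measure)) = 1 / emeasure lebesgue (ball 0 1 :: (complex^'n) set) * (\<integral>\<^sup>+z. f z \<partial>muB)"
proof -
  let ?c = "1 / emeasure lebesgue (ball 0 1 :: (complex^'n) set)"
  let ?d = "\<lambda>z :: complex^'n. ennreal (1 / (1 - (norm z)\<^sup>2) ^ (CARD('n) + 1))"
  have bm: "g \<in> borel_measurable mu_leb" if "g \<in> borel_measurable borel" for g :: "complex^'n \<Rightarrow> ennreal"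
  proof -
    have "g \<in> borel_measurable lebesgue" using that by (simp add: measurable_completion)
    then show ?thesis by (simp add: mu_leb_def)
  qed
  have d: "?d \<in> borel_measurable borel" by measurable
  have B: "ball 0 1 \<inter> space mu_leb \<in> sets (mu_leb :: (complex^'n) measure)" by (simp add: mu_leb_def)
  have "(\<integral>\<^sup>+z. f z \<partial>mu_n) = (\<integral>\<^sup>+z. ?d z * f z \<partial>restrict_space mu_leb (ball 0 1))"
    unfolding mu_n_def by (rule nn_integral_density) (auto intro!: measurable_restrict_space1 bm f d)
  also have "\<dots> = (\<integral>\<^sup>+z. ?d z * f z * indicator (ball 0 1) z \<partial>mu_leb)"
    by (rule nn_integral_restrict_space[OF B])
  also have "\<dots> = ?c * (\<integral>\<^sup>+z. ?d z * f z * indicator (ball 0 1) z \<partial>lebesgue)"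
    unfolding mu_leb_def
  proof (rule nn_integral_scale_measure)
    have "(\<lambda>z. ?d z * f z * indicator (ball 0 1) z) \<in> borel_measurable borel"
      by (intro borel_measurable_times_ennreal borel_measurable_indicator d f) simp
    then show "(\<lambda>z. ?d z * f z * indicator (ball 0 1) z) \<in> borel_measurable lebesgue"
      by (simp add: measurable_completion)
  qed
  also have "\<dots> = ?c * (\<integral>\<^sup>+z. f z \<partial>muB)"
  proof -
    have "(\<integral>\<^sup>+z. ?d z * f z * indicator (ball 0 1) z \<partial>lborel) = (\<integral>\<^sup>+z. f z \<partial>muB)"
      unfolding nn_integral_muB[OF f] by (rule nn_integral_cong) (simp only: mult_ac)
    then show ?thesis by (simp only: nn_integral_completion)
  qed
  finally show ?thesis .
qed

lemma integral_muB_orthogonal: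
  fixes f :: "complex^'n \<Rightarrow> complex" and U :: "complex^'n \<Rightarrow> complex^'n"
  assumes U: "orthogonal_transformation U" and f [measurable]: "f \<in> borel_measurable borel"
  shows "(LINT z|muB. f (U z)) = (LINT z|muB. f z)"
proof -
  have Ub [measurable]: "U \<in> borel \<rightarrow>\<^sub>M borel" by (rule borel_measurable_orthogonal[OF U])
  have "distr muB muB U = muB"
  proof (rule measure_eqI)
    fix A assume "A \<in> sets (distr muB muB U)"
    then have A [measurable]: "A \<in> sets borel" by simp
    have iA: "indicator A \<in> borel_measurable borel" by measurable
    have iAU: "(\<lambda>z. indicator A (U z) :: ennreal) \<in> borel_measurable borel" by measurable
    let ?w = "\<lambda>z :: complex^'n. indicator (ball 0 1) z * ennreal (1 / (1 - (norm z)\<^sup>2) ^ (CARD('n) + 1))"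
    have "emeasure (distr muB muB U) A = (\<integral>\<^sup>+z. indicator A z \<partial>distr muB muB U)" by simp
    also have "\<dots> = (\<integral>\<^sup>+z. indicator A (U z) \<partial>muB)"
      by (rule nn_integral_distr) (simp_all add: measurable_cong_sets[OF sets_muB sets_muB] Ub)
    also have "\<dots> = (\<integral>\<^sup>+z. ?w z * indicator A (U z) \<partial>lborel)"
      by (rule nn_integral_muB[OF iAU])
    also have "\<dots> = (\<integral>\<^sup>+z. ?w (U z) * indicator A (U z) \<partial>lborel)"
      by (rule nn_integral_cong) (simp add: orthogonal_transformation_norm[OF U] indicator_def)
    also have "\<dots> = (\<integral>\<^sup>+z. ?w z * indicator A z \<partial>lborel)"
      by (rule nn_integral_lborel_orthogonal[OF U]) (intro borel_measurable_times_ennreal[OF muB_density_measurable iA])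
    also have "\<dots> = (\<integral>\<^sup>+z. indicator A z \<partial>muB)"
      by (rule nn_integral_muB[OF iA, symmetric])
    also have "\<dots> = emeasure muB A" by simp
    finally show "emeasure (distr muB muB U) A = emeasure muB A" .
  qed simp
  then have "(LINT z|muB. f z) = (LINT z|distr muB muB U. f z)" by simp
  also have "\<dots> = (LINT z|muB. f (U z))"
    by (rule integral_distr) (simp_all add: measurable_cong_sets[OF sets_muB sets_muB] Ub)
  finally show ?thesis ..
qed

lemma orthogonal_phase: "norm c = 1 \<Longrightarrow> orthogonal_transformation (\<lambda>z :: complex^'n. c *s z)"
  unfolding orthogonal_transformation
  by (auto intro!: linearI simp: norm_vector_smult vec_eq_iff algebra_simps)

lemma integral_phase_zero:
  fixes f :: "complex^'n \<Rightarrow> complex"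
  assumes f: "f \<in> borel_measurable borel" and c: "norm c = 1" and e: "\<And>z. f (c *s z) = d * f z" and d: "d \<noteq> 1"
  shows "(LINT z|muB. f z) = 0"
proof -
  have "(LINT z|muB. f z) = (LINT z|muB. f (c *s z))"
    by (rule integral_muB_orthogonal[OF orthogonal_phase[OF c] f, symmetric])
  also have "\<dots> = d * (LINT z|muB. f z)" unfolding e by simp
  finally show ?thesis using d by simp
qed

text \<open>The measure is invariant under multiplication by a phase, under which components with
  the same q but different p transform by different characters; hence they are orthogonal.\<close>

lemma nn_integral_phase_orthogonal:
  fixes f :: "nat \<Rightarrow> complex^'n \<Rightarrow> complex"
  assumes f [measurable]: "\<And>p. f p \<in> borel_measurable borel"
    and fin: "\<And>p. (\<integral>\<^sup>+z. ennreal ((norm (f p z))\<^sup>2) \<partial>muB) < \<infinity>"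
    and hom: "\<And>p c z. norm c = 1 \<Longrightarrow> f p (c *s z) = cnj c ^ p * c ^ q * f p z"
  shows "(\<integral>\<^sup>+z. ennreal ((norm (\<Sum>p<P. f p z))\<^sup>2) \<partial>muB) = (\<Sum>p<P. \<integral>\<^sup>+z. ennreal ((norm (f p z))\<^sup>2) \<partial>muB)"
proof -
  have i2: "integrable muB (\<lambda>z. (norm (f p z))\<^sup>2)" for p
    using fin[of p] by (intro integrableI_bounded) simp_all
  have ipp: "integrable muB (\<lambda>z. f p z * cnj (f p' z))" for p p'
  proof (rule Bochner_Integration.integrable_bound)
    show "integrable muB (\<lambda>z. (norm (f p z))\<^sup>2 + (norm (f p' z))\<^sup>2)" by (intro Bochner_Integration.integrable_add i2)
    have "(\<lambda>z. f p z * cnj (f p' z)) \<in> borel_measurable borel"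
      using measurable_compose[OF f borel_measurable_continuous_onI[OF continuous_on_cnj[OF continuous_on_id]]] by measurable
    then show "(\<lambda>z. f p z * cnj (f p' z)) \<in> borel_measurable muB" by simp
    show "AE z in muB. norm (f p z * cnj (f p' z)) \<le> norm ((norm (f p z))\<^sup>2 + (norm (f p' z))\<^sup>2)"
    proof (rule AE_I2)
      fix z
      have "0 \<le> (norm (f p z) - norm (f p' z))\<^sup>2" by simp
      then have "norm (f p z) * norm (f p' z) \<le> (norm (f p z))\<^sup>2 + (norm (f p' z))\<^sup>2"
        unfolding power2_diff using mult_nonneg_nonneg[OF norm_ge_zero norm_ge_zero, of "f p z" "f p' z"] by linarith
      then show "norm (f p z * cnj (f p' z)) \<le> norm ((norm (f p z))\<^sup>2 + (norm (f p' z))\<^sup>2)"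
        by (simp add: norm_mult)
    qed
  qed
  have off: "(LINT z|muB. f p z * cnj (f p' z)) = 0" if "p \<noteq> p'" for p p'
  proof -
    \<comment> \<open>The angle for which the product of the component p with the conjugate of the
      component p' changes sign.\<close>
    define t where "t = pi / (real p' - real p)"
    define c where "c = cis t"
    have c: "norm c = 1" by (simp add: c_def)
    have cc: "cnj c * c = 1" using complex_norm_square[of c] c by (simp add: mult.commute)
    have d: "cnj c ^ p * c ^ p' = -1"
    proof -
      have "cnj c ^ p * c ^ p' = cis (t * (real p' - real p))"
        unfolding c_def cis_cnj Complex.DeMoivre cis_mult by (simp add: algebra_simps)
      also have "t * (real p' - real p) = pi" using that by (simp add: t_def)
      finally show ?thesis by simp
    qed
    show ?thesis
    proof (rule integral_phase_zero[OF _ c, where d = "-1"])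
      show "(\<lambda>z. f p z * cnj (f p' z)) \<in> borel_measurable borel"
        using borel_measurable_integrable[OF ipp] by simp
      fix z
      have "f p (c *s z) * cnj (f p' (c *s z)) = (cnj c ^ p * c ^ p') * (c ^ q * cnj c ^ q) * (f p z * cnj (f p' z))"
        by (simp add: hom[OF c] mult_ac)
      also have "c ^ q * cnj c ^ q = 1" by (metis cc mult.commute power_mult_distrib power_one)
      finally show "f p (c *s z) * cnj (f p' (c *s z)) = -1 * (f p z * cnj (f p' z))" unfolding d by simp
    qed simp
  qed
  have expand: "complex_of_real ((norm (\<Sum>p<P. f p z))\<^sup>2) = (\<Sum>p<P. \<Sum>p'<P. f p z * cnj (f p' z))" for z
    unfolding complex_norm_square by (simp add: sum_product)
  have isum: "integrable muB (\<lambda>z. complex_of_real ((norm (\<Sum>p<P. f p z))\<^sup>2))"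
    unfolding expand by (intro Bochner_Integration.integrable_sum ipp)
  then have isum': "integrable muB (\<lambda>z. (norm (\<Sum>p<P. f p z))\<^sup>2)"
    by (simp only: complex_of_real_integrable_eq)
  have "complex_of_real (LINT z|muB. (norm (\<Sum>p<P. f p z))\<^sup>2) = (\<Sum>p<P. \<Sum>p'<P. LINT z|muB. f p z * cnj (f p' z))"
    unfolding integral_complex_of_real[symmetric] expand by (simp add: Bochner_Integration.integral_sum ipp Bochner_Integration.integrable_sum)
  also have "\<dots> = (\<Sum>p<P. \<Sum>p'<P. if p' = p then LINT z|muB. f p z * cnj (f p z) else 0)"
    by (intro sum.cong refl) (auto simp: off)
  also have "\<dots> = (\<Sum>p<P. LINT z|muB. f p z * cnj (f p z))" by simp
  also have "\<dots> = complex_of_real (\<Sum>p<P. LINT z|muB. (norm (f p z))\<^sup>2)"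
    unfolding of_real_sum integral_complex_of_real[symmetric] complex_norm_square ..
  finally have eq: "(LINT z|muB. (norm (\<Sum>p<P. f p z))\<^sup>2) = (\<Sum>p<P. LINT z|muB. (norm (f p z))\<^sup>2)"
    using of_real_eq_iff by blast
  have "(\<integral>\<^sup>+z. ennreal ((norm (\<Sum>p<P. f p z))\<^sup>2) \<partial>muB) = ennreal (LINT z|muB. (norm (\<Sum>p<P. f p z))\<^sup>2)"
    by (rule nn_integral_eq_integral[OF isum']) simp
  also have "\<dots> = (\<Sum>p<P. ennreal (LINT z|muB. (norm (f p z))\<^sup>2))"
    unfolding eq by (rule sum_ennreal[symmetric]) simp
  also have "\<dots> = (\<Sum>p<P. \<integral>\<^sup>+z. ennreal ((norm (f p z))\<^sup>2) \<partial>muB)"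
    by (intro sum.cong refl nn_integral_eq_integral[symmetric] i2) simp
  finally show ?thesis .
qed

lemma nn_integral_harmonic_lincomb:
  fixes h :: "nat \<Rightarrow> nat \<Rightarrow> nat \<Rightarrow> complex^'n \<Rightarrow> complex"
  assumes s: "rotation_invariant_sphere_measure \<sigma>" and h: "orthonormal_harmonics \<sigma> h"
    and s': "rotation_invariant_sphere_measure \<sigma>'"
  shows "(\<integral>\<^sup>+z. ennreal ((norm (\<Sum>j = 1..dim_H TYPE('n) p q. b j * h p q j z))\<^sup>2) \<partial>\<sigma>')
    = ennreal (\<Sum>j = 1..dim_H TYPE('n) p q. (norm (b j))\<^sup>2)"
proof -
  define J where "J = {1..dim_H TYPE('n) p q}"
  define H where "H z = (\<Sum>j\<in>J. b j * h p q j z)" for z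
  have fJ: "finite J" by (simp add: J_def)
  have ch: "cpoly (h p q j)" if "j \<in> J" for j
    using h that bipoly_cpoly unfolding orthonormal_harmonics_def J_def harmonic_polys_iff by blast
  have on: "(LINT z|\<sigma>'. h p q i z * cnj (h p q j z)) = (if i = j then 1 else 0)" if "i \<in> J" "j \<in> J" for i j
    using orthonormal_harmonics_transfer[OF s h s'] that unfolding J_def by blast
  have icnj: "integrable \<sigma>' (\<lambda>z. f z * cnj (g z))" if "cpoly f" "cpoly g" for f g :: "complex^'n \<Rightarrow> complex"
    by (rule integrable_sphere_measure[OF s']) (intro continuous_intros cpoly_continuous that)
  have expand: "complex_of_real ((norm (H z))\<^sup>2) = (\<Sum>i\<in>J. \<Sum>j\<in>J. b i * cnj (b j) * (h p q i z * cnj (h p q j z)))" for z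
    unfolding complex_norm_square H_def by (simp add: sum_product mult_ac)
  have int: "integrable \<sigma>' (\<lambda>z. complex_of_real ((norm (H z))\<^sup>2))"
    unfolding expand by (intro Bochner_Integration.integrable_sum integrable_mult_right icnj ch)
  then have int': "integrable \<sigma>' (\<lambda>z. (norm (H z))\<^sup>2)" by (simp only: complex_of_real_integrable_eq)
  have "complex_of_real (LINT z|\<sigma>'. (norm (H z))\<^sup>2) = (\<Sum>i\<in>J. \<Sum>j\<in>J. b i * cnj (b j) * (LINT z|\<sigma>'. h p q i z * cnj (h p q j z)))"
  proof -
    have "complex_of_real (LINT z|\<sigma>'. (norm (H z))\<^sup>2) = (\<Sum>i\<in>J. LINT z|\<sigma>'. (\<Sum>j\<in>J. b i * cnj (b j) * (h p q i z * cnj (h p q j z))))"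
      unfolding integral_complex_of_real[symmetric] expand
      by (rule Bochner_Integration.integral_sum) (intro Bochner_Integration.integrable_sum integrable_mult_right icnj ch)
    also have "\<dots> = (\<Sum>i\<in>J. \<Sum>j\<in>J. LINT z|\<sigma>'. b i * cnj (b j) * (h p q i z * cnj (h p q j z)))"
      by (intro sum.cong refl Bochner_Integration.integral_sum integrable_mult_right icnj ch)
    finally show ?thesis by simp
  qed
  also have "\<dots> = (\<Sum>i\<in>J. \<Sum>j\<in>J. if j = i then b i * cnj (b i) else 0)"
    by (intro sum.cong refl) (auto simp: on)
  also have "\<dots> = complex_of_real (\<Sum>i\<in>J. (norm (b i))\<^sup>2)"
    unfolding of_real_sum complex_norm_square using fJ by simp
  finally have "(LINT z|\<sigma>'. (norm (H z))\<^sup>2) = (\<Sum>i\<in>J. (norm (b i))\<^sup>2)"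
    using of_real_eq_iff by blast
  moreover have "(\<integral>\<^sup>+z. ennreal ((norm (H z))\<^sup>2) \<partial>\<sigma>') = ennreal (LINT z|\<sigma>'. (norm (H z))\<^sup>2)"
    by (rule nn_integral_eq_integral[OF int']) simp
  ultimately show ?thesis unfolding H_def J_def by simp
qed

lemma radial_part_measurable [measurable]: "radial_part TYPE('n::finite) \<nu> m p q \<in> borel_measurable borel"
  unfolding radial_part_def[abs_def] jacobi_poly_def by measurable

lemma poly_hyp_measurable [measurable]: "(\<lambda>x. poly (hyp \<beta> k b) (1 - x)) \<in> borel_measurable borel"
  unfolding poly_hyp by measurable

text \<open>Homogeneity separates |z| from the direction of z. The angular factor gives the sum of
  the |b j|^2 by orthonormality, transferred to the polar measure, and the radial factor is bounded
  uniformly in p and q by \<open>radial_norm_bound\<close>.\<close>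

lemma harmonic_component_bound:
  fixes h :: "nat \<Rightarrow> nat \<Rightarrow> nat \<Rightarrow> complex^'n \<Rightarrow> complex"
  assumes s: "rotation_invariant_sphere_measure \<sigma>" and h: "orthonormal_harmonics \<sigma> h"
    and \<beta>: "\<beta> = 2 * (\<nu> - real m) - real CARD('n)" "\<beta> > 0"
  shows "\<exists>K\<ge>0. \<forall>p q b. q \<le> m \<longrightarrow>
    (\<integral>\<^sup>+z. ennreal ((norm (of_real (radial_part TYPE('n) \<nu> m p q ((norm z)\<^sup>2)) * (\<Sum>j = 1..dim_H TYPE('n) p q. b j * h p q j z)))\<^sup>2) \<partial>muB)
      \<le> ennreal (K * (\<Sum>j = 1..dim_H TYPE('n) p q. (norm (b j))\<^sup>2))"
proof -
  let ?n = "CARD('n)"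
  define a where "a = \<beta> + real m + real ?n"
  obtain C where C: "C \<ge> 0" "\<And>p q. q \<le> m \<Longrightarrow> ennreal (kern_weight ?n \<beta> m p q) *
    (\<integral>\<^sup>+r. ennreal (r ^ (?n + p + q - 1) * (1 - r) powr (\<beta> - 1) * (poly (hyp \<beta> (m - q) (a + real p)) (1 - r))\<^sup>2) * indicator {0..1} r \<partial>lborel) \<le> ennreal C"
    using radial_norm_bound[of ?n \<beta> a m] \<beta>(2) a_def by auto
  define v where "v = measure lborel (ball (0 :: complex^'n) 1)"
  have vB: "emeasure lborel (ball (0 :: complex^'n) 1) = ennreal v"
    unfolding v_def using emeasure_lborel_ball_finite[of "0 :: complex^'n" 1] by (intro emeasure_eq_ennreal_measure) simp
  define c0 where "c0 = \<beta> / (real ?n * Gamma (\<beta> + 1))"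
  have c0: "c0 \<ge> 0" unfolding c0_def using \<beta>(2) by (intro divide_nonneg_nonneg mult_nonneg_nonneg less_imp_le[OF Gamma_real_pos]) auto
  define K where "K = v * (c0 * real ?n * C)"
  have K0: "K \<ge> 0" unfolding K_def v_def using c0 C(1) by simp
  have main: "(\<integral>\<^sup>+z. ennreal ((norm (of_real (radial_part TYPE('n) \<nu> m p q ((norm z)\<^sup>2)) * (\<Sum>j = 1..dim_H TYPE('n) p q. b j * h p q j z)))\<^sup>2) \<partial>muB)
      \<le> ennreal (K * (\<Sum>j = 1..dim_H TYPE('n) p q. (norm (b j))\<^sup>2))" if q: "q \<le> m" for p q b
  proof -
    define \<rho> where "\<rho> = radial_part TYPE('n) \<nu> m p q"
    have [measurable]: "\<rho> \<in> borel_measurable borel" by (simp add: \<rho>_def)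
    define H where "H z = (\<Sum>j = 1..dim_H TYPE('n) p q. b j * h p q j z)" for z
    define Sb where "Sb = (\<Sum>j = 1..dim_H TYPE('n) p q. (norm (b j))\<^sup>2)"
    have Sb0: "Sb \<ge> 0" by (simp add: Sb_def sum_nonneg)
    have Hb: "bipoly p q H" unfolding H_def[abs_def]
      using h by (intro bipoly_sum bipoly_cmult) (auto simp: orthonormal_harmonics_def harmonic_polys_iff)
    have Hm [measurable]: "H \<in> borel_measurable borel"
      by (intro borel_measurable_continuous_onI cpoly_continuous bipoly_cpoly[OF Hb])
    \<comment> \<open>The radial profile in t = |z|^2: the squared radial part, the power t^(p+q)
      from the homogeneity of |H|^2, and the density of \<open>muB\<close>.\<close>
    define w where "w t = ennreal ((\<rho> t)\<^sup>2 * t ^ (p + q) * (1 / (1 - t) ^ (?n + 1)))" for t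
    have [measurable]: "w \<in> borel_measurable borel" unfolding w_def[abs_def] by measurable
    \<comment> \<open>The same profile as a function of the radius, with the ball encoded by the
      interval so that \<open>polar_measure\<close> applies to the whole space.\<close>
    define W where "W x = w (x\<^sup>2) * indicator {-1<..<1} x" for x :: real
    have [measurable]: "W \<in> borel_measurable borel" unfolding W_def[abs_def] by measurable
    have iB: "indicator {-1<..<1} (norm z) = (indicator (ball 0 1) z :: ennreal)" for z :: "complex^'n"
      by (auto simp: indicator_def intro: less_le_trans[OF _ norm_ge_zero])
    define F where "F z = ennreal ((norm (H z))\<^sup>2)" for z
    have [measurable]: "F \<in> borel_measurable borel" unfolding F_def[abs_def] by measurable
    define c where "c = (\<integral>\<^sup>+z. W (norm z) \<partial>(lborel :: (complex^'n) measure))"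
    have cK: "c \<le> ennreal K"
    proof -
      have "c = (\<integral>\<^sup>+z. w ((norm z)\<^sup>2) * indicator (ball 0 1) z \<partial>(lborel :: (complex^'n) measure))"
        unfolding c_def W_def iB ..
      also have "\<dots> = ennreal v * (\<integral>\<^sup>+r. w r * ennreal (real ?n * r ^ (?n - 1)) * indicator {0..1} r \<partial>lborel)"
        unfolding vB[symmetric] by (rule radial_nn_integral) measurable
      also have "(\<integral>\<^sup>+r. w r * ennreal (real ?n * r ^ (?n - 1)) * indicator {0..1} r \<partial>lborel) =
        (\<integral>\<^sup>+r. ennreal (c0 * real ?n * kern_weight ?n \<beta> m p q) * (ennreal (r ^ (?n + p + q - 1) * (1 - r) powr (\<beta> - 1) * (poly (hyp \<beta> (m - q) (a + real p)) (1 - r))\<^sup>2) * indicator {0..1} r) \<partial>lborel)"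
      proof (rule nn_integral_cong_AE)
        show "AE r in lborel. w r * ennreal (real ?n * r ^ (?n - 1)) * indicator {0..1} r =
          ennreal (c0 * real ?n * kern_weight ?n \<beta> m p q) * (ennreal (r ^ (?n + p + q - 1) * (1 - r) powr (\<beta> - 1) * (poly (hyp \<beta> (m - q) (a + real p)) (1 - r))\<^sup>2) * indicator {0..1} r)"
          using AE_lborel_singleton[of "1 :: real"]
        proof eventually_elim
          fix r :: real assume r1: "r \<noteq> 1"
          show "w r * ennreal (real ?n * r ^ (?n - 1)) * indicator {0..1} r =
          ennreal (c0 * real ?n * kern_weight ?n \<beta> m p q) * (ennreal (r ^ (?n + p + q - 1) * (1 - r) powr (\<beta> - 1) * (poly (hyp \<beta> (m - q) (a + real p)) (1 - r))\<^sup>2) * indicator {0..1} r)"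
          proof (cases "r \<in> {0..1}")
            case True
            then have r: "0 \<le> r" "1 - r > 0" using r1 by auto
            define P where "P = poly (hyp \<beta> (m - q) (a + real p)) (1 - r)"
            have rho2: "(\<rho> r)\<^sup>2 = c0 * kern_weight ?n \<beta> m p q * P\<^sup>2 * ((1 - r) powr (\<nu> - real m) * (1 - r) powr (\<nu> - real m))"
              unfolding power2_eq_square \<rho>_def radial_part_mult[OF \<beta> a_def q] c0_def P_def ..
            \<comment> \<open>The exponents combine to 2(\<nu>-m) - (n+1) = \<beta> - 1, the
              exponent of the Beta integral.\<close>
            have pw: "(1 - r) powr (\<nu> - real m) * (1 - r) powr (\<nu> - real m) * (1 / (1 - r) ^ (?n + 1)) = (1 - r) powr (\<beta> - 1)"
            proof -
              have "(1 - r) ^ (?n + 1) = (1 - r) powr real (?n + 1)" using r by (simp only: powr_realpow)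
              then have "(1 - r) powr (\<nu> - real m) * (1 - r) powr (\<nu> - real m) * (1 / (1 - r) ^ (?n + 1)) = (1 - r) powr ((\<nu> - real m) + (\<nu> - real m) - real (?n + 1))"
                by (simp only: powr_add powr_diff) simp
              also have "(\<nu> - real m) + (\<nu> - real m) - real (?n + 1) = \<beta> - 1" by (simp add: \<beta>(1))
              finally show ?thesis .
            qed
            have rp: "r ^ (p + q) * r ^ (?n - 1) = r ^ (?n + p + q - 1)"
            proof -
              have "(p + q) + (?n - 1) = ?n + p + q - 1" by (simp add: Suc_leI)
              then show ?thesis by (simp only: power_add[symmetric])
            qed
            have kw: "kern_weight ?n \<beta> m p q \<ge> 0" by (rule kern_weight_nonneg[OF \<beta>(2)]) simp
            have "(\<rho> r)\<^sup>2 * r ^ (p + q) * (1 / (1 - r) ^ (?n + 1)) * (real ?n * r ^ (?n - 1)) =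
              (c0 * real ?n * kern_weight ?n \<beta> m p q) * ((r ^ (p + q) * r ^ (?n - 1)) * ((1 - r) powr (\<nu> - real m) * (1 - r) powr (\<nu> - real m) * (1 / (1 - r) ^ (?n + 1))) * P\<^sup>2)"
              unfolding rho2 by (simp only: mult_ac)
            also have "\<dots> = (c0 * real ?n * kern_weight ?n \<beta> m p q) * (r ^ (?n + p + q - 1) * (1 - r) powr (\<beta> - 1) * P\<^sup>2)"
              unfolding pw rp ..
            finally have e: "(\<rho> r)\<^sup>2 * r ^ (p + q) * (1 / (1 - r) ^ (?n + 1)) * (real ?n * r ^ (?n - 1)) =
              (c0 * real ?n * kern_weight ?n \<beta> m p q) * (r ^ (?n + p + q - 1) * (1 - r) powr (\<beta> - 1) * P\<^sup>2)" .
            have "w r * ennreal (real ?n * r ^ (?n - 1)) = ennreal ((\<rho> r)\<^sup>2 * r ^ (p + q) * (1 / (1 - r) ^ (?n + 1)) * (real ?n * r ^ (?n - 1)))"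
              unfolding w_def using r by (intro ennreal_mult[symmetric] mult_nonneg_nonneg) auto
            also have "\<dots> = ennreal (c0 * real ?n * kern_weight ?n \<beta> m p q) * ennreal (r ^ (?n + p + q - 1) * (1 - r) powr (\<beta> - 1) * P\<^sup>2)"
              unfolding e using r c0 kw by (intro ennreal_mult mult_nonneg_nonneg) auto
            finally show ?thesis using True by (simp add: P_def)
          qed simp
        qed
      qed
      also have "\<dots> = ennreal (c0 * real ?n * kern_weight ?n \<beta> m p q) * (\<integral>\<^sup>+r. ennreal (r ^ (?n + p + q - 1) * (1 - r) powr (\<beta> - 1) * (poly (hyp \<beta> (m - q) (a + real p)) (1 - r))\<^sup>2) * indicator {0..1} r \<partial>lborel)"
        by (rule nn_integral_cmult) measurable
      also have "\<dots> = ennreal (c0 * real ?n) * (ennreal (kern_weight ?n \<beta> m p q) * (\<integral>\<^sup>+r. ennreal (r ^ (?n + p + q - 1) * (1 - r) powr (\<beta> - 1) * (poly (hyp \<beta> (m - q) (a + real p)) (1 - r))\<^sup>2) * indicator {0..1} r \<partial>lborel))"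
        using c0 kern_weight_nonneg[OF \<beta>(2), of ?n m p q] by (simp add: ennreal_mult mult.assoc del: One_nat_def)
      also have "ennreal v * \<dots> \<le> ennreal v * (ennreal (c0 * real ?n) * ennreal C)"
        by (intro mult_left_mono C(2) q) simp_all
      also have "\<dots> = ennreal K"
        unfolding K_def using c0 C(1) by (simp add: v_def ennreal_mult mult.assoc)
      finally show ?thesis .
    qed
    have pt: "indicator (ball 0 1) z * ennreal (1 / (1 - (norm z)\<^sup>2) ^ (?n + 1)) * ennreal ((norm (of_real (\<rho> ((norm z)\<^sup>2)) * H z))\<^sup>2)
       = W (norm z) * F (sgn z)" for z :: "complex^'n"
    proof (cases "norm z < 1")
      case True
      have z: "z = of_real (norm z) *s sgn z"
      proof -
        have "of_real (norm z) * (inverse (norm z) *\<^sub>R z $ i) = z $ i" for i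
          by (cases "z = 0") (simp_all add: scaleR_conv_of_real)
        then show ?thesis by (simp add: vec_eq_iff sgn_div_norm)
      qed
      have "H z = of_real (norm z) ^ p * of_real (norm z) ^ q * H (sgn z)"
        using bipoly_homogeneous[OF Hb, of "of_real (norm z)" "sgn z"] z by simp
      then have nH: "(norm (H z))\<^sup>2 = ((norm z)\<^sup>2) ^ (p + q) * (norm (H (sgn z)))\<^sup>2"
        by (simp add: norm_mult norm_power power_mult_distrib power_add power_mult[symmetric] mult.commute)
      have pos: "1 / (1 - (norm z)\<^sup>2) ^ (?n + 1) \<ge> 0"
        using power_le_one[of "norm z" 2] True by simp
      have "ennreal (1 / (1 - (norm z)\<^sup>2) ^ (?n + 1)) * ennreal ((norm (of_real (\<rho> ((norm z)\<^sup>2)) * H z))\<^sup>2) =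
        ennreal ((1 / (1 - (norm z)\<^sup>2) ^ (?n + 1)) * (norm (of_real (\<rho> ((norm z)\<^sup>2)) * H z))\<^sup>2)"
        using pos by (intro ennreal_mult[symmetric]) auto
      also have "(1 / (1 - (norm z)\<^sup>2) ^ (?n + 1)) * (norm (of_real (\<rho> ((norm z)\<^sup>2)) * H z))\<^sup>2 =
        ((\<rho> ((norm z)\<^sup>2))\<^sup>2 * ((norm z)\<^sup>2) ^ (p + q) * (1 / (1 - (norm z)\<^sup>2) ^ (?n + 1))) * (norm (H (sgn z)))\<^sup>2"
        by (simp add: norm_mult power_mult_distrib nH)
      also have "ennreal \<dots> = w ((norm z)\<^sup>2) * F (sgn z)"
        unfolding w_def F_def using pos by (intro ennreal_mult mult_nonneg_nonneg) auto
      finally show ?thesis using True by (simp add: W_def indicator_def less_le_trans[OF _ norm_ge_zero])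
    qed (simp add: W_def indicator_def)
    have "(\<integral>\<^sup>+z. ennreal ((norm (of_real (\<rho> ((norm z)\<^sup>2)) * H z))\<^sup>2) \<partial>muB) = (\<integral>\<^sup>+z. W (norm z) * F (sgn z) \<partial>lborel)"
      by (subst nn_integral_muB) (measurable, simp only: pt)
    also have "\<dots> \<le> ennreal (K * Sb)"
    \<comment> \<open>\<open>polar_measure\<close> divides by c; for c = 0 the integrand vanishes
      almost everywhere.\<close>
    proof (cases "c = 0")
      case True
      have "AE z in (lborel :: (complex^'n) measure). W (norm z) = 0"
        using True unfolding c_def by (subst (asm) nn_integral_0_iff_AE) auto
      then have "(\<integral>\<^sup>+z. W (norm z) * F (sgn z) \<partial>(lborel :: (complex^'n) measure)) = (\<integral>\<^sup>+z. 0 \<partial>(lborel :: (complex^'n) measure))"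
        by (intro nn_integral_cong_AE) auto
      then show ?thesis by simp
    next
      case False
      have "c \<noteq> \<infinity>" using cK by (metis ennreal_less_top infinity_ennreal_def leD)
      from polar_measure[OF _ c_def False this] obtain \<sigma>' :: "(complex^'n) measure"
        where s': "rotation_invariant_sphere_measure \<sigma>'"
          and pol: "\<And>F. F \<in> borel_measurable borel \<Longrightarrow> (\<integral>\<^sup>+z. W (norm z) * F (sgn z) \<partial>lborel) = c * (\<integral>\<^sup>+z. F z \<partial>\<sigma>')"
        by auto
      have "(\<integral>\<^sup>+z. W (norm z) * F (sgn z) \<partial>lborel) = c * ennreal Sb"
        using pol[of F] nn_integral_harmonic_lincomb[OF s h s', where p = p and q = q and b = b] by (simp add: F_def H_def Sb_def)
      also have "\<dots> \<le> ennreal K * ennreal Sb" by (intro mult_right_mono cK) simp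
      also have "\<dots> = ennreal (K * Sb)" using K0 Sb0 by (simp add: ennreal_mult)
      finally show ?thesis .
    qed
    finally show ?thesis unfolding \<rho>_def H_def Sb_def .
  qed
  show ?thesis using K0 main by blast
qed

text \<open>Different p are orthogonal for each fixed q, and the m + 1 values of q are combined by
  Cauchy-Schwarz, which costs a factor m + 1. The bound does not depend on P, so it passes to the
  limit by Fatou's lemma.\<close>

lemma coherent_bessel:
  fixes h :: "nat \<Rightarrow> nat \<Rightarrow> nat \<Rightarrow> complex^'n \<Rightarrow> complex"
  assumes s: "rotation_invariant_sphere_measure \<sigma>" and h: "orthonormal_harmonics \<sigma> h"
    and \<beta>: "\<beta> = 2 * (\<nu> - real m) - real CARD('n)" "\<beta> > 0"
  shows "\<exists>K\<ge>0. \<forall>P b. (\<integral>\<^sup>+z. ennreal ((norm (\<Sum>p<P. \<Sum>q\<le>m. \<Sum>j = 1..dim_H TYPE('n) p q. cnj (Phi h \<nu> m p q j z) * b p q j))\<^sup>2) \<partial>muB)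
      \<le> ennreal (K * (\<Sum>p<P. \<Sum>q\<le>m. \<Sum>j = 1..dim_H TYPE('n) p q. (norm (b p q j))\<^sup>2))"
proof -
  obtain K where K: "K \<ge> 0" "\<And>p q b. q \<le> m \<Longrightarrow>
    (\<integral>\<^sup>+z. ennreal ((norm (of_real (radial_part TYPE('n) \<nu> m p q ((norm z)\<^sup>2)) * (\<Sum>j = 1..dim_H TYPE('n) p q. b j * h p q j z)))\<^sup>2) \<partial>muB)
      \<le> ennreal (K * (\<Sum>j = 1..dim_H TYPE('n) p q. (norm (b j))\<^sup>2))"
    using harmonic_component_bound[OF s h \<beta>] by blast
  have main: "(\<integral>\<^sup>+z. ennreal ((norm (\<Sum>p<P. \<Sum>q\<le>m. \<Sum>j = 1..dim_H TYPE('n) p q. cnj (Phi h \<nu> m p q j z) * b p q j))\<^sup>2) \<partial>muB)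
      \<le> ennreal ((real m + 1) * K * (\<Sum>p<P. \<Sum>q\<le>m. \<Sum>j = 1..dim_H TYPE('n) p q. (norm (b p q j))\<^sup>2))" for P b
  proof -
    define B where "B p q = (\<Sum>j = 1..dim_H TYPE('n) p q. (norm (b p q j))\<^sup>2)" for p q
    have B0: "B p q \<ge> 0" for p q by (simp add: B_def sum_nonneg)
    define f where "f q p z = (\<Sum>j = 1..dim_H TYPE('n) p q. cnj (Phi h \<nu> m p q j z) * b p q j)" for q p z
    have f: "f q p z = cnj (of_real (radial_part TYPE('n) \<nu> m p q ((norm z)\<^sup>2)) * (\<Sum>j = 1..dim_H TYPE('n) p q. cnj (b p q j) * h p q j z))" for q p z
      by (simp add: f_def Phi_radial_part sum_distrib_left mult_ac)
    have hb: "bipoly p q (\<lambda>z. \<Sum>j = 1..dim_H TYPE('n) p q. cnj (b p q j) * h p q j z)" for p q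
      using h by (intro bipoly_sum bipoly_cmult) (auto simp: orthonormal_harmonics_def harmonic_polys_iff)
    have fm [measurable]: "f q p \<in> borel_measurable borel" for q p
    proof -
      have "(\<lambda>z. \<Sum>j = 1..dim_H TYPE('n) p q. cnj (b p q j) * h p q j z) \<in> borel_measurable borel"
        by (intro borel_measurable_continuous_onI cpoly_continuous bipoly_cpoly[OF hb])
      then have "(\<lambda>z. of_real (radial_part TYPE('n) \<nu> m p q ((norm z)\<^sup>2)) * (\<Sum>j = 1..dim_H TYPE('n) p q. cnj (b p q j) * h p q j z)) \<in> borel_measurable borel"
        by measurable
      from measurable_compose[OF this borel_measurable_continuous_onI[OF continuous_on_cnj[OF continuous_on_id]]]
      show ?thesis unfolding f[abs_def] .
    qed
    have fb: "(\<integral>\<^sup>+z. ennreal ((norm (f q p z))\<^sup>2) \<partial>muB) \<le> ennreal (K * B p q)" if "q \<le> m" for q p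
      using K(2)[OF that, of p "\<lambda>j. cnj (b p q j)"] unfolding f B_def by (simp only: complex_mod_cnj)
    have hom: "f q p (c *s z) = cnj c ^ p * c ^ q * f q p z" if c: "norm c = 1" for c z q p
      unfolding f bipoly_homogeneous[OF hb] norm_vector_smult c by simp
    have orth: "(\<integral>\<^sup>+z. ennreal ((norm (\<Sum>p<P. f q p z))\<^sup>2) \<partial>muB) = (\<Sum>p<P. \<integral>\<^sup>+z. ennreal ((norm (f q p z))\<^sup>2) \<partial>muB)" if "q \<le> m" for q
    proof (rule nn_integral_phase_orthogonal[where q = q])
      show "(\<integral>\<^sup>+z. ennreal ((norm (f q p z))\<^sup>2) \<partial>muB) < \<infinity>" for p
        using fb[OF that, of p] ennreal_less_top order_le_less_trans by (metis infinity_ennreal_def)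
    qed (use fm hom in auto)
    have pt: "ennreal ((norm (\<Sum>p<P. \<Sum>q\<le>m. f q p z))\<^sup>2) \<le> (\<Sum>q\<le>m. ennreal (real m + 1) * ennreal ((norm (\<Sum>p<P. f q p z))\<^sup>2))" for z
    proof -
      have "norm (\<Sum>p<P. \<Sum>q\<le>m. f q p z) \<le> (\<Sum>q\<le>m. norm (\<Sum>p<P. f q p z))"
        by (subst sum.swap) (rule norm_sum)
      then have "(norm (\<Sum>p<P. \<Sum>q\<le>m. f q p z))\<^sup>2 \<le> (\<Sum>q\<le>m. norm (\<Sum>p<P. f q p z))\<^sup>2"
        by (rule power_mono) simp
      also have "\<dots> \<le> (\<Sum>q\<le>m. (norm (\<Sum>p<P. f q p z))\<^sup>2) * real (card {..m})"
        by (rule sum_squared_le_sum_of_squares)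
      also have "\<dots> = (\<Sum>q\<le>m. (real m + 1) * (norm (\<Sum>p<P. f q p z))\<^sup>2)"
        by (simp add: sum_distrib_left mult.commute add.commute)
      finally have "ennreal ((norm (\<Sum>p<P. \<Sum>q\<le>m. f q p z))\<^sup>2) \<le> ennreal (\<Sum>q\<le>m. (real m + 1) * (norm (\<Sum>p<P. f q p z))\<^sup>2)"
        by (rule ennreal_leI)
      also have "\<dots> = (\<Sum>q\<le>m. ennreal (real m + 1) * ennreal ((norm (\<Sum>p<P. f q p z))\<^sup>2))"
        by (subst sum_ennreal[symmetric]) (auto simp: ennreal_mult)
      finally show ?thesis .
    qed
    have m1: "(\<lambda>z. ennreal ((norm (\<Sum>p<P. f q p z))\<^sup>2)) \<in> borel_measurable muB" for q by simp
    have "(\<integral>\<^sup>+z. ennreal ((norm (\<Sum>p<P. \<Sum>q\<le>m. f q p z))\<^sup>2) \<partial>muB) \<le> (\<integral>\<^sup>+z. (\<Sum>q\<le>m. ennreal (real m + 1) * ennreal ((norm (\<Sum>p<P. f q p z))\<^sup>2)) \<partial>muB)"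
      by (rule nn_integral_mono) (rule pt)
    also have "\<dots> = (\<Sum>q\<le>m. ennreal (real m + 1) * (\<integral>\<^sup>+z. ennreal ((norm (\<Sum>p<P. f q p z))\<^sup>2) \<partial>muB))"
      by (subst nn_integral_sum) (auto intro!: sum.cong nn_integral_cmult m1 borel_measurable_times_ennreal)
    also have "\<dots> = (\<Sum>q\<le>m. ennreal (real m + 1) * (\<Sum>p<P. \<integral>\<^sup>+z. ennreal ((norm (f q p z))\<^sup>2) \<partial>muB))"
      by (intro sum.cong refl) (simp add: orth)
    also have "\<dots> \<le> (\<Sum>q\<le>m. ennreal (real m + 1) * (\<Sum>p<P. ennreal (K * B p q)))"
      by (intro sum_mono mult_left_mono fb) auto
    also have "\<dots> = ennreal (\<Sum>q\<le>m. (real m + 1) * (\<Sum>p<P. K * B p q))"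
    proof -
      have "(\<Sum>p<P. ennreal (K * B p q)) = ennreal (\<Sum>p<P. K * B p q)" for q
        by (rule sum_ennreal) (simp add: K(1) B0)
      then have "(\<Sum>q\<le>m. ennreal (real m + 1) * (\<Sum>p<P. ennreal (K * B p q))) = (\<Sum>q\<le>m. ennreal ((real m + 1) * (\<Sum>p<P. K * B p q)))"
        by (simp add: ennreal_mult sum_nonneg K(1) B0)
      also have "\<dots> = ennreal (\<Sum>q\<le>m. (real m + 1) * (\<Sum>p<P. K * B p q))"
        by (rule sum_ennreal) (simp add: sum_nonneg K(1) B0)
      finally show ?thesis .
    qed
    also have "(\<Sum>q\<le>m. (real m + 1) * (\<Sum>p<P. K * B p q)) = (real m + 1) * K * (\<Sum>p<P. \<Sum>q\<le>m. B p q)"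
      unfolding sum_distrib_left by (subst sum.swap) (simp add: mult_ac)
    finally show ?thesis unfolding f_def B_def .
  qed
  show ?thesis using main K(1) by (intro exI[of _ "(real m + 1) * K"]) auto
qed

subsection \<open>The reproducing kernel and the expectation value\<close>

lemma hprod_bound: "norm (hprod z w) \<le> norm z * norm (w :: complex^'n)"
proof -
  have "norm (hprod z w) \<le> (\<Sum>j\<in>UNIV. \<bar>norm (z $ j)\<bar> * \<bar>norm (w $ j)\<bar>)"
    unfolding hprod_def by (rule order_trans[OF norm_sum]) (simp add: norm_mult)
  also have "\<dots> \<le> L2_set (\<lambda>j. norm (z $ j)) UNIV * L2_set (\<lambda>j. norm (w $ j)) UNIV"
    by (rule L2_set_mult_ineq)
  finally show ?thesis by (simp add: norm_vec_def)
qed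

lemma hprod_self: "hprod z z = of_real ((norm z)\<^sup>2)"
  unfolding norm_sq_sum hprod_def ..

text \<open>The third part puts the quotient in \<open>bergman_dist\<close> at or above 1: after
  |1-s| \<ge> 1 - |z||w| the difference of the two sides is the square (|z|-|w|)^2.\<close>

lemma ball_ineq:
  assumes z: "norm (z :: complex^'n) < 1" and w: "norm w < 1"
  shows "norm (hprod z w) < 1" "1 - hprod z w \<noteq> 0"
    "(1 - (norm z)\<^sup>2) * (1 - (norm w)\<^sup>2) \<le> (cmod (1 - hprod z w))\<^sup>2"
    "(1 - (norm z)\<^sup>2) * (1 - (norm w)\<^sup>2) > 0"
proof -
  have zw: "norm z * norm w < 1" using mult_left_le[of "norm w" "norm z"] z w by simp
  show "norm (hprod z w) < 1" using hprod_bound[of z w] zw by linarith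
  then show "1 - hprod z w \<noteq> 0" by (metis less_irrefl norm_one right_minus_eq)
  have "1 - norm z * norm w \<le> cmod (1 - hprod z w)"
    using norm_triangle_ineq2[of 1 "hprod z w"] hprod_bound[of z w] by simp
  then have "(1 - norm z * norm w)\<^sup>2 \<le> (cmod (1 - hprod z w))\<^sup>2"
    using zw by (intro power_mono) auto
  moreover have "(1 - norm z * norm w)\<^sup>2 - (1 - (norm z)\<^sup>2) * (1 - (norm w)\<^sup>2) = (norm z - norm w)\<^sup>2"
    by (simp add: power2_eq_square algebra_simps)
  ultimately show "(1 - (norm z)\<^sup>2) * (1 - (norm w)\<^sup>2) \<le> (cmod (1 - hprod z w))\<^sup>2"
    using zero_le_power2[of "norm z - norm w"] by linarith
  have "(norm z)\<^sup>2 < 1" "(norm w)\<^sup>2 < 1" using z w by (simp_all add: power_less_one_iff)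
  then show "(1 - (norm z)\<^sup>2) * (1 - (norm w)\<^sup>2) > 0" by simp
qed

text \<open>The definite description is resolved by arcosh of the square root, and then tanh^2 = 1 -
  1/cosh^2.\<close>

lemma tanh_bergman_dist:
  assumes z: "norm (z :: complex^'n) < 1" and w: "norm w < 1"
  shows "(tanh (bergman_dist z w))\<^sup>2 = 1 - (1 - (norm z)\<^sup>2) * (1 - (norm w)\<^sup>2) / (cmod (1 - hprod z w))\<^sup>2"
proof -
  define y where "y = (cmod (1 - hprod z w))\<^sup>2 / ((1 - (norm z)\<^sup>2) * (1 - (norm w)\<^sup>2))"
  have y: "y \<ge> 1" unfolding y_def using ball_ineq(3,4)[OF z w] by simp
  define d0 where "d0 = arcosh (sqrt y)"
  have d0: "d0 \<ge> 0" "cosh d0 = sqrt y" unfolding d0_def using y by (auto simp: arcosh_nonneg_real)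
  have "bergman_dist z w = d0"
    unfolding bergman_dist_def y_def[symmetric]
  proof (rule the_equality)
    show "0 \<le> d0 \<and> (cosh d0)\<^sup>2 = y" using d0 y by simp
    fix d assume d: "0 \<le> d \<and> (cosh d)\<^sup>2 = y"
    then have "cosh d = sqrt y" using cosh_real_nonneg[of d] by (metis real_sqrt_unique)
    then show "d = d0" using d d0 by (metis arcosh_cosh_real)
  qed
  then have c: "(cosh (bergman_dist z w))\<^sup>2 = y" using d0 y by simp
  have "(tanh (bergman_dist z w))\<^sup>2 = (sinh (bergman_dist z w))\<^sup>2 / (cosh (bergman_dist z w))\<^sup>2"
    by (simp add: tanh_def power_divide)
  also have "\<dots> = (y - 1) / y"
    using cosh_square_eq[of "bergman_dist z w"] c by simp
  also have "\<dots> = 1 - 1 / y" using y by (simp add: diff_divide_distrib)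
  finally show ?thesis by (simp add: y_def)
qed

lemma cmod_powr_of_real: "w \<noteq> 0 \<Longrightarrow> cmod (w powr of_real x) = cmod w powr x"
  by (simp add: powr_def)

text \<open>The closed form of the kernel K(z,w). It keeps the phase of the powers of 1 - s and its
  conjugate; only its modulus is a function of x = XY/|1-s|^2.\<close>

definition berg_kernel :: "real \<Rightarrow> nat \<Rightarrow> complex^'n \<Rightarrow> complex^'n \<Rightarrow> complex" where
  "berg_kernel \<nu> m z w = (let \<beta> = 2 * (\<nu> - real m) - real CARD('n); a = \<beta> + real m + real CARD('n);
      X = 1 - (norm z)\<^sup>2; Y = 1 - (norm w)\<^sup>2; s = hprod z w in
     of_real (\<beta> / (real CARD('n) * Gamma (\<beta> + 1)) * (X powr (\<nu> - real m) * Y powr (\<nu> - real m)))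
       * (\<Sum>j\<le>m. of_real (kern_coeff CARD('n) \<beta> m j * (X * Y) ^ j) * (1 - s) powr (- of_real (a + real j)) * (1 - cnj s) ^ (m - j)))"

lemma berg_kernel_sums:
  fixes h :: "nat \<Rightarrow> nat \<Rightarrow> nat \<Rightarrow> complex^'n \<Rightarrow> complex"
  assumes s: "rotation_invariant_sphere_measure \<sigma>" and h: "orthonormal_harmonics \<sigma> h"
    and m: "real m < \<nu> - real CARD('n) / 2" and z: "norm z < 1" and w: "norm w < 1"
  shows "(\<lambda>p. \<Sum>q\<le>m. \<Sum>j = 1..dim_H TYPE('n) p q. Phi h \<nu> m p q j z * cnj (Phi h \<nu> m p q j w)) sums berg_kernel \<nu> m z w"
proof -
  define \<beta> where "\<beta> = 2 * (\<nu> - real m) - real CARD('n)"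
  define a where "a = \<beta> + real m + real CARD('n)"
  have \<beta>: "\<beta> > 0" using m by (simp add: \<beta>_def)
  define X where "X = 1 - (norm z)\<^sup>2"
  define Y where "Y = 1 - (norm w)\<^sup>2"
  define c where "c = \<beta> / (real CARD('n) * Gamma (\<beta> + 1)) * (X powr (\<nu> - real m) * Y powr (\<nu> - real m))"
  have "(\<lambda>p. of_real c * (\<Sum>q\<le>m. of_real (kern_weight CARD('n) \<beta> m p q * poly (hyp \<beta> (m - q) (a + real p)) X * poly (hyp \<beta> (m - q) (a + real p)) Y)
      * zonal CARD('n) p q (hprod z w) ((1 - X) * (1 - Y)))) sums
    (of_real c * (\<Sum>j\<le>m. of_real (kern_coeff CARD('n) \<beta> m j * (X * Y) ^ j) * (1 - hprod z w) powr (- of_real (a + real j)) * (1 - cnj (hprod z w)) ^ (m - j)))"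
    by (intro sums_mult kernel_sums) (simp_all add: \<beta> a_def ball_ineq(1)[OF z w])
  moreover have "of_real c * (\<Sum>j\<le>m. of_real (kern_coeff CARD('n) \<beta> m j * (X * Y) ^ j) * (1 - hprod z w) powr (- of_real (a + real j)) * (1 - cnj (hprod z w)) ^ (m - j)) = berg_kernel \<nu> m z w"
    unfolding berg_kernel_def Let_def \<beta>_def[symmetric] unfolding a_def[symmetric] X_def[symmetric] Y_def[symmetric] c_def[symmetric] ..
  moreover have "of_real c * (\<Sum>q\<le>m. of_real (kern_weight CARD('n) \<beta> m p q * poly (hyp \<beta> (m - q) (a + real p)) X * poly (hyp \<beta> (m - q) (a + real p)) Y)
      * zonal CARD('n) p q (hprod z w) ((1 - X) * (1 - Y))) = (\<Sum>q\<le>m. \<Sum>j = 1..dim_H TYPE('n) p q. Phi h \<nu> m p q j z * cnj (Phi h \<nu> m p q j w))" for p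
    unfolding sum_distrib_left
  proof (rule sum.cong[OF refl])
    fix q assume "q \<in> {..m}"
    then have q: "q \<le> m" by simp
    have "(\<Sum>j = 1..dim_H TYPE('n) p q. Phi h \<nu> m p q j z * cnj (Phi h \<nu> m p q j w)) =
      of_real (radial_part TYPE('n) \<nu> m p q ((norm z)\<^sup>2) * radial_part TYPE('n) \<nu> m p q ((norm w)\<^sup>2)) * (\<Sum>j = 1..dim_H TYPE('n) p q. h p q j z * cnj (h p q j w))"
      by (simp add: Phi_radial_part sum_distrib_left mult_ac)
    also have "(\<Sum>j = 1..dim_H TYPE('n) p q. h p q j z * cnj (h p q j w)) = zonal CARD('n) p q (hprod z w) ((1 - X) * (1 - Y))"
      unfolding addition_formula[OF s h] zonal_fun_def by (simp add: X_def Y_def)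
    also have "radial_part TYPE('n) \<nu> m p q ((norm z)\<^sup>2) * radial_part TYPE('n) \<nu> m p q ((norm w)\<^sup>2) =
      c * (kern_weight CARD('n) \<beta> m p q * poly (hyp \<beta> (m - q) (a + real p)) X * poly (hyp \<beta> (m - q) (a + real p)) Y)"
      unfolding radial_part_mult[OF \<beta>_def \<beta> a_def q] c_def X_def Y_def by (simp only: mult_ac)
    finally show "of_real c * (of_real (kern_weight CARD('n) \<beta> m p q * poly (hyp \<beta> (m - q) (a + real p)) X * poly (hyp \<beta> (m - q) (a + real p)) Y)
      * zonal CARD('n) p q (hprod z w) ((1 - X) * (1 - Y))) = (\<Sum>j = 1..dim_H TYPE('n) p q. Phi h \<nu> m p q j z * cnj (Phi h \<nu> m p q j w))"
      by (simp only: of_real_mult mult.assoc)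
  qed
  ultimately show ?thesis by simp
qed

text \<open>The factor c in |K| = c x^(\<nu>-m) |P_m(2x-1)|, with the Gamma values in the form that
  the theorem uses.\<close>

definition berg_const :: "'n::finite itself \<Rightarrow> real \<Rightarrow> nat \<Rightarrow> real" where
  "berg_const _ \<nu> m = (2 * (\<nu> - real m) - real CARD('n)) * Gamma (2 * \<nu> - real m)
     / (fact CARD('n) * Gamma (2 * \<nu> - real m - real CARD('n) + 1))"

lemma berg_const_pos: "real m < \<nu> - real CARD('n) / 2 \<Longrightarrow> berg_const TYPE('n::finite) \<nu> m > 0"
proof -
  assume m: "real m < \<nu> - real CARD('n) / 2"
  have n0: "real CARD('n) > 0" by simp
  have p: "2 * \<nu> - real m > 0" "2 * \<nu> - real m - real CARD('n) + 1 > 0" "2 * (\<nu> - real m) - real CARD('n) > 0"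
  proof -
    show c: "2 * (\<nu> - real m) - real CARD('n) > 0" using m by simp
    then show "2 * \<nu> - real m > 0" "2 * \<nu> - real m - real CARD('n) + 1 > 0"
      using n0 of_nat_0_le_iff[of m, where 'a = real] by simp_all
  qed
  show ?thesis unfolding berg_const_def
    by (intro divide_pos_pos mult_pos_pos Gamma_real_pos p) simp
qed

text \<open>Taking out (1-s)^(-a) (1-cnj s)^m leaves a real polynomial in x, which
  \<open>jacobi_poly_hyp\<close> identifies with the Jacobi polynomial.\<close>

lemma cmod_berg_kernel:
  fixes z w :: "complex^'n"
  assumes m: "real m < \<nu> - real CARD('n) / 2" and z: "norm z < 1" and w: "norm w < 1"
  defines "\<beta> \<equiv> 2 * (\<nu> - real m) - real CARD('n)"
    and "x \<equiv> (1 - (norm z)\<^sup>2) * (1 - (norm w)\<^sup>2) / (cmod (1 - hprod z w))\<^sup>2"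
  shows "(cmod (berg_kernel \<nu> m z w))\<^sup>2 = (berg_const TYPE('n) \<nu> m)\<^sup>2 * x powr (2 * (\<nu> - real m))
     * (jacobi_poly m (real CARD('n) - 1) \<beta> (1 - 2 * (1 - x)))\<^sup>2"
proof -
  let ?n = "CARD('n)"
  define a where "a = \<beta> + real m + real ?n"
  have \<beta>: "\<beta> > 0" using m by (simp add: \<beta>_def)
  define X Y s where "X = 1 - (norm z)\<^sup>2" and "Y = 1 - (norm w)\<^sup>2" and "s = hprod z w"
  define t where "t = cmod (1 - s)"
  have s0: "1 - s \<noteq> 0" unfolding s_def by (rule ball_ineq(2)[OF z w])
  have s0': "1 - cnj s \<noteq> 0" using s0 by (metis complex_cnj_cancel_iff complex_cnj_diff complex_cnj_one complex_cnj_zero)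
  have t: "t > 0" using s0 by (simp add: t_def)
  have X: "X > 0" "Y > 0" using z w by (simp_all add: X_def Y_def power_less_one_iff)
  have xt: "x = X * Y / t\<^sup>2" by (simp add: x_def X_def Y_def t_def s_def)
  have xpos: "x > 0" unfolding xt using X t by simp
  have tt: "complex_of_real (t\<^sup>2) = (1 - s) * (1 - cnj s)"
    unfolding t_def complex_norm_square by simp
  define S where "S = (\<Sum>j\<le>m. kern_coeff ?n \<beta> m j * x ^ j)"
  \<comment> \<open>The term j has the additional factor (1-s)^(-j) (1-cnj s)^(-j) = |1-s|^(-2j),
    which makes (XY)^j into x^j.\<close>
  have trm: "of_real (kern_coeff ?n \<beta> m j * (X * Y) ^ j) * (1 - s) powr (- of_real (a + real j)) * (1 - cnj s) ^ (m - j)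
     = (1 - s) powr (- of_real a) * (1 - cnj s) ^ m * of_real (kern_coeff ?n \<beta> m j * x ^ j)" if j: "j \<le> m" for j
  proof -
    have "- of_real (a + real j) = - of_real a - (of_nat j :: complex)" by simp
    then have p1: "(1 - s) powr (- of_real (a + real j)) = (1 - s) powr (- of_real a) / (1 - s) ^ j"
      using s0 by (simp only: powr_diff powr_nat) simp
    have p2: "(1 - cnj s) ^ (m - j) = (1 - cnj s) ^ m / (1 - cnj s) ^ j"
      using s0' j by (simp add: power_diff)
    have "complex_of_real (x ^ j) = of_real ((X * Y) ^ j) / ((1 - s) * (1 - cnj s)) ^ j"
      unfolding xt power_divide of_real_divide of_real_power tt[symmetric] by simp
    then have p3: "complex_of_real (x ^ j) = of_real ((X * Y) ^ j) / ((1 - s) ^ j * (1 - cnj s) ^ j)"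
      by (simp add: power_mult_distrib)
    show ?thesis unfolding p1 p2 of_real_mult[of _ "x ^ j"] p3 by (simp add: mult_ac)
  qed
  have K: "berg_kernel \<nu> m z w = of_real (\<beta> / (real ?n * Gamma (\<beta> + 1)) * (X powr (\<nu> - real m) * Y powr (\<nu> - real m)))
      * ((1 - s) powr (- of_real a) * (1 - cnj s) ^ m * of_real S)"
  proof -
    have "(\<Sum>j\<le>m. of_real (kern_coeff ?n \<beta> m j * (X * Y) ^ j) * (1 - s) powr (- of_real (a + real j)) * (1 - cnj s) ^ (m - j))
      = (\<Sum>j\<le>m. (1 - s) powr (- of_real a) * (1 - cnj s) ^ m * of_real (kern_coeff ?n \<beta> m j * x ^ j))"
      by (rule sum.cong) (simp_all only: trm atMost_iff)
    also have "\<dots> = (1 - s) powr (- of_real a) * (1 - cnj s) ^ m * of_real S"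
      unfolding S_def of_real_sum sum_distrib_left ..
    finally show ?thesis
      unfolding berg_kernel_def Let_def \<beta>_def[symmetric] unfolding a_def[symmetric] X_def[symmetric] Y_def[symmetric] s_def[symmetric] by (simp only:)
  qed
  have e1: "cmod ((1 - s) powr (- of_real a)) = t powr (- a)"
    using cmod_powr_of_real[OF s0, of "- a"] by (simp add: t_def)
  have e2: "cmod ((1 - cnj s) ^ m) = t powr real m"
  proof -
    have "cmod (1 - cnj s) = t" unfolding t_def by (metis complex_cnj_diff complex_cnj_one complex_mod_cnj)
    then show ?thesis using t by (simp add: norm_power powr_realpow)
  qed
  define c where "c = \<beta> / (real ?n * Gamma (\<beta> + 1))"
  have c: "c > 0" unfolding c_def using \<beta> by (intro divide_pos_pos mult_pos_pos Gamma_real_pos) auto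
  have XY: "X powr (\<nu> - real m) * Y powr (\<nu> - real m) * (t powr (- a) * t powr real m) = x powr (\<nu> - real m)"
  proof -
    \<comment> \<open>Since a = 2(\<nu>-m) + m, the moduli combine to |1-s|^(-2(\<nu>-m)), just what
      turns (XY)^(\<nu>-m) into x^(\<nu>-m).\<close>
    have "t powr (- a) * t powr real m = t powr (- (2 * (\<nu> - real m)))"
      unfolding powr_add[symmetric] by (simp add: a_def \<beta>_def algebra_simps)
    also have "\<dots> = 1 / t powr (2 * (\<nu> - real m))" by (rule powr_minus_divide)
    also have "t powr (2 * (\<nu> - real m)) = (t powr 2) powr (\<nu> - real m)" by (rule powr_powr[symmetric])
    also have "t powr 2 = t\<^sup>2" using t by simp
    finally show ?thesis unfolding xt using X t by (simp add: powr_mult powr_divide)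
  qed
  have "cmod (berg_kernel \<nu> m z w) = c * (X powr (\<nu> - real m) * Y powr (\<nu> - real m)) * (t powr (- a) * t powr real m * \<bar>S\<bar>)"
    unfolding K norm_mult e1 e2 norm_of_real c_def[symmetric] using c X by (simp add: abs_mult)
  also have "\<dots> = c * \<bar>S\<bar> * (X powr (\<nu> - real m) * Y powr (\<nu> - real m) * (t powr (- a) * t powr real m))"
    by (simp only: mult_ac)
  finally have cm: "cmod (berg_kernel \<nu> m z w) = c * \<bar>S\<bar> * x powr (\<nu> - real m)" unfolding XY .
  have n1: "1 \<le> ?n" by (simp add: Suc_leI)
  have SJ: "c * \<bar>S\<bar> = berg_const TYPE('n) \<nu> m * \<bar>jacobi_poly m (real ?n - 1) \<beta> (1 - 2 * (1 - x))\<bar>"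
  proof -
    define P where "P = poly (hyp \<beta> m a) x"
    have S: "S = (-1) ^ m * Gamma a / (fact (?n - 1) * fact m) * P"
      unfolding S_def P_def poly_hyp kern_coeff_def a_def sum_distrib_left by (simp add: mult_ac)
    have "real m + (real ?n - 1) + \<beta> + 1 = a" by (simp add: a_def)
    moreover have "\<beta> > -1" using \<beta> by simp
    ultimately have J: "jacobi_poly m (real ?n - 1) \<beta> (1 - 2 * (1 - x)) = (-1) ^ m * pochhammer (\<beta> + 1) m / fact m * P"
      using jacobi_poly_hyp[of \<beta> m "real ?n - 1" "1 - x"] unfolding P_def by (simp only:) simp
    have pp: "pochhammer (\<beta> + 1) m > 0" by (rule pochhammer_pos) (use \<beta> in simp)
    have apos: "a > 0" using \<beta> by (simp add: a_def)
    have g: "Gamma a > 0" "Gamma (\<beta> + 1) > 0" using \<beta> apos by (simp_all add: Gamma_real_pos)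
    have "pochhammer (\<beta> + 1) m = Gamma (\<beta> + 1 + real m) / Gamma (\<beta> + 1)"
      by (rule pochhammer_Gamma) (use \<beta> in \<open>auto elim!: nonpos_Ints_cases\<close>)
    then have GB: "Gamma (\<beta> + 1 + real m) = Gamma (\<beta> + 1) * pochhammer (\<beta> + 1) m" using g by simp
    have "2 * \<nu> - real m = a" "2 * \<nu> - real m - real ?n + 1 = \<beta> + 1 + real m" by (simp_all add: a_def \<beta>_def)
    then have bc: "berg_const TYPE('n) \<nu> m = \<beta> * Gamma a / (fact ?n * (Gamma (\<beta> + 1) * pochhammer (\<beta> + 1) m))"
      unfolding berg_const_def \<beta>_def[symmetric] by (simp only: GB)
    have fn: "fact ?n = real ?n * fact (?n - 1)" using n1 by (simp add: fact_reduce)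
    have aS: "\<bar>S\<bar> = Gamma a / (fact (?n - 1) * fact m) * \<bar>P\<bar>"
      unfolding S using g by (simp add: abs_mult power_abs)
    have aJ: "\<bar>jacobi_poly m (real ?n - 1) \<beta> (1 - 2 * (1 - x))\<bar> = pochhammer (\<beta> + 1) m / fact m * \<bar>P\<bar>"
      unfolding J using pp by (simp add: abs_mult power_abs)
    show ?thesis unfolding aS aJ bc c_def fn using pp g by simp
  qed
  have "(x powr (\<nu> - real m))\<^sup>2 = x powr (2 * (\<nu> - real m))"
    using xpos by (simp add: power2_eq_square powr_add[symmetric])
  then show ?thesis unfolding cm SJ by (simp add: power_mult_distrib)
qed

text \<open>On the diagonal x = 1, so the modulus of the kernel is a constant. The kernel there is a
  sum of squares, hence real and nonnegative, and so equal to its modulus.\<close>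

lemma coh_norm_sums:
  fixes h :: "nat \<Rightarrow> nat \<Rightarrow> nat \<Rightarrow> complex^'n \<Rightarrow> complex"
  assumes s: "rotation_invariant_sphere_measure \<sigma>" and h: "orthonormal_harmonics \<sigma> h"
    and m: "real m < \<nu> - real CARD('n) / 2" and z: "norm z < 1"
  defines "N0 \<equiv> berg_const TYPE('n) \<nu> m * jacobi_poly m (real CARD('n) - 1) (2 * (\<nu> - real m) - real CARD('n)) 1"
  shows "(\<lambda>p. \<Sum>q\<le>m. \<Sum>j = 1..dim_H TYPE('n) p q. (cmod (Phi h \<nu> m p q j z))\<^sup>2) sums N0"
    and "N0 > 0" and "berg_kernel \<nu> m z z = of_real N0"
proof -
  define t where "t p = (\<Sum>q\<le>m. \<Sum>j = 1..dim_H TYPE('n) p q. (cmod (Phi h \<nu> m p q j z))\<^sup>2)" for p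
  define J where "J = jacobi_poly m (real CARD('n) - 1) (2 * (\<nu> - real m) - real CARD('n)) 1"
  have n0: "real CARD('n) > 0" by simp
  have J: "J > 0"
  proof -
    have "J = Gamma (real m + (real CARD('n) - 1) + 1) / (fact m * Gamma (real CARD('n) - 1 + 1))"
      unfolding J_def by (rule jacobi_poly_at_1) (use n0 in linarith)
    also have "\<dots> > 0"
    proof (intro divide_pos_pos mult_pos_pos Gamma_real_pos)
      show "real m + (real CARD('n) - 1) + 1 > 0" using n0 of_nat_0_le_iff[of m] by linarith
    qed (use n0 in auto)
    finally show ?thesis .
  qed
  have bc: "berg_const TYPE('n) \<nu> m > 0" by (rule berg_const_pos[OF m])
  then show N0: "N0 > 0" unfolding N0_def J_def[symmetric] using J by simp
  have "(\<Sum>q\<le>m. \<Sum>j = 1..dim_H TYPE('n) p q. Phi h \<nu> m p q j z * cnj (Phi h \<nu> m p q j z)) = complex_of_real (t p)" for p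
    unfolding t_def of_real_sum complex_norm_square ..
  then have S: "(\<lambda>p. complex_of_real (t p)) sums berg_kernel \<nu> m z z"
    using berg_kernel_sums[OF s h m z z] by simp
  have R: "t sums Re (berg_kernel \<nu> m z z)" using sums_Re[OF S] by simp
  have "berg_kernel \<nu> m z z = of_real (Re (berg_kernel \<nu> m z z))"
    by (rule sums_unique2[OF S]) (rule sums_of_real[OF R])
  moreover have "Re (berg_kernel \<nu> m z z) = N0"
  proof -
    have nn: "Re (berg_kernel \<nu> m z z) \<ge> 0"
      using R by (rule sums_le[OF _ sums_zero, rotated]) (simp add: t_def sum_nonneg)
    have X: "1 - (norm z)\<^sup>2 > 0" using z by (simp add: power_less_one_iff)
    have "cmod (1 - hprod z z) = 1 - (norm z)\<^sup>2"
    proof -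
      have "1 - hprod z z = of_real (1 - (norm z)\<^sup>2)" by (simp add: hprod_self)
      then show ?thesis using X by (simp only: norm_of_real)
    qed
    then have one: "(1 - (norm z)\<^sup>2) * (1 - (norm z)\<^sup>2) / (cmod (1 - hprod z z))\<^sup>2 = 1"
      using X by (simp add: power2_eq_square)
    have "(cmod (berg_kernel \<nu> m z z))\<^sup>2 = N0\<^sup>2"
      unfolding cmod_berg_kernel[OF m z z] one N0_def by (simp add: power_mult_distrib)
    then have "cmod (berg_kernel \<nu> m z z) = N0" using N0 by simp
    moreover have "cmod (berg_kernel \<nu> m z z) = Re (berg_kernel \<nu> m z z)"
      using calculation nn \<open>berg_kernel \<nu> m z z = of_real (Re (berg_kernel \<nu> m z z))\<close> by (metis abs_of_nonneg norm_of_real)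
    ultimately show ?thesis by simp
  qed
  ultimately show "berg_kernel \<nu> m z z = of_real N0" by simp
  show "(\<lambda>p. \<Sum>q\<le>m. \<Sum>j = 1..dim_H TYPE('n) p q. (cmod (Phi h \<nu> m p q j z))\<^sup>2) sums N0"
    using R unfolding t_def[abs_def] \<open>Re (berg_kernel \<nu> m z z) = N0\<close> .
qed

lemma space_mu_n [simp]: "space (mu_n :: (complex^'n) measure) = ball 0 1"
  by (simp add: mu_n_def mu_leb_def space_restrict_space)

lemma measurable_mu_n:
  assumes "f \<in> borel_measurable borel" shows "f \<in> borel_measurable (mu_n :: (complex^'n) measure)"
proof -
  have "f \<in> borel_measurable lebesgue" using assms by (simp add: measurable_completion)
  then have "f \<in> borel_measurable mu_leb" by (simp add: mu_leb_def)
  then show ?thesis by (simp add: mu_n_def measurable_restrict_space1)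
qed

lemma Phi_measurable:
  assumes h: "orthonormal_harmonics \<sigma> h" and j: "j \<in> {1..dim_H TYPE('n::finite) p q}"
  shows "Phi h \<nu> m p q j \<in> borel_measurable (borel :: (complex^'n) measure)"
proof -
  have "h p q j \<in> borel_measurable borel"
    using h j bipoly_cpoly unfolding orthonormal_harmonics_def harmonic_polys_iff
    by (blast intro: borel_measurable_continuous_onI cpoly_continuous)
  then show ?thesis unfolding Phi_radial_part[abs_def] by measurable
qed

theorem proposition4p2:
  fixes \<nu> :: real and m :: nat
    and \<sigma> :: "(complex^'n) measure"
    and h :: "nat \<Rightarrow> nat \<Rightarrow> nat \<Rightarrow> complex^'n \<Rightarrow> complex"
    and sC :: "complex \<Rightarrow> 'h::banach \<Rightarrow> 'h" and ip :: "'h \<Rightarrow> 'h \<Rightarrow> complex"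
    and e :: "nat \<times> nat \<times> nat \<Rightarrow> 'h"
    and \<phi> :: "complex^'n \<Rightarrow> complex" and z :: "complex^'n"
  assumes nu: "\<nu> > real CARD('n) / 2"
    and m: "real m < \<nu> - real CARD('n) / 2"
    and sigma: "rotation_invariant_sphere_measure \<sigma>"
    and h: "orthonormal_harmonics \<sigma> h"
    and hilbert: "complex_hilbert sC ip"
    and e: "orthonormal_basis sC ip (coh_index TYPE('n) m) e"
    and phi_meas: "\<phi> \<in> borel_measurable mu_n"
    and phi_L2: "integrable mu_n (\<lambda>\<xi>. (cmod (\<phi> \<xi>))\<^sup>2)"
    and z: "z \<in> ball 0 1"
  shows "exp_value ip (coh_state sC e h \<nu> m z) (A_op sC ip e h \<nu> m \<phi>) =
    of_real (Gamma (real CARD('n)) * fact m * (2 * (\<nu> - real m) - real CARD('n)) * Gamma (2 * \<nu> - real m)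
       / (fact CARD('n) * Gamma (real CARD('n) + real m) * Gamma (2 * \<nu> - real m - real CARD('n) + 1)))
    * (LINT \<xi>|restrict_space mu_leb (ball 0 1).
         of_real (((1 - (norm z)\<^sup>2) * (1 - (norm \<xi>)\<^sup>2) / (cmod (1 - hprod z \<xi>))\<^sup>2) powr (2 * (\<nu> - real m))
           * (jacobi_poly m (real CARD('n) - 1) (2 * (\<nu> - real m) - real CARD('n))
                (1 - 2 * (tanh (bergman_dist z \<xi>))\<^sup>2))\<^sup>2)
         * (\<phi> \<xi> / of_real ((1 - (norm \<xi>)\<^sup>2) ^ (CARD('n) + 1))))"
proof -
  interpret complex_hilbert sC ip by (rule hilbert)
  define \<beta> where "\<beta> = 2 * (\<nu> - real m) - real CARD('n)"
  have \<beta>: "\<beta> > 0" using m by (simp add: \<beta>_def)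
  define J1 where "J1 = jacobi_poly m (real CARD('n) - 1) \<beta> 1"
  define N0 where "N0 = berg_const TYPE('n) \<nu> m * J1"
  have nz: "norm z < 1" using z by simp
  note cn = coh_norm_sums[OF sigma h m, folded \<beta>_def, folded J1_def, folded N0_def]
  have N0: "N0 > 0" by (rule cn(2)[OF nz])
  have cnorm: "coh_norm h \<nu> m w = N0" if "norm w < 1" for w
    unfolding coh_norm_def by (rule sums_unique[OF cn(1)[OF that], symmetric])
  define I where "I = coh_index TYPE('n) m"
  \<comment> \<open>The finitely many basis indices of one degree p, so that the nested sums of the
    coherent state become the block sums of \<open>ip_blocks_basis\<close>.\<close>
  define B where "B p = {(p', q, j). p' = p \<and> q \<le> m \<and> j \<in> {1..dim_H TYPE('n) p q}}" for p
  have Bim: "B p = (\<lambda>(q, j). (p, q, j)) ` (SIGMA q:{..m}. {1..dim_H TYPE('n) p q})" for p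
    by (auto simp: B_def image_iff)
  have injB: "inj_on (\<lambda>(q, j). (p, q, j)) S" for p :: nat and S :: "(nat \<times> nat) set"
    by (auto simp: inj_on_def)
  have B: "finite (B p)" "B p \<subseteq> I" "p \<noteq> p' \<Longrightarrow> B p \<inter> B p' = {}" for p p'
  proof -
    show "finite (B p)" unfolding Bim by simp
  qed (auto simp: B_def I_def coh_index_def)
  have IB: "I \<subseteq> (\<Union>p. B p)" by (auto simp: B_def I_def coh_index_def)
  have sumBh: "(\<Sum>q\<le>m. \<Sum>j = 1..dim_H TYPE('n) p q. g (p, q, j)) = sum g (B p)" for p and g :: "nat \<times> nat \<times> nat \<Rightarrow> 'h"
    unfolding Bim sum.reindex[OF injB] by (subst sum.Sigma) (auto simp: case_prod_unfold)
  have sumBc: "(\<Sum>q\<le>m. \<Sum>j = 1..dim_H TYPE('n) p q. g (p, q, j)) = sum g (B p)" for p and g :: "nat \<times> nat \<times> nat \<Rightarrow> complex"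
    unfolding Bim sum.reindex[OF injB] by (subst sum.Sigma) (auto simp: case_prod_unfold)
  have sumBr: "(\<Sum>q\<le>m. \<Sum>j = 1..dim_H TYPE('n) p q. g (p, q, j)) = sum g (B p)" for p and g :: "nat \<times> nat \<times> nat \<Rightarrow> real"
    unfolding Bim sum.reindex[OF injB] by (subst sum.Sigma) (auto simp: case_prod_unfold)
  have on: "ip (e i) (e k) = (if i = k then 1 else 0)" if "i \<in> I" "k \<in> I" for i k
    using e that by (auto simp: orthonormal_basis_def I_def)
  define F where "F w i = (case i of (p, q, j) \<Rightarrow> Phi h \<nu> m p q j w)" for w and i :: "nat \<times> nat \<times> nat"
  have sm: "summable (\<lambda>p. \<Sum>i\<in>B p. (cmod (F w i))\<^sup>2)" if "norm w < 1" for w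
    using cn(1)[OF that] unfolding sumBr[symmetric] F_def by (auto intro: sums_summable)
  define x where "x w = (\<Sum>p. \<Sum>i\<in>B p. sC (F w i) (e i))" for w
  have xs: "(\<lambda>p. \<Sum>i\<in>B p. sC (F w i) (e i)) sums x w" if "norm w < 1" for w
    unfolding x_def by (intro summable_sums summable_blocks[OF on B sm[OF that]])
  define c where "c = coh_state sC e h \<nu> m"
  have c: "c w = N0 powr (- 1 / 2) *\<^sub>R x w" if "norm w < 1" for w
    unfolding c_def coh_state_def cnorm[OF that] x_def sumBh[symmetric] by (simp add: F_def)
  have xe: "ip (x w) (e i) = F w i" if w: "norm w < 1" and i: "i \<in> I" for w i
  proof -
    obtain p where p: "i \<in> B p" using i IB by blast
    show ?thesis unfolding x_def by (rule ip_blocks_basis[OF on B sm[OF w] p])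
  qed
  have ux: "(\<lambda>p. \<Sum>i\<in>B p. cnj (F w i) * ip u (e i)) sums ip u (x w)" if "norm w < 1" for u w
    using bounded_linear.sums[OF bounded_linear_ip_right xs[OF that], of u]
    by (simp add: ip_sum_right ip_sC_right)
  have xx: "ip (x w) (x w') = berg_kernel \<nu> m w w'" if w: "norm w < 1" and w': "norm w' < 1" for w w'
  proof -
    have "(\<lambda>p. \<Sum>i\<in>B p. cnj (F w' i) * ip (x w) (e i)) sums ip (x w) (x w')" by (rule ux[OF w'])
    moreover have "(\<Sum>i\<in>B p. cnj (F w' i) * ip (x w) (e i)) = (\<Sum>q\<le>m. \<Sum>j = 1..dim_H TYPE('n) p q. Phi h \<nu> m p q j w * cnj (Phi h \<nu> m p q j w'))" for p
    proof -
      have "(\<Sum>i\<in>B p. cnj (F w' i) * ip (x w) (e i)) = (\<Sum>i\<in>B p. F w i * cnj (F w' i))"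
        using B(2) by (intro sum.cong refl) (auto simp: xe[OF w] subset_iff)
      then show ?thesis unfolding sumBc[symmetric] by (simp add: F_def)
    qed
    ultimately show ?thesis using berg_kernel_sums[OF sigma h m w w'] sums_unique2 by simp
  qed
  have Npow: "N0 powr (- 1 / 2) * N0 powr (- 1 / 2) = 1 / N0"
    using N0 by (simp add: powr_add[symmetric] powr_minus_divide)
  have cc: "ip (c w) (c w') = berg_kernel \<nu> m w w' / of_real N0" if "norm w < 1" "norm w' < 1" for w w'
  proof -
    have "ip (c w) (c w') = of_real (N0 powr (- 1 / 2) * N0 powr (- 1 / 2)) * berg_kernel \<nu> m w w'"
      unfolding c[OF that(1)] c[OF that(2)] ip_scaleR_left ip_scaleR_right xx[OF that] by simp
    then show ?thesis unfolding Npow by simp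
  qed
  have nc: "norm (c w) \<le> 1" if "norm w < 1" for w
  proof -
    have "of_real ((norm (c w))\<^sup>2) = (of_real 1 :: complex)"
      unfolding ip_self[symmetric] cc[OF that that] cn(3)[OF that] using N0 by simp
    then have "(norm (c w))\<^sup>2 = 1" using of_real_eq_iff by blast
    then show ?thesis using power2_eq_imp_eq[of "norm (c w)" 1] by simp
  qed
  \<comment> \<open>Partial sums of the pairing of u with the unnormalized state x w: Borel
    functions on the whole space, to which \<open>coherent_bessel\<close> applies with coefficients
    ip u (e i).\<close>
  define U where "U u P w = (\<Sum>p<P. \<Sum>q\<le>m. \<Sum>j = 1..dim_H TYPE('n) p q. cnj (Phi h \<nu> m p q j w) * ip u (e (p, q, j)))" for u P w
  have Ulim: "(\<lambda>P. U u P w) \<longlonglongrightarrow> ip u (x w)" if "norm w < 1" for u w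
    using ux[OF that, of u] unfolding sums_def sumBc[symmetric] U_def F_def by simp
  have Um [measurable]: "U u P \<in> borel_measurable borel" for u P
  proof -
    have "(\<lambda>w. cnj (Phi h \<nu> m p q j w) * ip u (e (p, q, j))) \<in> borel_measurable borel" if "j \<in> {1..dim_H TYPE('n) p q}" for p q j
      using measurable_compose[OF Phi_measurable[OF h that] borel_measurable_continuous_onI[OF continuous_on_cnj[OF continuous_on_id]]]
      by measurable
    then show ?thesis unfolding U_def[abs_def] by (intro borel_measurable_sum) auto
  qed
  have uxm: "(\<lambda>w. ip u (x w)) \<in> borel_measurable mu_n" for u
    by (rule borel_measurable_LIMSEQ_metric[where f = "U u"]) (auto intro: measurable_mu_n Um Ulim)
  have ucm: "(\<lambda>w. ip u (c w)) \<in> borel_measurable mu_n" for u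
  proof -
    have "(\<lambda>w. of_real (N0 powr (- 1 / 2)) * ip u (x w)) \<in> borel_measurable mu_n"
      by (intro borel_measurable_times borel_measurable_const uxm)
    moreover have "ip u (c w) = of_real (N0 powr (- 1 / 2)) * ip u (x w)" if w: "w \<in> space mu_n" for w
    proof -
      have "norm w < 1" using w by simp
      then show ?thesis by (simp only: c ip_scaleR_right)
    qed
    ultimately show ?thesis by (rule measurable_cong[THEN iffD2, rotated])
  qed
  obtain K where K: "K \<ge> 0" "\<And>P b. (\<integral>\<^sup>+z. ennreal ((norm (\<Sum>p<P. \<Sum>q\<le>m. \<Sum>j = 1..dim_H TYPE('n) p q. cnj (Phi h \<nu> m p q j z) * b p q j))\<^sup>2) \<partial>muB)
      \<le> ennreal (K * (\<Sum>p<P. \<Sum>q\<le>m. \<Sum>j = 1..dim_H TYPE('n) p q. (norm (b p q j))\<^sup>2))"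
    using coherent_bessel[OF sigma h \<beta>_def \<beta>] by blast
  define vi where "vi = 1 / emeasure lebesgue (ball 0 1 :: (complex^'n) set)"
  have vi: "vi < \<infinity>"
  proof -
    have "unit_ball_vol (real CARD('n) * 2) \<noteq> 0" by (rule less_imp_neq[OF unit_ball_vol_pos, symmetric]) simp
    then have "emeasure lborel (ball 0 1 :: (complex^'n) set) \<noteq> 0" by (simp add: emeasure_ball)
    then show ?thesis by (auto simp: vi_def less_top[symmetric] ennreal_divide_eq_top_iff)
  qed
  have UK: "(\<integral>\<^sup>+w. ennreal ((norm (U u P w))\<^sup>2) \<partial>mu_n) \<le> vi * ennreal (K * (norm u)\<^sup>2)" for u P
  proof -
    have "(\<Sum>p<P. \<Sum>q\<le>m. \<Sum>j = 1..dim_H TYPE('n) p q. (norm (ip u (e (p, q, j))))\<^sup>2) = (\<Sum>i\<in>(\<Union>p\<in>{..<P}. B p). (norm (ip u (e i)))\<^sup>2)"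
      unfolding sumBr[where g = "\<lambda>i. (norm (ip u (e i)))\<^sup>2"] by (rule sum.UNION_disjoint[symmetric]) (simp_all add: B)
    also have "\<dots> \<le> (norm u)\<^sup>2"
    proof (rule bessel)
      have "(\<Union>p\<in>{..<P}. B p) \<subseteq> I" using B(2) by blast
      then show "ip (e i) (e k) = (if i = k then 1 else 0)" if "i \<in> (\<Union>p\<in>{..<P}. B p)" "k \<in> (\<Union>p\<in>{..<P}. B p)" for i k
        using on that by blast
    qed (simp add: B)
    finally have "K * (\<Sum>p<P. \<Sum>q\<le>m. \<Sum>j = 1..dim_H TYPE('n) p q. (norm (ip u (e (p, q, j))))\<^sup>2) \<le> K * (norm u)\<^sup>2"
      using K(1) by (rule mult_left_mono)
    then have "(\<integral>\<^sup>+w. ennreal ((norm (U u P w))\<^sup>2) \<partial>muB) \<le> ennreal (K * (norm u)\<^sup>2)"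
      using K(2)[where P = P and b = "\<lambda>p q j. ip u (e (p, q, j))"] unfolding U_def by (meson ennreal_leI order_trans)
    then have "vi * (\<integral>\<^sup>+w. ennreal ((norm (U u P w))\<^sup>2) \<partial>muB) \<le> vi * ennreal (K * (norm u)\<^sup>2)"
      by (rule mult_left_mono) simp
    moreover have "(\<integral>\<^sup>+w. ennreal ((norm (U u P w))\<^sup>2) \<partial>mu_n) = vi * (\<integral>\<^sup>+w. ennreal ((norm (U u P w))\<^sup>2) \<partial>muB)"
      unfolding vi_def by (rule nn_integral_mu_n) measurable
    ultimately show ?thesis by simp
  qed
  \<comment> \<open>Fatou's lemma: the partial sums converge inside the ball, and their squared
    norms are bounded by \<open>UK\<close> independently of P.\<close>
  have ux2: "integrable mu_n (\<lambda>w. (norm (ip u (x w)))\<^sup>2)" for u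
  proof (rule integrableI_bounded)
    show "(\<lambda>w. (norm (ip u (x w)))\<^sup>2) \<in> borel_measurable mu_n" using uxm by measurable
    have "(\<integral>\<^sup>+w. ennreal (norm ((norm (ip u (x w)))\<^sup>2)) \<partial>mu_n) = (\<integral>\<^sup>+w. liminf (\<lambda>P. ennreal ((norm (U u P w))\<^sup>2)) \<partial>mu_n)"
    proof (rule nn_integral_cong)
      fix w :: "complex^'n" assume "w \<in> space mu_n"
      then have "(\<lambda>P. ennreal ((norm (U u P w))\<^sup>2)) \<longlonglongrightarrow> ennreal ((norm (ip u (x w)))\<^sup>2)"
        by (intro tendsto_ennrealI tendsto_intros Ulim) simp
      then show "ennreal (norm ((norm (ip u (x w)))\<^sup>2)) = liminf (\<lambda>P. ennreal ((norm (U u P w))\<^sup>2))"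
        using lim_imp_Liminf[OF sequentially_bot] by fastforce
    qed
    also have "\<dots> \<le> liminf (\<lambda>P. \<integral>\<^sup>+w. ennreal ((norm (U u P w))\<^sup>2) \<partial>mu_n)"
      by (rule nn_integral_liminf) (intro measurable_mu_n, measurable)
    also have "\<dots> \<le> liminf (\<lambda>P :: nat. vi * ennreal (K * (norm u)\<^sup>2))"
      by (rule Liminf_mono) (simp add: UK)
    also have "\<dots> = vi * ennreal (K * (norm u)\<^sup>2)" by (rule Liminf_const) simp
    also have "\<dots> < \<infinity>" using vi by (simp add: ennreal_mult_less_top)
    finally show "(\<integral>\<^sup>+w. ennreal (norm ((norm (ip u (x w)))\<^sup>2)) \<partial>mu_n) < \<infinity>" .
  qed
  define g where "g w = \<phi> w * of_real (coh_norm h \<nu> m w)" for w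
  have gm: "g \<in> borel_measurable mu_n"
  proof -
    have "(\<lambda>w. \<phi> w * of_real N0) \<in> borel_measurable mu_n"
      by (intro borel_measurable_times borel_measurable_const phi_meas)
    moreover have "g w = \<phi> w * of_real N0" if w: "w \<in> space mu_n" for w
    proof -
      have "norm w < 1" using w by simp
      then show ?thesis by (simp only: g_def cnorm)
    qed
    ultimately show ?thesis by (rule measurable_cong[THEN iffD2, rotated])
  qed
  \<comment> \<open>Up to constants the integrand is a product of two square-integrable functions,
    \<phi> and the pairing with x w; the product is at most the sum of the squares.\<close>
  have gint: "integrable mu_n (\<lambda>w. g w * ip u (c w))" for u
  proof (rule Bochner_Integration.integrable_bound)
    show "integrable mu_n (\<lambda>w. (N0 * N0 powr (- 1 / 2)) * ((norm (\<phi> w))\<^sup>2 + (norm (ip u (x w)))\<^sup>2))"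
      by (intro integrable_mult_right Bochner_Integration.integrable_add phi_L2 ux2)
    show "(\<lambda>w. g w * ip u (c w)) \<in> borel_measurable mu_n" by (intro borel_measurable_times gm ucm)
    show "AE w in mu_n. norm (g w * ip u (c w)) \<le> norm ((N0 * N0 powr (- 1 / 2)) * ((norm (\<phi> w))\<^sup>2 + (norm (ip u (x w)))\<^sup>2))"
    proof (rule AE_I2)
      fix w :: "complex^'n" assume "w \<in> space mu_n"
      then have w: "norm w < 1" by simp
      have "norm (g w * ip u (c w)) = (N0 * N0 powr (- 1 / 2)) * (norm (\<phi> w) * norm (ip u (x w)))"
        unfolding g_def c[OF w] ip_scaleR_right cnorm[OF w] using N0 by (simp add: norm_mult)
      also have "\<dots> \<le> (N0 * N0 powr (- 1 / 2)) * ((norm (\<phi> w))\<^sup>2 + (norm (ip u (x w)))\<^sup>2)"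
      proof (rule mult_left_mono)
        have "0 \<le> (norm (\<phi> w) - norm (ip u (x w)))\<^sup>2" by simp
        then show "norm (\<phi> w) * norm (ip u (x w)) \<le> (norm (\<phi> w))\<^sup>2 + (norm (ip u (x w)))\<^sup>2"
          unfolding power2_diff using mult_nonneg_nonneg[OF norm_ge_zero norm_ge_zero, of "\<phi> w" "ip u (x w)"] by linarith
      qed (use N0 in simp)
      finally show "norm (g w * ip u (c w)) \<le> norm ((N0 * N0 powr (- 1 / 2)) * ((norm (\<phi> w))\<^sup>2 + (norm (ip u (x w)))\<^sup>2))"
        by simp
    qed
  qed
  have "exp_value ip (c z) (A_op sC ip e h \<nu> m \<phi>) = (LINT w|mu_n. g w * ip (c z) (c w) * ip (c w) (c z))"
    unfolding exp_value_def A_op_def c_def[symmetric] g_def[symmetric]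
    by (rule weak_integral_ip[OF e[folded I_def] B IB gm ucm _ gint]) (auto intro: nc)
  also have "\<dots> = (LINT w|restrict_space mu_leb (ball 0 1). (1 / (1 - (norm w)\<^sup>2) ^ (CARD('n) + 1)) *\<^sub>R (g w * ip (c z) (c w) * ip (c w) (c z)))"
  proof -
    have cn: "ip (c w) (c z) = cnj (ip (c z) (c w))" for w by (rule ip_commute)
    have "(\<lambda>w. cnj (ip (c z) (c w))) \<in> borel_measurable mu_n"
      by (rule measurable_compose[OF ucm borel_measurable_continuous_onI[OF continuous_on_cnj[OF continuous_on_id]]])
    then have m1: "(\<lambda>w. g w * ip (c z) (c w) * ip (c w) (c z)) \<in> borel_measurable (restrict_space mu_leb (ball 0 1))"
      unfolding cn using gm ucm[of "c z"] by (auto simp: mu_n_def)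
    have "(\<lambda>w :: complex^'n. 1 / (1 - (norm w)\<^sup>2) ^ (CARD('n) + 1)) \<in> borel_measurable borel" by measurable
    then have m2: "(\<lambda>w :: complex^'n. 1 / (1 - (norm w)\<^sup>2) ^ (CARD('n) + 1)) \<in> borel_measurable (restrict_space mu_leb (ball 0 1))"
      using measurable_mu_n by (fastforce simp: mu_n_def)
    have "AE w in restrict_space mu_leb (ball 0 1). 0 \<le> 1 / (1 - (norm (w :: complex^'n))\<^sup>2) ^ (CARD('n) + 1)"
      by (rule AE_I2) (auto simp: space_restrict_space mu_leb_def power_le_one_iff)
    then show ?thesis unfolding mu_n_def by (rule integral_density[OF m1 m2])
  qed
  also have "\<dots> = (LINT \<xi>|restrict_space mu_leb (ball 0 1).
       of_real (Gamma (real CARD('n)) * fact m * (2 * (\<nu> - real m) - real CARD('n)) * Gamma (2 * \<nu> - real m)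
       / (fact CARD('n) * Gamma (real CARD('n) + real m) * Gamma (2 * \<nu> - real m - real CARD('n) + 1)))
       * (of_real (((1 - (norm z)\<^sup>2) * (1 - (norm \<xi>)\<^sup>2) / (cmod (1 - hprod z \<xi>))\<^sup>2) powr (2 * (\<nu> - real m))
           * (jacobi_poly m (real CARD('n) - 1) (2 * (\<nu> - real m) - real CARD('n))
                (1 - 2 * (tanh (bergman_dist z \<xi>))\<^sup>2))\<^sup>2)
         * (\<phi> \<xi> / of_real ((1 - (norm \<xi>)\<^sup>2) ^ (CARD('n) + 1)))))"
  proof (rule Bochner_Integration.integral_cong[OF refl])
    fix w :: "complex^'n" assume "w \<in> space (restrict_space mu_leb (ball 0 1))"
    then have w: "norm w < 1" by (simp add: space_restrict_space)
    define C where "C = Gamma (real CARD('n)) * fact m * (2 * (\<nu> - real m) - real CARD('n)) * Gamma (2 * \<nu> - real m)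
       / (fact CARD('n) * Gamma (real CARD('n) + real m) * Gamma (2 * \<nu> - real m - real CARD('n) + 1))"
    define Q where "Q = ((1 - (norm z)\<^sup>2) * (1 - (norm w)\<^sup>2) / (cmod (1 - hprod z w))\<^sup>2) powr (2 * (\<nu> - real m))
           * (jacobi_poly m (real CARD('n) - 1) (2 * (\<nu> - real m) - real CARD('n)) (1 - 2 * (tanh (bergman_dist z w))\<^sup>2))\<^sup>2"
    have kQ: "(cmod (berg_kernel \<nu> m z w))\<^sup>2 = (berg_const TYPE('n) \<nu> m)\<^sup>2 * Q"
      unfolding cmod_berg_kernel[OF m nz w] Q_def tanh_bergman_dist[OF nz w] by simp
    have n0: "real CARD('n) > 0" by simp
    have J1: "J1 = Gamma (real CARD('n) + real m) / (fact m * Gamma (real CARD('n)))"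
    proof -
      have "J1 = Gamma (real m + (real CARD('n) - 1) + 1) / (fact m * Gamma (real CARD('n) - 1 + 1))"
        unfolding J1_def by (rule jacobi_poly_at_1) (use n0 in linarith)
      then show ?thesis by (simp add: add.commute)
    qed
    have bp: "berg_const TYPE('n) \<nu> m > 0" by (rule berg_const_pos[OF m])
    \<comment> \<open>One factor of \<open>berg_const\<close> cancels against N0; the remaining
      division by J1 = P_m(1) brings in m!, \<Gamma>(n) and \<Gamma>(n+m).\<close>
    have NC: "(berg_const TYPE('n) \<nu> m)\<^sup>2 / N0 = C"
    proof -
      have "(berg_const TYPE('n) \<nu> m)\<^sup>2 / N0 = berg_const TYPE('n) \<nu> m / J1"
        unfolding N0_def using bp by (simp add: power2_eq_square)
      also have "\<dots> = C" unfolding J1 berg_const_def C_def by (simp add: mult_ac)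
      finally show ?thesis .
    qed
    have "g w * ip (c z) (c w) * ip (c w) (c z) = \<phi> w * of_real ((cmod (berg_kernel \<nu> m z w))\<^sup>2 / N0)"
    proof -
      have "ip (c w) (c z) = cnj (berg_kernel \<nu> m z w / of_real N0)"
        unfolding cc[OF nz w, symmetric] by (rule ip_commute)
      then show ?thesis
        unfolding g_def cnorm[OF w] cc[OF nz w] of_real_divide complex_norm_square using N0 by (simp add: divide_simps)
    qed
    also have "(cmod (berg_kernel \<nu> m z w))\<^sup>2 / N0 = C * Q"
      unfolding kQ NC[symmetric] by simp
    finally have eq: "g w * ip (c z) (c w) * ip (c w) (c z) = \<phi> w * of_real (C * Q)" .
    show "(1 / (1 - (norm w)\<^sup>2) ^ (CARD('n) + 1)) *\<^sub>R (g w * ip (c z) (c w) * ip (c w) (c z)) =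
      of_real (Gamma (real CARD('n)) * fact m * (2 * (\<nu> - real m) - real CARD('n)) * Gamma (2 * \<nu> - real m)
       / (fact CARD('n) * Gamma (real CARD('n) + real m) * Gamma (2 * \<nu> - real m - real CARD('n) + 1)))
       * (of_real (((1 - (norm z)\<^sup>2) * (1 - (norm w)\<^sup>2) / (cmod (1 - hprod z w))\<^sup>2) powr (2 * (\<nu> - real m))
           * (jacobi_poly m (real CARD('n) - 1) (2 * (\<nu> - real m) - real CARD('n))
                (1 - 2 * (tanh (bergman_dist z w))\<^sup>2))\<^sup>2)
         * (\<phi> w / of_real ((1 - (norm w)\<^sup>2) ^ (CARD('n) + 1))))"
      unfolding C_def[symmetric] Q_def[symmetric] eq by (simp add: scaleR_conv_of_real mult_ac)
  qed
  finally show ?thesis unfolding c_def Bochner_Integration.integral_mult_right_zero .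
qed

end
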